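(* (i) There exist compact 8-manifolds with an integrable $PSU(3)$-structure with non-vanishing torsion whose metric is not Einstein. On the other hand, vanishing torsion of an integrable $PSU(3)$-structure does not imply Ricci-flatness of its metric. Moreover, there exist local (i.e. on some open 8-manifold) integrable $PSU(3)$-structures with non-vanishing torsion whose metric is Ricci-flat. (ii) There exist compact 8-manifolds with an integrable structure of type $3_+$ with non-vanishing torsion. Moreover, there exist local integrable structures of type $2_0$ and of type $3_0$ with non-vanishing torsion whose metric is Ricci-flat.
   Context: $\nabla$ denotes the Levi-Civita connection. $PSU(3)$-structures: on $\mathbb{R}^8$ let $\rho_0=e^{123}+\frac12e^1(e^{47}-e^{56})+\frac12e^2(e^{46}+e^{57})+\frac12e^3(e^{45}-e^{67})+\frac{\sqrt3}{2}e^8(e^{45}+e^{67})$, whose stabiliser in $GL_+(8)$ is $PSU(3)\subset SO(8)$ (adjoint representation). A $PSU(3)$-structure on an oriented $M^8$ is a 3-form $\rho$ given at each point by $\rho_0$ in some oriented frame; these frames are declared orthonormal, defining the metric. It is integrable if $d\rho=0$ and $d\star\rho=0$. Its torsion is the section $T$ of $T^*M\otimes\mathfrak{su}(3)^\perp$ (orthogonal complement in $\mathfrak{so}(8)=\Lambda^2$) with $\nabla\rho=T(\rho)$; it vanishes iff $\nabla\rho=0$. Types $2_0$, $3_0$: a Riemannian oriented 8-manifold with a 3-form $\rho$ of unit norm such that at each point $g([x,y],z)=\rho(x,y,z)$ defines a Lie bracket on the tangent space isomorphic to $\mathfrak{su}(2)\oplus\mathfrak{su}(2)\oplus\mathbb{R}^2$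 (type $2_0$), respectively $\mathfrak{su}(2)\oplus\mathbb{R}^5$ (type $3_0$). Integrable means $d\rho=0$, $d\star\rho=0$; non-vanishing torsion means $\nabla\rho\neq0$. Type $3_+$: an 8-dimensional oriented Riemannian spin manifold with half-spinor bundles $\Delta_\pm$ (real rank 8) and an isometry $\gamma_+:TM\to\Delta_+$ lying in the kernel of Clifford multiplication $\Lambda^1\otimes\Delta_+\to\Delta_-$; by triality this kernel is $\Lambda^3\Delta_-$, and one requires that the 3-form on $\Delta_-$ corresponding to $\gamma_+$ (normalised to unit length) defines, through the inner product $q$ of $\Delta_-$ and $q([x,y],z)$, a Lie bracket isomorphic to $\mathfrak{su}(2)\oplus\mathbb{R}^5$ on each fibre of $\Delta_-$ (equivalently, the structure group $SO(\Delta_-)$ reduces to $SO(3)\times SO(5)$, giving an $Sp(1)\cdot Sp(2)$-structure on $TM$). It is integrable if $\gamma_+$ satisfies $\mathcal{D}\gamma_+=0$ for the twisted Dirac operator $\mathcal{D}(X\otimes\Psi)=\sum_i(\nabla_{e_i}X\otimes e_i\cdot\Psi+X\otimes e_i\cdot\nabla_{e_i}\Psi)$ on $\Lambda^1\otimes(\Delta_+\oplus\Delta_-)$; non-vanishing torsion means $\nabla\gamma_+\neq0$. *)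

theory Defs
  imports "HOL-Analysis.Analysis"
begin

section \<open>Calculus on open subsets of Euclidean space\<close>

definition dir_deriv :: "('a::euclidean_space \<Rightarrow> 'b::real_normed_vector) \<Rightarrow> 'a \<Rightarrow> 'a \<Rightarrow> 'b" where
  "dir_deriv f x u = frechet_derivative f (at x) u"

text \<open>Only used for open \<open>S\<close>.\<close>

primrec Ck_on :: "nat \<Rightarrow> 'a::euclidean_space set \<Rightarrow> ('a \<Rightarrow> 'b::real_normed_vector) \<Rightarrow> bool" where
  "Ck_on 0 S f \<longleftrightarrow> continuous_on S f"
| "Ck_on (Suc k) S f \<longleftrightarrow> f differentiable_on S \<and> (\<forall>u. Ck_on k S (\<lambda>x. dir_deriv f x u))"

definition smooth_on :: "'a::euclidean_space set \<Rightarrow> ('a \<Rightarrow> 'b::real_normed_vector) \<Rightarrow> bool" where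
  "smooth_on S f \<longleftrightarrow> (\<forall>k. Ck_on k S f)"


section \<open>Multilinear algebra\<close>

text \<open>
  A \<open>k\<close>-form on \<open>real^8\<close> is a function on lists of vectors, of which only the values on lists of
  length \<open>k\<close> are meaningful. In the index type \<open>8\<close> the numerals \<open>1, \<dots>, 8\<close> are pairwise distinct
  (with \<open>8 = 0\<close>), so \<open>v $ i\<close> is \<open>e\<^sup>i(v)\<close> in the usual numbering.
\<close>

type_synonym form = "(real^8) list \<Rightarrow> real"

abbreviation ax :: "8 \<Rightarrow> real^8" where
  "ax i \<equiv> axis i 1"

definition idx8 :: "8 list" where
  "idx8 = [1, 2, 3, 4, 5, 6, 7, 8]"

definition alt_form :: "nat \<Rightarrow> form \<Rightarrow> bool" where
  "alt_form k \<omega> \<longleftrightarrow>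
     (\<forall>vs j. length vs = k \<and> j < k \<longrightarrow> linear (\<lambda>u. \<omega> (vs[j := u]))) \<and>
     (\<forall>vs i j. length vs = k \<and> i < j \<and> j < k \<and> vs ! i = vs ! j \<longrightarrow> \<omega> vs = 0)"

text \<open>The determinant of the matrix with rows \<open>vs ! 0, \<dots>, vs ! 7\<close>.\<close>

definition det8 :: form where
  "det8 vs = det ((\<chi> a. the (map_of (zip idx8 vs) a)) :: real^8^8)"

text \<open>Gram matrices \<open>G\<close> represent inner products, here on coordinate vectors.\<close>

definition ip :: "real^8^8 \<Rightarrow> real^8 \<Rightarrow> real^8 \<Rightarrow> real" where
  "ip G u v = u \<bullet> (G *v v)"

definition vol_form :: "real^8^8 \<Rightarrow> form" where
  "vol_form G vs = sqrt (det G) * det8 vs"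

text \<open>
  Hodge star on \<open>k\<close>-forms, normalised by \<open>\<alpha> \<and> \<star>\<omega> = \<langle>\<alpha>, \<omega>\<rangle> vol\<close>. In an oriented orthonormal frame
  it is \<open>\<star>\<omega>(ws) = 1/k! \<Sum> \<omega>(e\<^sub>I) vol(e\<^sub>I, ws)\<close>; in a general basis the inverse metric \<open>\<Sum> e\<^sub>a \<otimes> e\<^sub>a\<close> is
  \<open>\<Sum>\<^sub>i G\<^sup>-\<^sup>1\<partial>\<^sub>i \<otimes> \<partial>\<^sub>i\<close>.
\<close>

definition hodge :: "real^8^8 \<Rightarrow> nat \<Rightarrow> form \<Rightarrow> form" where
  "hodge G k \<omega> ws =
     (\<Sum>is\<in>{l::8 list. length l = k}.
        \<omega> (map (\<lambda>i. matrix_inv G *v ax i) is) * vol_form G (map ax is @ ws)) / fact k"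

text \<open>The squared norm of a 3-form for which the \<open>e\<^sup>i\<^sup>j\<^sup>k\<close> with \<open>i < j < k\<close> are orthonormal.\<close>

definition norm_sq3 :: "real^8^8 \<Rightarrow> form \<Rightarrow> real" where
  "norm_sq3 G \<omega> =
     (\<Sum>i\<in>UNIV. \<Sum>j\<in>UNIV. \<Sum>k\<in>UNIV.
        \<omega> [matrix_inv G *v ax i, matrix_inv G *v ax j, matrix_inv G *v ax k]
        * \<omega> [ax i, ax j, ax k]) / 6"

text \<open>The derivation action of an endomorphism on forms.\<close>

definition act :: "real^8^8 \<Rightarrow> form \<Rightarrow> form" where
  "act B \<omega> vs = - (\<Sum>j<length vs. \<omega> (vs[j := B *v (vs ! j)]))"


section \<open>Lie algebras\<close>

definition lie_iso ::
    "('a::real_vector \<Rightarrow> 'a \<Rightarrow> 'a) \<Rightarrow> 'b::real_vector set \<Rightarrow> ('b \<Rightarrow> 'b \<Rightarrow> 'b) \<Rightarrow> bool" where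
  "lie_iso br L brL \<longleftrightarrow>
     (\<exists>f. linear f \<and> inj f \<and> range f = L \<and> (\<forall>u v. f (br u v) = brL (f u) (f v)))"

definition su2 :: "(complex^2^2) set" where
  "su2 = {A. (\<forall>i j. A $ j $ i = - cnj (A $ i $ j)) \<and> trace A = 0}"

definition comm :: "complex^2^2 \<Rightarrow> complex^2^2 \<Rightarrow> complex^2^2" where
  "comm A B = A ** B - B ** A"

definition is_su2_su2_R2 :: "(real^8 \<Rightarrow> real^8 \<Rightarrow> real^8) \<Rightarrow> bool" where
  "is_su2_su2_R2 br \<longleftrightarrow>
     lie_iso br (su2 \<times> su2 \<times> (UNIV :: (real^2) set))
       (\<lambda>(a, b, z) (a', b', z'). (comm a a', comm b b', 0))"

definition is_su2_R5 :: "(real^8 \<Rightarrow> real^8 \<Rightarrow> real^8) \<Rightarrow> bool" where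
  "is_su2_R5 br \<longleftrightarrow>
     lie_iso br (su2 \<times> (UNIV :: (real^5) set)) (\<lambda>(a, z) (a', z'). (comm a a', 0))"


section \<open>Oriented 8-manifolds\<close>

text \<open>
  A chart is a pair of its domain and its coordinate map. Geometric objects are given by their
  coordinate expressions in the charts of the atlas, as functions on the coordinate domains.
\<close>

type_synonym 'p chart = "'p set \<times> ('p \<Rightarrow> real^8)"

definition cdom :: "'p chart \<Rightarrow> (real^8) set" where
  "cdom c = snd c ` fst c"

definition overlap :: "'p chart \<Rightarrow> 'p chart \<Rightarrow> (real^8) set" where
  "overlap c d = snd c ` (fst c \<inter> fst d)"

text \<open>The coordinate change from \<open>c\<close>-coordinates to \<open>d\<close>-coordinates, and its Jacobian matrix.\<close>

definition coord_change :: "'p chart \<Rightarrow> 'p chart \<Rightarrow> real^8 \<Rightarrow> real^8" where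
  "coord_change c d = snd d \<circ> inv_into (fst c) (snd c)"

definition jac :: "'p chart \<Rightarrow> 'p chart \<Rightarrow> real^8 \<Rightarrow> real^8^8" where
  "jac c d x = matrix (dir_deriv (coord_change c d) x)"

definition is_chart :: "'p topology \<Rightarrow> 'p chart \<Rightarrow> bool" where
  "is_chart X c \<longleftrightarrow>
     openin X (fst c) \<and> open (cdom c) \<and>
     homeomorphic_map (subtopology X (fst c)) (top_of_set (cdom c)) (snd c)"

text \<open>Manifolds are non-empty and connected; the orientation is the one for which the charts
  of the atlas are oriented.\<close>

definition oriented_manifold8 :: "'p topology \<Rightarrow> 'p chart set \<Rightarrow> bool" where
  "oriented_manifold8 X A \<longleftrightarrow>
     Hausdorff_space X \<and> second_countable X \<and> connected_space X \<and> topspace X \<noteq> {} \<and>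
     (\<forall>c\<in>A. is_chart X c) \<and> (\<Union>c\<in>A. fst c) = topspace X \<and>
     (\<forall>c\<in>A. \<forall>d\<in>A. smooth_on (overlap c d) (coord_change c d) \<and> (\<forall>x\<in>overlap c d. det (jac c d x) > 0))"

type_synonym 'p metric_field = "'p chart \<Rightarrow> real^8 \<Rightarrow> real^8^8"
type_synonym 'p form_field = "'p chart \<Rightarrow> real^8 \<Rightarrow> form"

definition riemannian_metric :: "'p chart set \<Rightarrow> 'p metric_field \<Rightarrow> bool" where
  "riemannian_metric A g \<longleftrightarrow>
     (\<forall>c\<in>A. smooth_on (cdom c) (g c) \<and>
        (\<forall>x\<in>cdom c. transpose (g c x) = g c x \<and> (\<forall>v. v \<noteq> 0 \<longrightarrow> ip (g c x) v v > 0))) \<and>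
     (\<forall>c\<in>A. \<forall>d\<in>A. \<forall>x\<in>overlap c d. \<forall>u v.
        ip (g d (coord_change c d x)) (jac c d x *v u) (jac c d x *v v) = ip (g c x) u v)"

definition diff_form :: "'p chart set \<Rightarrow> nat \<Rightarrow> 'p form_field \<Rightarrow> bool" where
  "diff_form A k \<omega> \<longleftrightarrow>
     (\<forall>c\<in>A. (\<forall>vs. length vs = k \<longrightarrow> smooth_on (cdom c) (\<lambda>x. \<omega> c x vs)) \<and>
        (\<forall>x\<in>cdom c. alt_form k (\<omega> c x))) \<and>
     (\<forall>c\<in>A. \<forall>d\<in>A. \<forall>x\<in>overlap c d. \<forall>vs. length vs = k \<longrightarrow>
        \<omega> d (coord_change c d x) (map ((*v) (jac c d x)) vs) = \<omega> c x vs)"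


section \<open>Riemannian geometry in coordinates\<close>

definition ext_deriv :: "(real^8 \<Rightarrow> form) \<Rightarrow> real^8 \<Rightarrow> form" where
  "ext_deriv \<omega> x vs =
     (\<Sum>j<length vs. (-1) ^ j * dir_deriv (\<lambda>y. \<omega> y (take j vs @ drop (Suc j) vs)) x (vs ! j))"

text \<open>The Levi-Civita derivative of the constant field \<open>v\<close> in the direction \<open>u\<close>, by Koszul's
  formula for constant (hence commuting) fields.\<close>

definition christoffel :: "(real^8 \<Rightarrow> real^8^8) \<Rightarrow> real^8 \<Rightarrow> real^8 \<Rightarrow> real^8 \<Rightarrow> real^8" where
  "christoffel G x u v = matrix_inv (G x) *v
     (\<chi> k. (dir_deriv (\<lambda>y. ip (G y) v (ax k)) x u + dir_deriv (\<lambda>y. ip (G y) u (ax k)) x v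
            - dir_deriv (\<lambda>y. ip (G y) u v) x (ax k)) / 2)"

definition nabla_vec :: "(real^8 \<Rightarrow> real^8^8) \<Rightarrow> real^8 \<Rightarrow> real^8 \<Rightarrow> (real^8 \<Rightarrow> real^8) \<Rightarrow> real^8" where
  "nabla_vec G x u Y = dir_deriv Y x u + christoffel G x u (Y x)"

definition nabla_form :: "(real^8 \<Rightarrow> real^8^8) \<Rightarrow> (real^8 \<Rightarrow> form) \<Rightarrow> real^8 \<Rightarrow> real^8 \<Rightarrow> form" where
  "nabla_form G \<omega> x u vs =
     dir_deriv (\<lambda>y. \<omega> y vs) x u
     - (\<Sum>j<length vs. \<omega> x (vs[j := christoffel G x u (vs ! j)]))"

definition curvature ::
    "(real^8 \<Rightarrow> real^8^8) \<Rightarrow> real^8 \<Rightarrow> real^8 \<Rightarrow> real^8 \<Rightarrow> real^8 \<Rightarrow> real^8" where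
  "curvature G x u v w =
     nabla_vec G x u (\<lambda>y. christoffel G y v w) - nabla_vec G x v (\<lambda>y. christoffel G y u w)"

definition ricci :: "(real^8 \<Rightarrow> real^8^8) \<Rightarrow> real^8 \<Rightarrow> real^8 \<Rightarrow> real^8 \<Rightarrow> real" where
  "ricci G x v w = (\<Sum>k\<in>UNIV. curvature G x (ax k) v w $ k)"

definition einstein :: "'p chart set \<Rightarrow> 'p metric_field \<Rightarrow> bool" where
  "einstein A g \<longleftrightarrow>
     (\<exists>\<kappa>::real. \<forall>c\<in>A. \<forall>x\<in>cdom c. \<forall>v w. ricci (g c) x v w = \<kappa> * ip (g c x) v w)"

definition ricci_flat :: "'p chart set \<Rightarrow> 'p metric_field \<Rightarrow> bool" where
  "ricci_flat A g \<longleftrightarrow> (\<forall>c\<in>A. \<forall>x\<in>cdom c. \<forall>v w. ricci (g c) x v w = 0)"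

definition closed_form :: "'p chart set \<Rightarrow> nat \<Rightarrow> 'p form_field \<Rightarrow> bool" where
  "closed_form A k \<omega> \<longleftrightarrow>
     (\<forall>c\<in>A. \<forall>x\<in>cdom c. \<forall>vs. length vs = Suc k \<longrightarrow> ext_deriv (\<omega> c) x vs = 0)"

definition integrable3 :: "'p chart set \<Rightarrow> 'p metric_field \<Rightarrow> 'p form_field \<Rightarrow> bool" where
  "integrable3 A g \<rho> \<longleftrightarrow>
     closed_form A 3 \<rho> \<and> closed_form A 5 (\<lambda>c x. hodge (g c x) 3 (\<rho> c x))"

definition parallel3 :: "'p chart set \<Rightarrow> 'p metric_field \<Rightarrow> 'p form_field \<Rightarrow> bool" where
  "parallel3 A g \<rho> \<longleftrightarrow>
     (\<forall>c\<in>A. \<forall>x\<in>cdom c. \<forall>u vs. length vs = 3 \<longrightarrow> nabla_form (g c) (\<rho> c) x u vs = 0)"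


section \<open>\<open>PSU(3)\<close>-structures\<close>

text \<open>\<open>e3 a b c\<close> is \<open>e\<^sup>a \<and> e\<^sup>b \<and> e\<^sup>c\<close> (meaningful on lists of three vectors).\<close>

definition e3 :: "8 \<Rightarrow> 8 \<Rightarrow> 8 \<Rightarrow> form" where
  "e3 a b c vs = (let u = vs ! 0; v = vs ! 1; w = vs ! 2 in
       u $ a * (v $ b * w $ c - v $ c * w $ b)
     - u $ b * (v $ a * w $ c - v $ c * w $ a)
     + u $ c * (v $ a * w $ b - v $ b * w $ a))"

definition rho0 :: form where
  "rho0 vs = e3 1 2 3 vs
     + 1/2 * (e3 1 4 7 vs - e3 1 5 6 vs)
     + 1/2 * (e3 2 4 6 vs + e3 2 5 7 vs)
     + 1/2 * (e3 3 4 5 vs - e3 3 6 7 vs)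
     + sqrt 3 / 2 * (e3 8 4 5 vs + e3 8 6 7 vs)"

text \<open>
  The columns of \<open>E\<close> form an oriented frame in which \<open>\<rho>\<close> is \<open>\<rho>\<^sub>0\<close>. As the stabiliser of \<open>\<rho>\<^sub>0\<close>
  in \<open>GL\<^sub>+(8)\<close> lies in \<open>SO(8)\<close>, all such frames at a point are orthonormal for the same inner
  product, so that \<open>g\<close> below is the metric determined by \<open>\<rho>\<close>.
\<close>

definition psu3_frame :: "form \<Rightarrow> real^8^8 \<Rightarrow> bool" where
  "psu3_frame \<rho> E \<longleftrightarrow> det E > 0 \<and> (\<forall>vs. length vs = 3 \<longrightarrow> \<rho> (map ((*v) E) vs) = rho0 vs)"

definition psu3_structure ::
    "'p topology \<Rightarrow> 'p chart set \<Rightarrow> 'p metric_field \<Rightarrow> 'p form_field \<Rightarrow> bool" where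
  "psu3_structure X A g \<rho> \<longleftrightarrow>
     oriented_manifold8 X A \<and> riemannian_metric A g \<and> diff_form A 3 \<rho> \<and>
     (\<forall>c\<in>A. \<forall>x\<in>cdom c. \<exists>E. psu3_frame (\<rho> c x) E \<and> transpose E ** g c x ** E = mat 1)"

definition integrable_psu3 ::
    "'p topology \<Rightarrow> 'p chart set \<Rightarrow> 'p metric_field \<Rightarrow> 'p form_field \<Rightarrow> bool" where
  "integrable_psu3 X A g \<rho> \<longleftrightarrow> psu3_structure X A g \<rho> \<and> integrable3 A g \<rho>"

text \<open>The Lie algebra of the orthogonal group of \<open>G\<close>, the stabiliser \<open>su(3)\<close> of \<open>\<rho>\<close> in it, and the
  orthogonal complement of the latter with respect to the inner product \<open>- tr(BC)/2\<close> of \<open>\<Lambda>\<^sup>2\<close>.\<close>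

definition so_alg :: "real^8^8 \<Rightarrow> (real^8^8) set" where
  "so_alg G = {B. \<forall>u v. ip G (B *v u) v = - ip G u (B *v v)}"

definition stab_alg :: "real^8^8 \<Rightarrow> form \<Rightarrow> (real^8^8) set" where
  "stab_alg G \<rho> = {B \<in> so_alg G. \<forall>vs. length vs = 3 \<longrightarrow> act B \<rho> vs = 0}"

definition stab_perp :: "real^8^8 \<Rightarrow> form \<Rightarrow> (real^8^8) set" where
  "stab_perp G \<rho> = {B \<in> so_alg G. \<forall>C\<in>stab_alg G \<rho>. trace (B ** C) = 0}"

text \<open>
  \<open>T c x u\<close> is the endomorphism \<open>T(u)\<close> at the point with \<open>c\<close>-coordinates \<open>x\<close>. It is unique, because
  \<open>stab_alg\<close> and \<open>stab_perp\<close> intersect trivially; linearity in \<open>u\<close>, smoothness and the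
  transformation behaviour are therefore consequences.
\<close>

definition psu3_torsion ::
    "'p chart set \<Rightarrow> 'p metric_field \<Rightarrow> 'p form_field \<Rightarrow> ('p chart \<Rightarrow> real^8 \<Rightarrow> real^8 \<Rightarrow> real^8^8) \<Rightarrow> bool"
  where
  "psu3_torsion A g \<rho> T \<longleftrightarrow>
     (\<forall>c\<in>A. \<forall>x\<in>cdom c. \<forall>u. T c x u \<in> stab_perp (g c x) (\<rho> c x) \<and>
        (\<forall>vs. length vs = 3 \<longrightarrow> nabla_form (g c) (\<rho> c) x u vs = act (T c x u) (\<rho> c x) vs))"

definition torsion_zero ::
    "'p chart set \<Rightarrow> ('p chart \<Rightarrow> real^8 \<Rightarrow> real^8 \<Rightarrow> real^8^8) \<Rightarrow> bool" where
  "torsion_zero A T \<longleftrightarrow> (\<forall>c\<in>A. \<forall>x\<in>cdom c. \<forall>u. T c x u = 0)"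


section \<open>Structures of type \<open>2\<^sub>0\<close> and \<open>3\<^sub>0\<close>\<close>

definition bracket_structure ::
    "((real^8 \<Rightarrow> real^8 \<Rightarrow> real^8) \<Rightarrow> bool) \<Rightarrow>
     'p topology \<Rightarrow> 'p chart set \<Rightarrow> 'p metric_field \<Rightarrow> 'p form_field \<Rightarrow> bool" where
  "bracket_structure L X A g \<rho> \<longleftrightarrow>
     oriented_manifold8 X A \<and> riemannian_metric A g \<and> diff_form A 3 \<rho> \<and>
     (\<forall>c\<in>A. \<forall>x\<in>cdom c. norm_sq3 (g c x) (\<rho> c x) = 1 \<and>
        (\<exists>br. (\<forall>u v w. ip (g c x) (br u v) w = \<rho> c x [u, v, w]) \<and> L br))"

definition integrable_type2_0 ::
    "'p topology \<Rightarrow> 'p chart set \<Rightarrow> 'p metric_field \<Rightarrow> 'p form_field \<Rightarrow> bool" where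
  "integrable_type2_0 X A g \<rho> \<longleftrightarrow> bracket_structure is_su2_su2_R2 X A g \<rho> \<and> integrable3 A g \<rho>"

definition integrable_type3_0 ::
    "'p topology \<Rightarrow> 'p chart set \<Rightarrow> 'p metric_field \<Rightarrow> 'p form_field \<Rightarrow> bool" where
  "integrable_type3_0 X A g \<rho> \<longleftrightarrow> bracket_structure is_su2_R5 X A g \<rho> \<and> integrable3 A g \<rho>"


section \<open>Spinors in dimension 8\<close>

text \<open>
  The spinor module \<open>\<Delta> = \<Delta>\<^sub>+ \<oplus> \<Delta>\<^sub>-\<close> is modelled on pairs, each summand with the standard inner
  product. A Clifford multiplication is given by the matrices \<open>K a : \<Delta>\<^sub>+ \<rightarrow> \<Delta>\<^sub>-\<close> of the standard
  basis vectors; \<open>\<Delta>\<^sub>- \<rightarrow> \<Delta>\<^sub>+\<close> is minus the transpose, so that vectors act by skew operators.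
\<close>

type_synonym spinor = "(real^8) \<times> (real^8)"

definition cliff :: "(8 \<Rightarrow> real^8^8) \<Rightarrow> real^8 \<Rightarrow> spinor \<Rightarrow> spinor" where
  "cliff K v s = (let M = (\<Sum>a\<in>UNIV. v $ a *\<^sub>R K a) in (- (transpose M *v snd s), M *v fst s))"

text \<open>The Clifford relation \<open>v \<cdot> v = - |v|\<^sup>2\<close>, and the chirality convention that the volume element
  \<open>e\<^sub>1 \<cdots> e\<^sub>8\<close> is \<open>+1\<close> on \<open>\<Delta>\<^sub>+\<close>. Such \<open>K\<close> is unique up to isometries of \<open>\<Delta>\<^sub>+\<close> and \<open>\<Delta>\<^sub>-\<close>.\<close>

definition half_spin_rep :: "(8 \<Rightarrow> real^8^8) \<Rightarrow> bool" where
  "half_spin_rep K \<longleftrightarrow>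
     (\<forall>v s. cliff K v (cliff K v s) = - (v \<bullet> v) *\<^sub>R s) \<and>
     (\<forall>p. foldr (\<lambda>a s. cliff K (ax a) s) idx8 (p, 0) = (p, 0))"

text \<open>\<open>Spin(8)\<close>, the group of even products of unit vectors, acting on \<open>\<Delta>\<close> (faithfully); and the
  double covering \<open>Spin(8) \<rightarrow> SO(8)\<close> given by \<open>v \<mapsto> \<sigma> \<cdot> v \<cdot> \<sigma>\<^sup>-\<^sup>1\<close>, as a relation.\<close>

inductive_set Spin8 :: "(8 \<Rightarrow> real^8^8) \<Rightarrow> (spinor \<Rightarrow> spinor) set" for K where
  one: "id \<in> Spin8 K"
| mult: "norm u = 1 \<Longrightarrow> norm v = 1 \<Longrightarrow> \<sigma> \<in> Spin8 K \<Longrightarrow> cliff K u \<circ> cliff K v \<circ> \<sigma> \<in> Spin8 K"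

definition covers :: "(8 \<Rightarrow> real^8^8) \<Rightarrow> (spinor \<Rightarrow> spinor) \<Rightarrow> real^8^8 \<Rightarrow> bool" where
  "covers K \<sigma> h \<longleftrightarrow> (\<forall>v s. \<sigma> (cliff K v s) = cliff K (h *v v) (\<sigma> s))"

type_synonym 'p frame_field = "'p chart \<Rightarrow> real^8 \<Rightarrow> real^8^8"
type_synonym 'p spin_cocycle = "'p chart \<Rightarrow> 'p chart \<Rightarrow> real^8 \<Rightarrow> spinor \<Rightarrow> spinor"

text \<open>The vectors of the frame are the columns of \<open>E c x\<close>. The matrix \<open>frame_trans E c d x\<close> converts
  components with respect to the frame of \<open>c\<close> into components with respect to the frame of \<open>d\<close>.\<close>

definition orth_frame :: "'p chart set \<Rightarrow> 'p metric_field \<Rightarrow> 'p frame_field \<Rightarrow> bool" where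
  "orth_frame A g E \<longleftrightarrow>
     (\<forall>c\<in>A. smooth_on (cdom c) (E c) \<and>
        (\<forall>x\<in>cdom c. det (E c x) > 0 \<and> transpose (E c x) ** g c x ** E c x = mat 1))"

definition frame_trans :: "'p frame_field \<Rightarrow> 'p chart \<Rightarrow> 'p chart \<Rightarrow> real^8 \<Rightarrow> real^8^8" where
  "frame_trans E c d x = matrix_inv (E d (coord_change c d x)) ** jac c d x ** E c x"

text \<open>
  A spin structure, as a \<open>Spin(8)\<close>-valued cocycle lifting the transition functions of oriented
  orthonormal frames. That frames and lifts are indexed by the charts of the atlas only requires
  the atlas to be fine enough. A section of the spinor bundle is a family of \<open>\<Delta>\<close>-valued functions
  \<open>\<psi>\<^sub>c\<close> with \<open>\<psi>\<^sub>d = \<sigma>\<^sub>c\<^sub>d \<psi>\<^sub>c\<close> (where \<open>\<sigma>\<^sub>c\<^sub>d\<close> is \<open>\<sigma> c d\<close>).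
\<close>

definition spin_structure ::
    "(8 \<Rightarrow> real^8^8) \<Rightarrow> 'p chart set \<Rightarrow> 'p metric_field \<Rightarrow> 'p frame_field \<Rightarrow> 'p spin_cocycle \<Rightarrow> bool"
  where
  "spin_structure K A g E \<sigma> \<longleftrightarrow>
     half_spin_rep K \<and> orth_frame A g E \<and>
     (\<forall>c\<in>A. \<forall>d\<in>A. (\<forall>x\<in>overlap c d. \<sigma> c d x \<in> Spin8 K \<and> covers K (\<sigma> c d x) (frame_trans E c d x)) \<and>
        (\<forall>s. continuous_on (overlap c d) (\<lambda>x. \<sigma> c d x s))) \<and>
     (\<forall>c\<in>A. \<forall>d\<in>A. \<forall>e\<in>A. \<forall>x\<in>overlap c d \<inter> overlap c e.
        \<sigma> d e (coord_change c d x) \<circ> \<sigma> c d x = \<sigma> c e x)"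

text \<open>\<open>conn G E x u a b = g(\<nabla>\<^sub>u e\<^sub>a, e\<^sub>b)\<close> for the frame \<open>E\<close>.\<close>

definition conn ::
    "(real^8 \<Rightarrow> real^8^8) \<Rightarrow> (real^8 \<Rightarrow> real^8^8) \<Rightarrow> real^8 \<Rightarrow> real^8 \<Rightarrow> 8 \<Rightarrow> 8 \<Rightarrow> real" where
  "conn G E x u a b = ip (G x) (nabla_vec G x u (\<lambda>y. E y *v ax a)) (E x *v ax b)"

text \<open>The spin connection \<open>\<nabla>\<^sub>u\<psi> = \<partial>\<^sub>u\<psi> + 1/4 \<Sum> g(\<nabla>\<^sub>u e\<^sub>a, e\<^sub>b) e\<^sub>a \<cdot> e\<^sub>b \<cdot> \<psi>\<close>; with the present Clifford
  relation this sign is the one for which \<open>\<nabla>(v \<cdot> \<psi>) = \<nabla>v \<cdot> \<psi> + v \<cdot> \<nabla>\<psi>\<close>.\<close>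

definition nabla_spinor ::
    "(8 \<Rightarrow> real^8^8) \<Rightarrow> (real^8 \<Rightarrow> real^8^8) \<Rightarrow> (real^8 \<Rightarrow> real^8^8) \<Rightarrow> real^8 \<Rightarrow> real^8 \<Rightarrow>
     (real^8 \<Rightarrow> spinor) \<Rightarrow> spinor" where
  "nabla_spinor K G E x u \<psi> =
     dir_deriv \<psi> x u
     + (1/4) *\<^sub>R (\<Sum>a\<in>UNIV. \<Sum>b\<in>UNIV. conn G E x u a b *\<^sub>R cliff K (ax a) (cliff K (ax b) (\<psi> x)))"


section \<open>Structures of type \<open>3\<^sub>+\<close>\<close>

text \<open>
  A bundle map \<open>\<gamma> : TM \<rightarrow> \<Delta>\<^sub>+\<close> is given in chart \<open>c\<close> by the matrix \<open>\<gamma> c x\<close> acting on components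
  with respect to the frame \<open>E c x\<close>.
\<close>

type_synonym 'p gamma_field = "'p chart \<Rightarrow> real^8 \<Rightarrow> real^8^8"

definition gamma_plus_section ::
    "'p chart set \<Rightarrow> 'p frame_field \<Rightarrow> 'p spin_cocycle \<Rightarrow> 'p gamma_field \<Rightarrow> bool" where
  "gamma_plus_section A E \<sigma> \<gamma> \<longleftrightarrow>
     (\<forall>c\<in>A. smooth_on (cdom c) (\<gamma> c)) \<and>
     (\<forall>c\<in>A. \<forall>d\<in>A. \<forall>x\<in>overlap c d. \<forall>v.
        (\<gamma> d (coord_change c d x) *v (frame_trans E c d x *v v), 0) = \<sigma> c d x (\<gamma> c x *v v, 0))"

text \<open>The kernel of Clifford multiplication, where \<open>\<gamma>\<close> is identified with \<open>\<Sum> e\<^sub>a \<otimes> \<gamma>(e\<^sub>a)\<close>.\<close>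

definition in_cliff_kernel :: "(8 \<Rightarrow> real^8^8) \<Rightarrow> real^8^8 \<Rightarrow> bool" where
  "in_cliff_kernel K \<gamma> \<longleftrightarrow> (\<Sum>a\<in>UNIV. cliff K (ax a) (\<gamma> *v ax a, 0)) = 0"

text \<open>
  Triality: \<open>minus_mult K \<eta>\<close> is the map \<open>\<Lambda>\<^sup>1 \<rightarrow> \<Delta>\<^sub>+\<close>, \<open>v \<mapsto> v \<cdot> \<eta>\<close>. Through these maps and their
  transposes \<open>\<Delta>\<^sub>-\<close> acts on \<open>\<Lambda>\<^sup>1 \<oplus> \<Delta>\<^sub>+\<close> as vectors act on spinors, and \<open>\<Lambda>\<^sup>3\<Delta>\<^sub>-\<close> is embedded into
  \<open>\<Lambda>\<^sup>1 \<otimes> \<Delta>\<^sub>+\<close> as the kernel of Clifford multiplication by letting 3-forms act by Clifford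
  multiplication, \<open>\<eta>\<^sub>i \<and> \<eta>\<^sub>j \<and> \<eta>\<^sub>k \<mapsto> \<eta>\<^sub>i \<eta>\<^sub>j\<^sup>T \<eta>\<^sub>k\<close> on orthonormal vectors.
\<close>

definition minus_mult :: "(8 \<Rightarrow> real^8^8) \<Rightarrow> real^8 \<Rightarrow> real^8^8" where
  "minus_mult K \<eta> = matrix (\<lambda>v. fst (cliff K v (0, \<eta>)))"

definition triality3 :: "(8 \<Rightarrow> real^8^8) \<Rightarrow> form \<Rightarrow> real^8^8" where
  "triality3 K \<beta> =
     (1/6) *\<^sub>R (\<Sum>i\<in>UNIV. \<Sum>j\<in>UNIV. \<Sum>k\<in>UNIV. \<beta> [ax i, ax j, ax k] *\<^sub>R
        (minus_mult K (ax i) ** transpose (minus_mult K (ax j)) ** minus_mult K (ax k)))"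

definition type3_plus_at :: "(8 \<Rightarrow> real^8^8) \<Rightarrow> real^8^8 \<Rightarrow> bool" where
  "type3_plus_at K \<gamma> \<longleftrightarrow>
     orthogonal_matrix \<gamma> \<and> in_cliff_kernel K \<gamma> \<and>
     (\<exists>\<beta> r br. alt_form 3 \<beta> \<and> norm_sq3 (mat 1) \<beta> = 1 \<and> r > 0 \<and> \<gamma> = r *\<^sub>R triality3 K \<beta> \<and>
        (\<forall>u v w. br u v \<bullet> w = \<beta> [u, v, w]) \<and> is_su2_R5 br)"

definition type3_plus_structure ::
    "(8 \<Rightarrow> real^8^8) \<Rightarrow> 'p topology \<Rightarrow> 'p chart set \<Rightarrow> 'p metric_field \<Rightarrow> 'p frame_field \<Rightarrow>
     'p spin_cocycle \<Rightarrow> 'p gamma_field \<Rightarrow> bool" where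
  "type3_plus_structure K X A g E \<sigma> \<gamma> \<longleftrightarrow>
     oriented_manifold8 X A \<and> riemannian_metric A g \<and> spin_structure K A g E \<sigma> \<and>
     gamma_plus_section A E \<sigma> \<gamma> \<and> (\<forall>c\<in>A. \<forall>x\<in>cdom c. type3_plus_at K (\<gamma> c x))"

text \<open>
  The \<open>e\<^sub>b\<close>-components of \<open>\<nabla>\<^sub>u\<gamma>\<close> and of \<open>\<D>\<gamma>\<close>, for \<open>\<gamma> = \<Sum> e\<^sub>a \<otimes> \<gamma>(e\<^sub>a)\<close> and
  \<open>\<nabla>\<^sub>u(X \<otimes> \<Psi>) = \<nabla>\<^sub>uX \<otimes> \<Psi> + X \<otimes> \<nabla>\<^sub>u\<Psi>\<close>, \<open>\<D>(X \<otimes> \<Psi>) = \<Sum>\<^sub>i \<nabla>\<^sub>iX \<otimes> e\<^sub>i\<cdot>\<Psi> + X \<otimes> e\<^sub>i\<cdot>\<nabla>\<^sub>i\<Psi>\<close>.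
\<close>

definition nabla_gamma ::
    "(8 \<Rightarrow> real^8^8) \<Rightarrow> (real^8 \<Rightarrow> real^8^8) \<Rightarrow> (real^8 \<Rightarrow> real^8^8) \<Rightarrow> (real^8 \<Rightarrow> real^8^8) \<Rightarrow>
     real^8 \<Rightarrow> real^8 \<Rightarrow> 8 \<Rightarrow> spinor" where
  "nabla_gamma K G E \<gamma> x u b =
     (\<Sum>a\<in>UNIV. conn G E x u a b *\<^sub>R (\<gamma> x *v ax a, 0))
     + nabla_spinor K G E x u (\<lambda>y. (\<gamma> y *v ax b, 0))"

definition twisted_dirac ::
    "(8 \<Rightarrow> real^8^8) \<Rightarrow> (real^8 \<Rightarrow> real^8^8) \<Rightarrow> (real^8 \<Rightarrow> real^8^8) \<Rightarrow> (real^8 \<Rightarrow> real^8^8) \<Rightarrow>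
     real^8 \<Rightarrow> 8 \<Rightarrow> spinor" where
  "twisted_dirac K G E \<gamma> x b =
     (\<Sum>i\<in>UNIV. let u = E x *v ax i in
        (\<Sum>a\<in>UNIV. conn G E x u a b *\<^sub>R cliff K (ax i) (\<gamma> x *v ax a, 0))
        + cliff K (ax i) (nabla_spinor K G E x u (\<lambda>y. (\<gamma> y *v ax b, 0))))"

definition integrable_type3_plus ::
    "(8 \<Rightarrow> real^8^8) \<Rightarrow> 'p topology \<Rightarrow> 'p chart set \<Rightarrow> 'p metric_field \<Rightarrow> 'p frame_field \<Rightarrow>
     'p spin_cocycle \<Rightarrow> 'p gamma_field \<Rightarrow> bool" where
  "integrable_type3_plus K X A g E \<sigma> \<gamma> \<longleftrightarrow>
     type3_plus_structure K X A g E \<sigma> \<gamma> \<and>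
     (\<forall>c\<in>A. \<forall>x\<in>cdom c. \<forall>b. twisted_dirac K (g c) (E c) (\<gamma> c) x b = 0)"

definition parallel_gamma ::
    "(8 \<Rightarrow> real^8^8) \<Rightarrow> 'p chart set \<Rightarrow> 'p metric_field \<Rightarrow> 'p frame_field \<Rightarrow> 'p gamma_field \<Rightarrow> bool"
  where
  "parallel_gamma K A g E \<gamma> \<longleftrightarrow>
     (\<forall>c\<in>A. \<forall>x\<in>cdom c. \<forall>u b. nabla_gamma K (g c) (E c) (\<gamma> c) x u b = 0)"


text \<open>
  The points of all manifolds are taken from one type with the cardinality of the continuum. Every
  second countable manifold is homeomorphic to one of this kind; the topology need not be induced
  by the one of \<open>real^8\<close>.
\<close>

type_synonym point = "real^8"

end

theory Submission
  imports Defs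
begin

text \<open>
  Every metric here comes from a global coframe \<open>\<theta> = P dx\<close> on \<open>\<real>\<^sup>8\<close> with \<open>d\<theta> = - h L(\<theta>, \<theta>)\<close> for a constant
  skew bilinear map \<open>L\<close> and a function \<open>h\<close>. In such a coframe, Koszul's formula turns the Levi-Civita
  connection, \<open>d\<close> and \<open>d\<star>\<close> of forms with constant coefficients, and the Ricci curvature into algebraic
  expressions in \<open>L\<close>, multiplied by powers of \<open>h\<close>; so each example is a finite computation. The examples are
  compact quotients of 2-step nilpotent groups (\<open>PSU(3)\<close>, not Einstein; type \<open>3\<^sub>+\<close>), the symmetric space
  \<open>SL(3, \<complex>)/SU(3)\<close> as a solvable group (\<open>\<rho>\<close> parallel, not Ricci-flat), and the product of \<open>\<real>\<^sup>4\<close> with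
  a Ricci-flat Gibbons-Hawking metric, on which \<open>\<rho>\<^sub>0\<close>, \<open>e\<^sup>1\<^sup>4\<^sup>5\<close> and \<open>(e\<^sup>1\<^sup>4\<^sup>5 + e\<^sup>2\<^sup>6\<^sup>7)/\<surd>2\<close> are closed and
  coclosed, but not parallel.
\<close>

text \<open>A left-invariant coframe has constant \<open>h\<close>, and a homogeneous Ricci-flat
  metric is flat, so the curved Ricci-flat examples need a varying \<open>h\<close>. The
  Gibbons-Hawking metric with potential z has translations that preserve its coframe and are
  transitive on the level sets of z, and a homothety that scales z and the coframe. All structure
  functions are therefore constants times the same function z^(-3/2). The derivative of
  \<open>h\<close> then enters only the curvature, through the linear form \<open>lam\<close>.

  The definitions are in terms of charts and Christoffel symbols. The bridge to algebra is that d is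
  the alternation of the Levi-Civita derivative, that the latter acts on forms with constant
  coefficients by skew matrices, and that skew matrices commute with the Hodge star. The vanishing
  of 9-forms in dimension eight yields both this commutation and the passage from zero divergence to
  a closed star.

  The coframes are global, also on the compact quotients, so the spin cocycle and the matrix of
  \<open>\<gamma>\<close> are constant. What distinguishes one structure of type 3_+ from another is
  then the choice of the orthonormal frame in which \<open>\<gamma>\<close> is the identity.\<close>

lemma UNIV_8: "(UNIV :: 8 set) = {1, 2, 3, 4, 5, 6, 7, 8}"
proof -
  have "card {1, 2, 3, 4, 5, 6, 7, 8 :: 8} = CARD(8)"
    by simp
  then show ?thesis
    by (metis card_subset_eq finite top_greatest)
qed

lemma forall_8: "(\<forall>i::8. P i) \<longleftrightarrow> P 1 \<and> P 2 \<and> P 3 \<and> P 4 \<and> P 5 \<and> P 6 \<and> P 7 \<and> P 8"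
proof -
  have "(\<forall>i::8. P i) \<longleftrightarrow> (\<forall>i\<in>{1, 2, 3, 4, 5, 6, 7, 8}. P i)"
    by (metis UNIV_8 UNIV_I)
  then show ?thesis by simp
qed

lemma sum_8: "(\<Sum>i\<in>(UNIV :: 8 set). f i) = f 1 + f 2 + f 3 + f 4 + f 5 + f 6 + f 7 + f 8"
  for f :: "8 \<Rightarrow> 'a::comm_monoid_add"
  unfolding UNIV_8 by (simp add: add.assoc)

section \<open>Exponential polynomials and smoothness\<close>

text \<open>These functions are smooth, because directional derivatives stay in the class.\<close>

inductive_set exp_polys :: "(real^8 \<Rightarrow> real) set" where
  const: "(\<lambda>x. c) \<in> exp_polys"
| coord: "(\<lambda>x. x $ i) \<in> exp_polys"
| exp_coord: "(\<lambda>x. exp (c * x $ i)) \<in> exp_polys"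
| add: "f \<in> exp_polys \<Longrightarrow> g \<in> exp_polys \<Longrightarrow> (\<lambda>x. f x + g x) \<in> exp_polys"
| mult: "f \<in> exp_polys \<Longrightarrow> g \<in> exp_polys \<Longrightarrow> (\<lambda>x. f x * g x) \<in> exp_polys"

lemma exp_polys_uminus: "f \<in> exp_polys \<Longrightarrow> (\<lambda>x. - f x) \<in> exp_polys"
  using exp_polys.mult[OF exp_polys.const[of "-1"]] by simp

lemma exp_polys_diff: "f \<in> exp_polys \<Longrightarrow> g \<in> exp_polys \<Longrightarrow> (\<lambda>x. f x - g x) \<in> exp_polys"
  using exp_polys.add[OF _ exp_polys_uminus] by simp

lemma exp_polys_sum: "(\<And>i. i \<in> I \<Longrightarrow> f i \<in> exp_polys) \<Longrightarrow> (\<lambda>x. \<Sum>i\<in>I. f i x) \<in> exp_polys"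
  by (induction I rule: infinite_finite_induct) (auto intro: exp_polys.intros)

lemmas exp_polys_intros = exp_polys.intros exp_polys_uminus exp_polys_diff exp_polys_sum

lemma exp_polys_has_derivative:
  assumes "f \<in> exp_polys"
  shows "\<exists>f'. (\<forall>x. (f has_derivative (\<lambda>u. f' u x)) (at x)) \<and> (\<forall>u. f' u \<in> exp_polys)"
  using assms
proof induction
  case (const c)
  show ?case
    by (rule exI[of _ "\<lambda>u x. 0"]) (auto intro: exp_polys.intros)
next
  case (coord i)
  show ?case
    by (rule exI[of _ "\<lambda>u x. u $ i"])
      (auto intro: exp_polys.intros bounded_linear_imp_has_derivative bounded_linear_vec_nth)
next
  case (exp_coord c i)
  have "((\<lambda>x. exp (c * x $ i)) has_derivative (\<lambda>u. c * u $ i * exp (c * x $ i))) (at x)" for x :: "real^8"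
    by (rule derivative_eq_intros bounded_linear_imp_has_derivative bounded_linear_vec_nth refl)+
      (simp add: mult_ac)
  then show ?case
    by (intro exI[of _ "\<lambda>u x. c * u $ i * exp (c * x $ i)"]) (auto intro: exp_polys.intros)
next
  case (add f g)
  then obtain f' g' where
    "\<forall>x. (f has_derivative (\<lambda>u. f' u x)) (at x)" "\<forall>u. f' u \<in> exp_polys"
    "\<forall>x. (g has_derivative (\<lambda>u. g' u x)) (at x)" "\<forall>u. g' u \<in> exp_polys" by blast
  then show ?case
    by (intro exI[of _ "\<lambda>u x. f' u x + g' u x"]) (auto intro!: exp_polys.intros has_derivative_add)
next
  case (mult f g)
  then obtain f' g' where
    "\<forall>x. (f has_derivative (\<lambda>u. f' u x)) (at x)" "\<forall>u. f' u \<in> exp_polys"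
    "\<forall>x. (g has_derivative (\<lambda>u. g' u x)) (at x)" "\<forall>u. g' u \<in> exp_polys" by blast
  with mult.hyps show ?case
    by (intro exI[of _ "\<lambda>u x. f x * g' u x + f' u x * g x"]) (auto intro!: exp_polys.intros has_derivative_mult)
qed

definition exp_poly_map :: "(real^8 \<Rightarrow> 'a::euclidean_space) \<Rightarrow> bool" where
  "exp_poly_map f \<longleftrightarrow> (\<forall>b\<in>Basis. (\<lambda>x. f x \<bullet> b) \<in> exp_polys)"

lemma exp_poly_map_vec: "(\<And>i. (\<lambda>x. f x $ i) \<in> exp_polys) \<Longrightarrow> exp_poly_map (f :: real^8 \<Rightarrow> real^'n)"
  by (auto simp: exp_poly_map_def Basis_vec_def inner_axis)

lemma exp_poly_map_matrix:
  "(\<And>i j. (\<lambda>x. f x $ i $ j) \<in> exp_polys) \<Longrightarrow> exp_poly_map (f :: real^8 \<Rightarrow> real^'n^'m)"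
  by (auto simp: exp_poly_map_def Basis_vec_def inner_axis)

lemma exp_poly_map_has_derivative:
  assumes "exp_poly_map f"
  shows "\<exists>f'. (\<forall>x. (f has_derivative (\<lambda>u. f' u x)) (at x)) \<and> (\<forall>u. exp_poly_map (f' u))"
proof -
  have "\<forall>b\<in>Basis. \<exists>f'. (\<forall>x. ((\<lambda>x. f x \<bullet> b) has_derivative (\<lambda>u. f' u x)) (at x)) \<and> (\<forall>u. f' u \<in> exp_polys)"
    using assms exp_polys_has_derivative unfolding exp_poly_map_def by blast
  then obtain f' where f': "\<And>b x. b \<in> Basis \<Longrightarrow> ((\<lambda>x. f x \<bullet> b) has_derivative (\<lambda>u. f' b u x)) (at x)"
    "\<And>b u. b \<in> Basis \<Longrightarrow> f' b u \<in> exp_polys"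
    by metis
  show ?thesis
  proof (intro exI[of _ "\<lambda>u x. \<Sum>b\<in>Basis. f' b u x *\<^sub>R b"] conjI allI)
    fix x
    show "(f has_derivative (\<lambda>u. \<Sum>b\<in>Basis. f' b u x *\<^sub>R b)) (at x)"
      using f'(1) by (subst has_derivative_componentwise_within) simp
  next
    fix u
    show "exp_poly_map (\<lambda>x. \<Sum>b\<in>Basis. f' b u x *\<^sub>R b)"
      using f'(2) by (simp add: exp_poly_map_def)
  qed
qed

lemma exp_poly_map_differentiable: "exp_poly_map f \<Longrightarrow> f differentiable (at x)"
  using exp_poly_map_has_derivative[of f] unfolding differentiable_def by blast

text \<open>Coordinate changes of a quotient are translations by lattice elements that may differ
  from one component of the overlap to another, so they belong to the class only locally.\<close>

definition locally_exp_poly :: "(real^8) set \<Rightarrow> (real^8 \<Rightarrow> 'a::euclidean_space) \<Rightarrow> bool" where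
  "locally_exp_poly S f \<longleftrightarrow>
     (\<forall>x\<in>S. \<exists>T \<phi>. open T \<and> x \<in> T \<and> exp_poly_map \<phi> \<and> (\<forall>y\<in>T. f y = \<phi> y))"

lemma locally_exp_poly_differentiable:
  assumes "locally_exp_poly S f" "x \<in> S"
  shows "f differentiable (at x)"
proof -
  obtain T \<phi> where T: "open T" "x \<in> T" "exp_poly_map \<phi>" "\<forall>y\<in>T. f y = \<phi> y"
    using bspec[OF assms(1)[unfolded locally_exp_poly_def] assms(2)]
    by (elim exE conjE) (rule that)
  then have "\<phi> differentiable (at x)"
    using exp_poly_map_differentiable by blast
  then show ?thesis
    using T(1,2,4) has_derivative_transform_within_open[of \<phi> _ x UNIV T f]
    unfolding differentiable_def by auto
qed

lemma locally_exp_poly_dir_deriv: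
  assumes "locally_exp_poly S f"
  shows "locally_exp_poly S (\<lambda>x. dir_deriv f x u)"
  unfolding locally_exp_poly_def
proof
  fix x assume "x \<in> S"
  then obtain T \<phi> where T: "open T" "x \<in> T" "exp_poly_map \<phi>" "\<forall>y\<in>T. f y = \<phi> y"
    using bspec[OF assms(1)[unfolded locally_exp_poly_def] \<open>x \<in> S\<close>]
    by (elim exE conjE) (rule that)
  obtain \<phi>' where \<phi>': "\<And>x. (\<phi> has_derivative (\<lambda>u. \<phi>' u x)) (at x)" "\<And>u. exp_poly_map (\<phi>' u)"
    using exp_poly_map_has_derivative[OF T(3)] by blast
  have "dir_deriv f y u = \<phi>' u y" if "y \<in> T" for y
  proof -
    have "(f has_derivative (\<lambda>u. \<phi>' u y)) (at y)"
      using has_derivative_transform_within_open[OF \<phi>'(1) T(1) that] T(4) by simp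
    then show ?thesis
      by (simp add: dir_deriv_def frechet_derivative_at[symmetric])
  qed
  then show "\<exists>T \<phi>. open T \<and> x \<in> T \<and> exp_poly_map \<phi> \<and> (\<forall>y\<in>T. dir_deriv f y u = \<phi> y)"
    using T(1,2) \<phi>'(2)[of u] by (intro exI[of _ T] exI[of _ "\<phi>' u"]) auto
qed

lemma locally_exp_poly_smooth: "locally_exp_poly S f \<Longrightarrow> smooth_on S f"
proof -
  have "locally_exp_poly S f \<Longrightarrow> Ck_on k S f" for k
  proof (induction k arbitrary: f)
    case 0
    then show ?case
      by (auto intro!: continuous_at_imp_continuous_on differentiable_imp_continuous_within
          locally_exp_poly_differentiable)
  next
    case (Suc k)
    then show ?case
      by (auto simp: differentiable_on_def
          intro: differentiable_at_withinI locally_exp_poly_differentiable locally_exp_poly_dir_deriv)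
  qed
  then show "locally_exp_poly S f \<Longrightarrow> smooth_on S f"
    by (simp add: smooth_on_def)
qed

lemma exp_poly_map_smooth: "exp_poly_map f \<Longrightarrow> smooth_on S f"
  by (rule locally_exp_poly_smooth) (auto simp: locally_exp_poly_def)

lemma dir_deriv_eq: "(f has_derivative f') (at x) \<Longrightarrow> dir_deriv f x u = f' u"
  by (simp add: dir_deriv_def frechet_derivative_at[symmetric])

lemma linear_expand_8: "linear f \<Longrightarrow> f v = (\<Sum>i\<in>UNIV. v $ i *\<^sub>R f (ax i))" for f :: "real^8 \<Rightarrow> 'a::real_vector"
proof -
  assume f: "linear f"
  have "v = (\<Sum>i\<in>UNIV. v $ i *\<^sub>R ax i)"
    using basis_expansion[of v] by (simp add: scalar_mult_eq_scaleR)
  then have "f v = f (\<Sum>i\<in>UNIV. v $ i *\<^sub>R ax i)" by simp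
  also have "\<dots> = (\<Sum>i\<in>UNIV. v $ i *\<^sub>R f (ax i))"
    by (simp add: linear_sum[OF f] linear_cmul[OF f])
  finally show ?thesis .
qed

section \<open>Alternating forms\<close>

lemma alt_form_linear: "alt_form k \<omega> \<Longrightarrow> length as + Suc (length cs) = k \<Longrightarrow> linear (\<lambda>u. \<omega> (as @ u # cs))"
  unfolding alt_form_def
  by (elim conjE allE[of _ "as @ 0 # cs"] allE[of _ "length as"]) auto

lemma alt_form_linear_nth: "alt_form k \<omega> \<Longrightarrow> length vs = k \<Longrightarrow> j < k \<Longrightarrow> linear (\<lambda>u. \<omega> (vs[j := u]))"
  unfolding alt_form_def by blast

lemma alt_form_eq_0:
  assumes "alt_form k \<omega>" "length as + Suc (length bs + Suc (length cs)) = k"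
  shows "\<omega> (as @ a # bs @ a # cs) = 0"
proof -
  let ?vs = "as @ a # bs @ a # cs" and ?j = "length as + Suc (length bs)"
  have "?vs ! length as = ?vs ! ?j" by (simp add: nth_append)
  moreover have "length ?vs = k" "length as < ?j" "?j < k" using assms(2) by auto
  ultimately show ?thesis
    using assms(1) unfolding alt_form_def by blast
qed

lemma alt_form_swap:
  assumes \<omega>: "alt_form k \<omega>" and k: "length as + Suc (Suc (length cs)) = k"
  shows "\<omega> (as @ a # b # cs) = - \<omega> (as @ b # a # cs)"
proof -
  have l1: "linear (\<lambda>u. \<omega> (as @ u # c # cs))" for c
    using alt_form_linear[OF \<omega>, of as "c # cs"] k by simp
  have l2: "linear (\<lambda>u. \<omega> (as @ c # u # cs))" for c
    using alt_form_linear[OF \<omega>, of "as @ [c]" cs] k by simp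
  have z: "\<omega> (as @ c # c # cs) = 0" for c
    using alt_form_eq_0[OF \<omega>, of as "[]" cs c] k by simp
  have "\<omega> (as @ (a + b) # (a + b) # cs) =
      \<omega> (as @ a # a # cs) + \<omega> (as @ a # b # cs) + \<omega> (as @ b # a # cs) + \<omega> (as @ b # b # cs)"
    by (simp add: linear_add[OF l1] linear_add[OF l2])
  then show ?thesis by (simp add: z)
qed

lemma alt_form_move:
  assumes \<omega>: "alt_form k \<omega>"
  shows "length as + Suc (length bs + length cs) = k \<Longrightarrow>
    \<omega> (as @ bs @ a # cs) = (-1) ^ length bs * \<omega> (as @ a # bs @ cs)"
proof (induction bs arbitrary: as)
  case (Cons b bs)
  have "\<omega> (as @ (b # bs) @ a # cs) = (-1) ^ length bs * \<omega> ((as @ [b]) @ a # bs @ cs)"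
    using Cons.IH[of "as @ [b]"] Cons.prems by simp
  also have "\<omega> ((as @ [b]) @ a # bs @ cs) = - \<omega> (as @ a # b # bs @ cs)"
    using alt_form_swap[OF \<omega>, of as "bs @ cs" b a] Cons.prems by simp
  finally show ?case by simp
qed simp

definition drop_nth :: "nat \<Rightarrow> 'a list \<Rightarrow> 'a list" where
  "drop_nth j xs = take j xs @ drop (Suc j) xs"

lemma length_drop_nth [simp]: "j < length xs \<Longrightarrow> length (drop_nth j xs) = length xs - 1"
  by (auto simp: drop_nth_def)

lemma nth_drop_nth: "j < length xs \<Longrightarrow> l < length xs - 1 \<Longrightarrow>
    drop_nth j xs ! l = xs ! (if l < j then l else Suc l)"
  by (auto simp: drop_nth_def nth_append min_def)

lemma map_drop_nth: "map f (drop_nth j xs) = drop_nth j (map f xs)"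
  by (simp add: drop_nth_def take_map drop_map)

text \<open>Once entry \<open>l\<close> is deleted, entry \<open>j\<close> sits in position
  \<open>j - 1\<close>. Moving \<open>s\<close> past the \<open>j - l - 1\<close> entries between
  the two positions gives a sign that, together with the powers at \<open>l\<close> and
  \<open>j\<close>, leaves a single minus.\<close>

lemma drop_nth_update_swap:
  assumes \<omega>: "alt_form k \<omega>" and ws: "length ws = Suc k" and "l < j" "j \<le> k"
  shows "(-1) ^ l * \<omega> ((drop_nth l ws)[j - 1 := s]) = - ((-1) ^ j * \<omega> ((drop_nth j ws)[l := s]))"
proof -
  define as bs cs where "as = take l ws" and "bs = take (j - Suc l) (drop (Suc l) ws)" and "cs = drop (Suc j) ws"
  have len: "length as = l" "length bs = j - Suc l" "length cs = k - j"
    using assms by (auto simp: as_def bs_def cs_def)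
  have split: "ws = as @ ws ! l # bs @ ws ! j # cs"
  proof -
    have 1: "ws = as @ ws ! l # drop (Suc l) ws"
      unfolding as_def using assms by (intro id_take_nth_drop) auto
    have "drop (Suc l) ws = bs @ drop (j - Suc l) (drop (Suc l) ws)"
      unfolding bs_def by (rule append_take_drop_id[symmetric])
    also have "drop (j - Suc l) (drop (Suc l) ws) = drop j ws"
      using assms by simp
    also have "drop j ws = ws ! j # cs"
      unfolding cs_def using assms by (metis Cons_nth_drop_Suc le_imp_less_Suc)
    finally show ?thesis using 1 by simp
  qed
  have "drop_nth l ws = as @ bs @ ws ! j # cs"
    by (subst split) (simp add: drop_nth_def len)
  then have "(drop_nth l ws)[j - 1 := s] = ((as @ bs) @ ws ! j # cs)[length (as @ bs) := s]"
    using assms len by simp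
  then have 1: "(drop_nth l ws)[j - 1 := s] = as @ bs @ s # cs"
    by (simp only: list_update_length) simp
  have "drop_nth j ws = as @ ws ! l # bs @ cs"
    by (subst split) (use assms in \<open>simp add: drop_nth_def len take_Cons' drop_Cons'\<close>)
  then have 2: "(drop_nth j ws)[l := s] = as @ s # bs @ cs"
    using len by (metis list_update_length)
  obtain d where j: "j = Suc (l + d)"
    using less_imp_Suc_add[OF \<open>l < j\<close>] by auto
  have "\<omega> (as @ bs @ s # cs) = (-1) ^ length bs * \<omega> (as @ s # bs @ cs)"
    using assms len by (intro alt_form_move[OF \<omega>]) simp
  then show ?thesis
    using 1 2 len by (simp add: j power_add mult.assoc)
qed

text \<open>Deleting one entry and overwriting another can be done with the roles of the two
  exchanged; the two terms carry the same value of \<open>S\<close> and opposite signs. With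
  Christoffel symbols for \<open>S\<close>, this is why d can be computed from a torsion-free
  connection.\<close>

lemma alternating_sum_symmetric:
  assumes \<omega>: "alt_form k \<omega>" and ws: "length ws = Suc k" and S: "\<And>i j. S i j = S j i"
  shows "(\<Sum>j<Suc k. (-1) ^ j * (\<Sum>l<k. \<omega> ((drop_nth j ws)[l := S j (if l < j then l else Suc l)]))) = 0"
proof -
  define f where "f j l = (-1) ^ j * \<omega> ((drop_nth j ws)[l := S j (if l < j then l else Suc l)])" for j l
  define U where "U = {(j, l). l < j \<and> j \<le> k}"
  define V where "V = {(j, l). j \<le> l \<and> l < k}"
  have fin: "finite U" "finite V"
    by (rule finite_subset[of _ "{..k} \<times> {..k}"]; auto simp: U_def V_def)+
  have "(\<Sum>j<Suc k. (-1) ^ j * (\<Sum>l<k. \<omega> ((drop_nth j ws)[l := S j (if l < j then l else Suc l)])))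
      = (\<Sum>(j, l)\<in>{..<Suc k} \<times> {..<k}. f j l)"
    by (simp only: f_def sum_distrib_left sum.cartesian_product)
  also have "{..<Suc k} \<times> {..<k} = U \<union> V"
    by (auto simp: U_def V_def)
  also have "(\<Sum>(j, l)\<in>U \<union> V. f j l) = (\<Sum>(j, l)\<in>U. f j l) + (\<Sum>(j, l)\<in>V. f j l)"
    by (rule sum.union_disjoint) (use fin in \<open>auto simp: U_def V_def\<close>)
  also have "(\<Sum>(j, l)\<in>V. f j l) = (\<Sum>(j, l)\<in>U. - f j l)"
  \<comment> \<open>Slot \<open>l\<close> with \<open>j \<le> l\<close> holds the original entry
    \<open>Suc l\<close>, so the partner deletes entry \<open>Suc l\<close> and overwrites entry
    \<open>j\<close>.\<close>
  proof (rule sum.reindex_bij_witness[of _ "\<lambda>(j, l). (l, j - 1)" "\<lambda>(j, l). (Suc l, j)"], goal_cases)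
    case (5 a)
    then obtain j l where a: "a = (j, l)" "j \<le> l" "l < k" by (auto simp: V_def)
    then show ?case
      using drop_nth_update_swap[OF \<omega> ws, of j "Suc l" "S j (Suc l)"] by (simp add: f_def S)
  qed (auto simp: U_def V_def)
  finally show ?thesis
    by (simp add: case_prod_unfold sum_negf)
qed

text \<open>The Leibniz rule for a multilinear map of arbitrary degree. Expanding the first argument
  in the basis reduces it to products of real functions and to one degree less.\<close>

lemma multilinear_has_derivative:
  fixes \<omega> :: form
  assumes "\<And>vs j. length vs = k \<Longrightarrow> j < k \<Longrightarrow> linear (\<lambda>u. \<omega> (vs[j := u]))"
    and "length gs = k" "length gs' = k"
    and "\<And>i. i < k \<Longrightarrow> ((gs ! i) has_derivative (gs' ! i)) (at x)"
  shows "((\<lambda>y. \<omega> (map (\<lambda>g. g y) gs)) has_derivative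
      (\<lambda>u. \<Sum>l<k. \<omega> ((map (\<lambda>g. g x) gs)[l := (gs' ! l) u]))) (at (x :: real^8))"
  using assms
proof (induction k arbitrary: \<omega> gs gs')
  case 0
  then show ?case by simp
next
  case (Suc k)
  obtain g rest g' rest' where gs: "gs = g # rest" "gs' = g' # rest'" "length rest = k" "length rest' = k"
    using Suc.prems(2,3) by (cases gs; cases gs') auto
  have g: "(g has_derivative g') (at x)"
    using Suc.prems(4)[of 0] gs by simp
  have lin: "linear (\<lambda>u. \<omega> (u # vs))" if "length vs = k" for vs
    using Suc.prems(1)[of "0 # vs" 0] that by simp
  have IH: "((\<lambda>y. \<omega> (ax i # map (\<lambda>g. g y) rest)) has_derivative
      (\<lambda>u. \<Sum>l<k. \<omega> (ax i # (map (\<lambda>g. g x) rest)[l := (rest' ! l) u]))) (at x)" for i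
  proof (rule Suc.IH)
    fix vs :: "(real^8) list" and j assume "length vs = k" "j < k"
    then show "linear (\<lambda>u. \<omega> (ax i # vs[j := u]))"
      using Suc.prems(1)[of "ax i # vs" "Suc j"] by simp
  next
    fix j assume "j < k"
    then show "((rest ! j) has_derivative (rest' ! j)) (at x)"
      using Suc.prems(4)[of "Suc j"] gs by simp
  qed (use gs in auto)
  have "((\<lambda>y. \<Sum>i\<in>UNIV. g y $ i * \<omega> (ax i # map (\<lambda>g. g y) rest)) has_derivative
      (\<lambda>u. \<Sum>i\<in>UNIV. g x $ i * (\<Sum>l<k. \<omega> (ax i # (map (\<lambda>g. g x) rest)[l := (rest' ! l) u]))
         + g' u $ i * \<omega> (ax i # map (\<lambda>g. g x) rest))) (at x)"
    by (intro has_derivative_sum has_derivative_mult IH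
        bounded_linear.has_derivative[OF bounded_linear_vec_nth g])
  moreover have "(\<Sum>i\<in>UNIV. g y $ i * \<omega> (ax i # map (\<lambda>g. g y) rest)) = \<omega> (map (\<lambda>g. g y) gs)" for y
    using linear_expand_8[OF lin, of "map (\<lambda>g. g y) rest" "g y"] gs by simp
  moreover have "(\<Sum>i\<in>UNIV. g x $ i * (\<Sum>l<k. \<omega> (ax i # (map (\<lambda>g. g x) rest)[l := (rest' ! l) u]))
         + g' u $ i * \<omega> (ax i # map (\<lambda>g. g x) rest)) =
      (\<Sum>l<Suc k. \<omega> ((map (\<lambda>g. g x) gs)[l := (gs' ! l) u]))" for u
  proof -
    have "(\<Sum>i\<in>UNIV. g x $ i * (\<Sum>l<k. \<omega> (ax i # (map (\<lambda>g. g x) rest)[l := (rest' ! l) u])))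
        = (\<Sum>l<k. \<Sum>i\<in>UNIV. g x $ i * \<omega> (ax i # (map (\<lambda>g. g x) rest)[l := (rest' ! l) u]))"
      by (simp only: sum_distrib_left) (rule sum.swap)
    also have "\<dots> = (\<Sum>l<k. \<omega> (g x # (map (\<lambda>g. g x) rest)[l := (rest' ! l) u]))"
      by (intro sum.cong refl, subst (2) linear_expand_8[OF lin]) (use gs in auto)
    moreover have "(\<Sum>i\<in>UNIV. g' u $ i * \<omega> (ax i # map (\<lambda>g. g x) rest)) = \<omega> (g' u # map (\<lambda>g. g x) rest)"
      using linear_expand_8[OF lin, of "map (\<lambda>g. g x) rest" "g' u"] gs by simp
    ultimately show ?thesis
      using gs by (simp add: sum.distrib sum.lessThan_Suc_shift del: sum.lessThan_Suc)
  qed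
  ultimately show ?case by simp
qed

section \<open>Gram matrices and derivatives of matrix fields\<close>

lemma inner_gram: "u \<bullet> ((transpose M ** M) *v v) = (M *v u) \<bullet> (M *v v)"
  for M :: "real^'n^'m"
  unfolding matrix_vector_mul_assoc[symmetric] transpose_matrix_vector inner_commute[of u] dot_lmul_matrix
  by (rule inner_commute)

lemma ip_gram: "ip (transpose M ** M) u v = (M *v u) \<bullet> (M *v v)"
  by (simp only: ip_def inner_gram)

lemma matrix_inv_eqI: "A ** B = mat 1 \<Longrightarrow> matrix_inv A = B" for A B :: "real^'n^'n"
proof -
  assume AB: "A ** B = mat 1"
  then have "\<exists>A'. A ** A' = mat 1 \<and> A' ** A = mat 1"
    using matrix_left_right_inverse by blast
  from someI_ex[OF this] have "matrix_inv A ** A = mat 1"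
    unfolding matrix_inv_def by blast
  then have "matrix_inv A ** (A ** B) = B"
    by (simp add: matrix_mul_assoc)
  then show ?thesis
    by (simp add: AB)
qed

text \<open>The product rule when \<open>Q\<close> is only known to be differentiable on constant
  vectors: uniqueness of derivatives makes \<open>D u\<close> linear, and then \<open>Y\<close> can
  be expanded in the basis.\<close>

lemma matrix_vec_bilinear_has_derivative:
  fixes Q :: "real^8 \<Rightarrow> real^8^'m"
  assumes "\<And>v. ((\<lambda>y. Q y *v v) has_derivative (\<lambda>u. D u v)) (at x)"
    and "(Y has_derivative Y') (at x)"
  shows "((\<lambda>y. Q y *v Y y) has_derivative (\<lambda>u. D u (Y x) + Q x *v Y' u)) (at x)"
proof -
  have add: "(\<lambda>u. D u (v + w)) = (\<lambda>u. D u v + D u w)" for v w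
    by (rule has_derivative_unique[OF assms(1)[of "v + w", unfolded matrix_vector_right_distrib]
          has_derivative_add[OF assms(1) assms(1)]])
  have scale: "(\<lambda>u. D u (c *\<^sub>R v)) = (\<lambda>u. c *\<^sub>R D u v)" for c v
    by (rule has_derivative_unique[OF assms(1)[of "c *\<^sub>R v", unfolded matrix_vector_mult_scaleR]
          has_derivative_scaleR_right[OF assms(1)]])
  have lin: "linear (D u)" for u
    using fun_cong[OF add] fun_cong[OF scale] by (intro linearI) blast+
  have "((\<lambda>y. \<Sum>i\<in>UNIV. Y y $ i *\<^sub>R (Q y *v ax i)) has_derivative
      (\<lambda>u. \<Sum>i\<in>UNIV. Y x $ i *\<^sub>R D u (ax i) + Y' u $ i *\<^sub>R (Q x *v ax i))) (at x)"
    by (intro has_derivative_sum has_derivative_scaleR assms(1)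
        bounded_linear.has_derivative[OF bounded_linear_vec_nth assms(2)])
  then show ?thesis
    by (simp add: sum.distrib linear_expand_8[OF lin, symmetric]
        linear_expand_8[OF matrix_vector_mul_linear, symmetric])
qed

section \<open>The connection of a bracket\<close>

text \<open>Koszul's formula in an orthonormal frame with brackets \<open>L\<close>, where the
  derivatives of the inner products vanish. The Levi-Civita connection of a \<open>coframe\<close>
  is \<open>h\<close> times this.\<close>

definition koszul :: "(real^8 \<Rightarrow> real^8 \<Rightarrow> real^8) \<Rightarrow> real^8 \<Rightarrow> real^8 \<Rightarrow> real^8" where
  "koszul L X Y = (\<chi> k. (L X Y \<bullet> ax k - L Y (ax k) \<bullet> X + L (ax k) X \<bullet> Y) / 2)"

text \<open>Bilinearity and skewness are what remains of a Lie bracket when \<open>h\<close> varies: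
  for \<open>np_L\<close> the Jacobi identity fails on the basis vectors 4, 6, 7, and the defect is
  balanced by the derivative of \<open>h\<close> in d(d\<theta>) = 0.\<close>

locale bracket =
  fixes L :: "real^8 \<Rightarrow> real^8 \<Rightarrow> real^8"
  assumes bilinear: "bilinear L" and antisym: "L X Y = - L Y X"
begin

lemma koszul_inner: "koszul L X Y \<bullet> Z = (L X Y \<bullet> Z - L Y Z \<bullet> X + L Z X \<bullet> Y) / 2"
proof -
  have "linear (\<lambda>Z. (L X Y \<bullet> Z - L Y Z \<bullet> X + L Z X \<bullet> Y) / 2)"
    using bilinear
    by (intro linearI) (auto simp: bilinear_ladd bilinear_radd bilinear_lmul bilinear_rmul
        inner_add_left inner_add_right algebra_simps add_divide_distrib diff_divide_distrib)
  from linear_expand_8[OF this, of Z] show ?thesis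
    by (simp add: koszul_def inner_vec_def mult.commute)
qed

lemma koszul_bilinear: "bilinear (koszul L)"
proof -
  have "koszul L (X + X') Y = koszul L X Y + koszul L X' Y"
    "koszul L Y (X + X') = koszul L Y X + koszul L Y X'"
    "koszul L (c *\<^sub>R X) Y = c *\<^sub>R koszul L X Y" "koszul L Y (c *\<^sub>R X) = c *\<^sub>R koszul L Y X" for X X' Y c
    using bilinear
    by (auto simp: koszul_def vec_eq_iff bilinear_ladd bilinear_radd bilinear_lmul bilinear_rmul
        inner_add_left inner_add_right algebra_simps add_divide_distrib diff_divide_distrib)
  then show ?thesis
    by (auto simp: bilinear_def intro!: linearI)
qed

lemma koszul_skew: "koszul L X Y \<bullet> Z = - (Y \<bullet> koszul L X Z)"
proof -
  have "L Y Z = - L Z Y" "L X Y = - L Y X" "L Z X = - L X Z" by (rule antisym)+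
  then show ?thesis
    by (simp add: koszul_inner inner_commute[of Y] field_simps)
qed

lemma koszul_torsion_free: "koszul L X Y - koszul L Y X = L X Y"
proof -
  have "(koszul L X Y - koszul L Y X) \<bullet> Z = L X Y \<bullet> Z" for Z
    using antisym[of X Y] antisym[of Z X] antisym[of Z Y]
    by (simp add: inner_diff_left koszul_inner field_simps)
  then show ?thesis
    by (metis vector_eq_rdot)
qed

definition conn_mat :: "real^8 \<Rightarrow> real^8^8" where
  "conn_mat X = matrix (koszul L X)"

lemma conn_mat_mult [simp]: "conn_mat X *v Y = koszul L X Y"
  using koszul_bilinear unfolding conn_mat_def bilinear_def by (simp add: matrix_works)

text \<open>The curvature divided by the square of \<open>h\<close>. The first two terms arise from
  differentiating \<open>h\<close> in the connection, where the derivative of \<open>h\<close> along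
  \<open>X\<close> is its square times \<open>l X\<close>; the third is the bracket term.\<close>

definition curv :: "(real^8 \<Rightarrow> real) \<Rightarrow> real^8 \<Rightarrow> real^8 \<Rightarrow> real^8 \<Rightarrow> real^8" where
  "curv l X Y W = l X *\<^sub>R koszul L Y W - l Y *\<^sub>R koszul L X W - koszul L (L X Y) W
     + koszul L X (koszul L Y W) - koszul L Y (koszul L X W)"

lemma linear_curv:
  assumes "linear l"
  shows "linear (\<lambda>X. curv l X Y W)"
proof -
  have a: "linear (\<lambda>X. koszul L X Z)" "linear (koszul L Z)" "linear (\<lambda>X. L X Z)" for Z
    using koszul_bilinear bilinear by (auto simp: bilinear_def)
  have "linear (\<lambda>X. koszul L (L X Y) W)" "linear (\<lambda>X. koszul L Y (koszul L X W))"
    using linear_compose[OF a(3)[of Y] a(1)[of W]] linear_compose[OF a(1)[of W] a(2)[of Y]]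
    by (simp_all add: o_def)
  moreover have "linear (\<lambda>X. l X *\<^sub>R koszul L Y W)"
    using linear_compose[OF assms linear_scaleR_left] by (simp add: o_def)
  moreover have "linear (\<lambda>X. l Y *\<^sub>R koszul L X W)"
    by (rule linear_compose_scale_right[OF a(1)])
  ultimately show ?thesis
    unfolding curv_def by (intro linear_compose_add linear_compose_sub a)
qed

lemma linear_curv_2:
  assumes "linear l"
  shows "linear (\<lambda>Y. curv l X Y W)"
proof -
  have "curv l X Y W = - curv l Y X W" for Y
    using antisym[of X Y] by (simp add: curv_def bilinear_lneg[OF koszul_bilinear])
  then show ?thesis
    using linear_compose_neg[OF linear_curv[OF assms]] by simp
qed

end

section \<open>Coframes whose structure functions are multiples of constants\<close>

text \<open>
  The rows of \<open>P\<close> are 1-forms \<open>\<theta>\<^sup>i\<close> with dual frame \<open>E\<close>, and \<open>D x u v\<close> is the derivative of \<open>\<theta>(v)\<close> in the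
  direction \<open>u\<close>. The structure equation says \<open>d\<theta> = - h L(\<theta>, \<theta>)\<close>, and \<open>dh = h\<^sup>2 \<lambda>(\<theta>)\<close>.
\<close>

locale coframe = bracket L for L +
  fixes P E :: "real^8 \<Rightarrow> real^8^8" and D :: "real^8 \<Rightarrow> real^8 \<Rightarrow> real^8 \<Rightarrow> real^8"
    and D2 :: "real^8 \<Rightarrow> real^8 \<Rightarrow> real^8 \<Rightarrow> real^8 \<Rightarrow> real^8"
    and h :: "real^8 \<Rightarrow> real" and lam :: "real^8 \<Rightarrow> real"
  assumes P_smooth: "exp_poly_map P" and E_smooth: "exp_poly_map E"
    and P_E: "P x ** E x = mat 1"
    and det_P: "det (P x) > 0"
    and D: "((\<lambda>y. P y *v v) has_derivative (\<lambda>u. D x u v)) (at x)"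
    and D2: "((\<lambda>y. D y u v) has_derivative (\<lambda>w. D2 x w u v)) (at x)"
    and D2_sym: "D2 x w u v = D2 x u w v"
    and h: "(h has_derivative (\<lambda>u. (h x)\<^sup>2 * lam (P x *v u))) (at x)"
    and lam: "linear lam"
    and structure_eq: "D x u v - D x v u = - (h x *\<^sub>R L (P x *v u) (P x *v v))"
begin

definition G :: "real^8 \<Rightarrow> real^8^8" where
  "G x = transpose (P x) ** P x"

definition pull :: "form \<Rightarrow> real^8 \<Rightarrow> form" where
  "pull \<omega> x vs = \<omega> (map ((*v) (P x)) vs)"

lemma E_P: "E x ** P x = mat 1"
  using P_E matrix_left_right_inverse by blast

lemma P_E_mult [simp]: "P x *v (E x *v v) = v" "E x *v (P x *v v) = v"
  by (simp_all add: matrix_vector_mul_assoc P_E E_P)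

lemma ip_G: "ip (G x) u v = (P x *v u) \<bullet> (P x *v v)"
  unfolding G_def by (rule ip_gram)

lemma G_inv: "matrix_inv (G x) = E x ** transpose (E x)"
proof (rule matrix_inv_eqI)
  have "G x ** (E x ** transpose (E x)) = transpose (P x) ** (P x ** E x) ** transpose (E x)"
    by (simp add: G_def matrix_mul_assoc)
  also have "\<dots> = transpose (E x ** P x)"
    by (simp add: P_E matrix_transpose_mul)
  finally show "G x ** (E x ** transpose (E x)) = mat 1"
    by (simp add: E_P)
qed

lemma G_inv_mult: "matrix_inv (G x) *v (G x *v v) = v"
proof -
  have "E x ** transpose (E x) ** G x = E x ** transpose (P x ** E x) ** P x"
    by (simp add: G_def matrix_transpose_mul matrix_mul_assoc)
  then show ?thesis
    by (simp add: G_inv matrix_vector_mul_assoc P_E E_P)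
qed

text \<open>In frame components a constant field \<open>v\<close> is \<open>P x *v v\<close>: its
  covariant derivative is the plain derivative \<open>D\<close> plus the connection of the frame.
  The proof lowers the index with \<open>G\<close> and uses \<open>structure_eq\<close> to bring all
  values of \<open>D\<close> to the same order of arguments.\<close>

lemma christoffel_G:
  "christoffel G x u v = E x *v (D x u v + h x *\<^sub>R koszul L (P x *v u) (P x *v v))"
  (is "_ = E x *v ?C")
proof -
  have der: "dir_deriv (\<lambda>y. ip (G y) a b) x c = D x c b \<bullet> (P x *v a) + D x c a \<bullet> (P x *v b)" for a b c
    unfolding ip_G
    by (subst dir_deriv_eq[OF has_derivative_inner[OF D D]]) (simp add: inner_commute)
  let ?f = "\<chi> k. (dir_deriv (\<lambda>y. ip (G y) v (ax k)) x u + dir_deriv (\<lambda>y. ip (G y) u (ax k)) x v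
            - dir_deriv (\<lambda>y. ip (G y) u v) x (ax k)) / 2"
  have "?f $ k = (G x *v (E x *v ?C)) $ k" for k
  proof -
    let ?U = "P x *v u" and ?V = "P x *v v" and ?K = "P x *v ax k"
    have "(G x *v (E x *v ?C)) $ k = ip (G x) (ax k) (E x *v ?C)"
      by (simp add: ip_def inner_axis')
    also have "\<dots> = ?C \<bullet> ?K"
      by (simp add: ip_G inner_commute)
    also have "\<dots> = D x u v \<bullet> ?K + h x * ((L ?U ?V \<bullet> ?K - L ?V ?K \<bullet> ?U + L ?K ?U \<bullet> ?V) / 2)"
      by (simp only: inner_add_left inner_scaleR_left koszul_inner)
    finally have e: "(G x *v (E x *v ?C)) $ k = \<dots>" .
    have e1: "D x b a \<bullet> c = D x a b \<bullet> c + h x * (L (P x *v a) (P x *v b) \<bullet> c)" for a b c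
    proof -
      have "D x b a = D x a b + h x *\<^sub>R L (P x *v a) (P x *v b)"
        using structure_eq[of x a b] by (simp add: algebra_simps)
      then show ?thesis by (simp only: inner_add_left inner_scaleR_left)
    qed
    have e4: "L ?K ?U \<bullet> ?V = - (L ?U ?K \<bullet> ?V)"
      by (subst antisym) simp
    show ?thesis
      unfolding e vec_lambda_beta der e1[where a = u and b = v] e1[where a = v and b = "ax k"]
        e1[where a = u and b = "ax k"] e4
      by (simp add: field_simps)
  qed
  then have "?f = G x *v (E x *v ?C)"
    by (subst vec_eq_iff) blast
  then show ?thesis
    unfolding christoffel_def by (simp only: G_inv_mult)
qed

lemma P_christoffel: "P x *v christoffel G x u v = D x u v + h x *\<^sub>R koszul L (P x *v u) (P x *v v)"
  by (simp add: christoffel_G)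

lemma christoffel_sym: "christoffel G x u v = christoffel G x v u"
proof -
  have "D x u v + h x *\<^sub>R koszul L (P x *v u) (P x *v v) = D x v u + h x *\<^sub>R koszul L (P x *v v) (P x *v u)"
    using structure_eq[of x u v] koszul_torsion_free[of "P x *v u" "P x *v v"]
    by (simp add: algebra_simps scaleR_diff_right[symmetric])
  then show ?thesis
    by (simp only: christoffel_G)
qed

text \<open>The Christoffel symbols disappear here: the \<open>D\<close> that they contain is
  exactly the missing term of the product rule for \<open>P y *v Y y\<close>.\<close>

lemma P_nabla_vec:
  assumes "Y differentiable (at x)" and "((\<lambda>y. P y *v Y y) has_derivative Z') (at x)"
  shows "P x *v nabla_vec G x u Y = Z' u + h x *\<^sub>R koszul L (P x *v u) (P x *v Y x)"
proof -
  obtain Y' where Y': "(Y has_derivative Y') (at x)"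
    using assms(1) unfolding differentiable_def by blast
  have "Z' = (\<lambda>u. D x u (Y x) + P x *v Y' u)"
    by (rule has_derivative_unique[OF assms(2) matrix_vec_bilinear_has_derivative[OF D Y']])
  then show ?thesis
    by (simp add: nabla_vec_def matrix_vector_right_distrib dir_deriv_eq[OF Y'] P_christoffel)
qed

text \<open>\<open>P_nabla_vec\<close> asks for differentiability of a field in coordinates, while
  the fields of interest are known through their frame components.\<close>

lemma E_differentiable:
  assumes "Z differentiable (at x)"
  shows "(\<lambda>y. E y *v Z y) differentiable (at x)"
proof -
  note Z' = assms[unfolded frechet_derivative_works]
  have E': "(E has_derivative frechet_derivative E (at x)) (at x)"
    using exp_poly_map_differentiable[OF E_smooth] frechet_derivative_works by (rule iffD1[rotated])
  have "bounded_linear (\<lambda>M :: real^8^8. M *v v)" for v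
    by (intro linear_conv_bounded_linear[THEN iffD1] linearI)
      (auto simp: matrix_vector_mult_add_rdistrib scaleR_matrix_vector_assoc)
  then have "((\<lambda>y. E y *v v) has_derivative (\<lambda>u. frechet_derivative E (at x) u *v v)) (at x)" for v
    by (rule bounded_linear.has_derivative[OF _ E'])
  from matrix_vec_bilinear_has_derivative[OF this Z'] show ?thesis
    by (rule differentiableI)
qed

lemma koszul_has_derivative:
  assumes "(f has_derivative f') (at x)" "(g has_derivative g') (at x)"
  shows "((\<lambda>y. koszul L (f y) (g y)) has_derivative (\<lambda>u. koszul L (f x) (g' u) + koszul L (f' u) (g x))) (at x)"
  by (rule bounded_bilinear.FDERIV[OF bilinear_conv_bounded_bilinear[THEN iffD1, OF koszul_bilinear] assms])

text \<open>\<open>P_nabla_vec\<close> is applied to fields that are themselves covariant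
  derivatives. Second derivatives cancel by \<open>D2_sym\<close>, the mixed first-order terms
  cancel in pairs, and exchanging \<open>u\<close> and \<open>v\<close> in the remaining
  \<open>D x u v\<close> produces the bracket term through \<open>structure_eq\<close>.\<close>

lemma P_curvature: "P x *v curvature G x u v w = (h x)\<^sup>2 *\<^sub>R curv lam (P x *v u) (P x *v v) (P x *v w)"
proof -
  let ?Z = "\<lambda>v y. D y v w + h y *\<^sub>R koszul L (P y *v v) (P y *v w)"
  define Z' where "Z' v u = D2 x u v w + (h x *\<^sub>R (koszul L (P x *v v) (D x u w) + koszul L (D x u v) (P x *v w))
      + ((h x)\<^sup>2 * lam (P x *v u)) *\<^sub>R koszul L (P x *v v) (P x *v w))" for v u
  have Z': "(?Z v has_derivative Z' v) (at x)" for v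
    unfolding Z'_def
    by (intro has_derivative_add has_derivative_scaleR D2 h koszul_has_derivative D)
  have nabla: "P x *v nabla_vec G x u (\<lambda>y. christoffel G y v w) = Z' v u + h x *\<^sub>R koszul L (P x *v u) (?Z v x)" for u v
  proof -
    have "(\<lambda>y. christoffel G y v w) differentiable (at x)"
      unfolding christoffel_G by (rule E_differentiable) (use Z' in \<open>auto simp: differentiable_def\<close>)
    from P_nabla_vec[OF this, unfolded P_christoffel, OF Z'] show ?thesis .
  qed
  let ?R = "D2 x u v w" and ?A1 = "koszul L (P x *v v) (D x u w)" and ?A2 = "koszul L (D x v u) (P x *v w)"
    and ?A3 = "koszul L (P x *v v) (P x *v w)" and ?A3' = "koszul L (P x *v u) (P x *v w)"
    and ?B1 = "koszul L (P x *v u) (D x v w)" and ?Q = "koszul L (L (P x *v u) (P x *v v)) (P x *v w)"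
    and ?l = "lam (P x *v u)" and ?l' = "lam (P x *v v)"
  let ?B2 = "koszul L (P x *v u) ?A3" and ?C2 = "koszul L (P x *v v) ?A3'"
  have q: "koszul L (D x u v) (P x *v w) = ?A2 - h x *\<^sub>R ?Q"
  proof -
    have "D x u v = D x v u - h x *\<^sub>R L (P x *v u) (P x *v v)"
      using structure_eq[of x u v] by (simp add: algebra_simps)
    then show ?thesis
      by (simp add: bilinear_lsub[OF koszul_bilinear] bilinear_lmul[OF koszul_bilinear])
  qed
  have n1: "P x *v nabla_vec G x u (\<lambda>y. christoffel G y v w) =
      ?R + (h x *\<^sub>R (?A1 + (?A2 - h x *\<^sub>R ?Q)) + ((h x)\<^sup>2 * ?l) *\<^sub>R ?A3) + h x *\<^sub>R (?B1 + h x *\<^sub>R ?B2)"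
    by (simp only: nabla Z'_def q bilinear_radd[OF koszul_bilinear] bilinear_rmul[OF koszul_bilinear])
  have n2: "P x *v nabla_vec G x v (\<lambda>y. christoffel G y u w) =
      ?R + (h x *\<^sub>R (?B1 + ?A2) + ((h x)\<^sup>2 * ?l') *\<^sub>R ?A3') + h x *\<^sub>R (?A1 + h x *\<^sub>R ?C2)"
    by (simp only: nabla Z'_def D2_sym[of x v u] bilinear_radd[OF koszul_bilinear] bilinear_rmul[OF koszul_bilinear])
  have "(R + (c *\<^sub>R (A1 + (A2 - c *\<^sub>R Q)) + (c\<^sup>2 * l) *\<^sub>R A3) + c *\<^sub>R (B1 + c *\<^sub>R B2))
      - (R + (c *\<^sub>R (B1 + A2) + (c\<^sup>2 * l') *\<^sub>R A3') + c *\<^sub>R (A1 + c *\<^sub>R C2))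
      = c\<^sup>2 *\<^sub>R (l *\<^sub>R A3 - l' *\<^sub>R A3' - Q + B2 - C2)" for R A1 A2 A3 A3' B1 B2 C2 Q :: "real^8" and c l l'
    by (simp add: algebra_simps power2_eq_square)
  then show ?thesis
    by (simp only: curvature_def matrix_vector_mult_diff_distrib n1 n2 curv_def)
qed

lemma trace_matrix: "linear f \<Longrightarrow> trace (matrix f) = (\<Sum>k\<in>UNIV. f (ax k) $ k)" for f :: "real^8 \<Rightarrow> real^8"
  by (simp add: trace_def matrix_def)

text \<open>The trace over the coordinate basis is that of a matrix conjugated by
  \<open>P x\<close>, so it may be taken over the orthonormal frame.\<close>

lemma ricci_G: "ricci G x v w = (h x)\<^sup>2 * (\<Sum>a\<in>UNIV. curv lam (ax a) (P x *v v) (P x *v w) $ a)"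
proof -
  let ?M = "\<lambda>X. curv lam X (P x *v v) (P x *v w)"
  have lin: "linear ?M"
    by (rule linear_curv[OF lam])
  have "curvature G x u v w = (h x)\<^sup>2 *\<^sub>R (E x *v ?M (P x *v u))" for u
    using arg_cong[OF P_curvature[of x u v w], of "\<lambda>z. E x *v z"]
    by (simp add: matrix_vector_mult_scaleR)
  then have "ricci G x v w = (h x)\<^sup>2 * (\<Sum>k\<in>UNIV. (E x *v ?M (P x *v ax k)) $ k)"
    by (simp add: ricci_def sum_distrib_left)
  also have "(\<Sum>k\<in>UNIV. (E x *v ?M (P x *v ax k)) $ k) = trace (E x ** (matrix ?M ** P x))"
  proof -
    have "(E x *v ?M (P x *v ax k)) $ k = ((E x ** (matrix ?M ** P x)) *v ax k) $ k" for k
      by (simp add: matrix_vector_mul_assoc[symmetric] fun_cong[OF matrix_vector_mul(2)[OF lin]])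
    then show ?thesis
      by (simp add: trace_def matrix_vector_mult_basis column_def)
  qed
  also have "\<dots> = trace (matrix ?M)"
    by (simp add: trace_mul_sym[of "E x"] matrix_mul_assoc[symmetric] P_E)
  finally show ?thesis
    by (simp add: trace_matrix[OF lin])
qed

end

section \<open>The volume form and the Hodge star\<close>

lemma linear_vanish: "linear f \<Longrightarrow> (\<And>i. f (ax i) = 0) \<Longrightarrow> f v = 0" for f :: "real^8 \<Rightarrow> real"
  by (simp add: linear_expand_8[of f v])

text \<open>By multilinearity the arguments can be replaced by basis vectors one at a time, and
  among more than eight basis vectors one is repeated.\<close>

lemma alt_form_vanish:
  assumes \<omega>: "alt_form k \<omega>" and k: "8 < k" and vs: "length vs = k"
  shows "\<omega> vs = 0"
proof -
  have "\<omega> (map ax is @ rest) = 0" if "length is + length rest = k" for "is" rest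
    using that
  proof (induction rest arbitrary: "is")
    case Nil
    have "\<not> distinct is"
    proof
      assume "distinct is"
      then have "length is \<le> CARD(8)"
        by (metis card_mono distinct_card finite top_greatest)
      then show False using Nil k by simp
    qed
    then obtain as a bs cs where "is = as @ a # bs @ a # cs"
      using not_distinct_decomp by fastforce
    then show ?case
      using Nil alt_form_eq_0[OF \<omega>, of "map ax as" "map ax bs" "map ax cs" "ax a"] by simp
  next
    case (Cons v rest)
    have lin: "linear (\<lambda>u. \<omega> (map ax is @ u # rest))"
      by (rule alt_form_linear[OF \<omega>]) (use Cons.prems in simp)
    show ?case
      by (rule linear_vanish[OF lin]) (use Cons.IH[of "is @ [_]"] Cons.prems in simp)
  qed
  from this[of "[]" vs] vs show ?thesis by simp
qed

section \<open>Wedge product with a 1-form, and forms of top degree\<close>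

definition wedge1 :: "(real^8 \<Rightarrow> real) \<Rightarrow> form \<Rightarrow> form" where
  "wedge1 l \<omega> vs = (\<Sum>j<length vs. (-1) ^ j * (l (vs ! j) * \<omega> (drop_nth j vs)))"

lemma drop_nth_update_same: "drop_nth j (vs[j := u]) = drop_nth j vs"
  by (simp add: drop_nth_def)

lemma drop_nth_update_other:
  "m < length vs \<Longrightarrow> j < length vs \<Longrightarrow> j \<noteq> m \<Longrightarrow>
    drop_nth j (vs[m := u]) = (drop_nth j vs)[(if m < j then m else m - 1) := u]"
  by (rule nth_equalityI) (auto simp: nth_drop_nth nth_list_update)

lemma alt_form_wedge1:
  assumes \<omega>: "alt_form k \<omega>" and l: "linear l"
  shows "alt_form (Suc k) (wedge1 l \<omega>)"
  unfolding alt_form_def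
proof (intro conjI allI impI; elim conjE)
  fix vs :: "(real^8) list" and m
  assume vs: "length vs = Suc k" and m: "m < Suc k"
  have "linear (\<lambda>u. (-1) ^ j * (l (vs[m := u] ! j) * \<omega> (drop_nth j (vs[m := u]))))" if j: "j < Suc k" for j
  proof (cases "j = m")
    case True
    have "linear (\<lambda>u. l u * \<omega> (drop_nth m vs))"
      using linear_compose[OF l linear_times[of "\<omega> (drop_nth m vs)"]] by (simp add: o_def mult.commute)
    from linear_compose[OF this linear_times, of "(-1) ^ j"] show ?thesis
      using True vs m by (simp add: drop_nth_update_same o_def)
  next
    case False
    have "linear (\<lambda>u. \<omega> ((drop_nth j vs)[(if m < j then m else m - 1) := u]))"
      by (rule alt_form_linear_nth[OF \<omega>]) (use vs j m False in auto)
    from linear_compose[OF this linear_times, of "(-1) ^ j * l (vs ! j)"] show ?thesis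
      using False vs m j by (simp add: drop_nth_update_other o_def mult.assoc)
  qed
  then show "linear (\<lambda>u. wedge1 l \<omega> (vs[m := u]))"
    unfolding wedge1_def using vs by (simp add: linear_compose_sum del: sum.lessThan_Suc)
next
  fix vs :: "(real^8) list" and a b
  assume vs: "length vs = Suc k" and ab: "a < b" "b < Suc k" and eq: "vs ! a = vs ! b"
  have 0: "\<omega> (drop_nth j vs) = 0" if "j < Suc k" "j \<noteq> a" "j \<noteq> b" for j
  proof -
    define p q where "p = (if a < j then a else a - 1)" and "q = (if b < j then b else b - 1)"
    have pq: "p < q" "q < k" using that ab by (auto simp: p_def q_def)
    have "drop_nth j vs ! p = vs ! a" "drop_nth j vs ! q = vs ! b"
      using that ab vs by (auto simp: p_def q_def nth_drop_nth)
    with eq pq vs that show ?thesis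
      using \<omega> unfolding alt_form_def by (metis diff_Suc_1 length_drop_nth)
  qed
  have "drop_nth a vs = (drop_nth a vs)[b - 1 := vs ! b]" "drop_nth b vs = (drop_nth b vs)[a := vs ! b]"
    using ab vs eq by (auto intro!: nth_equalityI simp: nth_drop_nth nth_list_update)
  then have "(-1) ^ a * \<omega> (drop_nth a vs) = - ((-1) ^ b * \<omega> (drop_nth b vs))"
    using drop_nth_update_swap[OF \<omega> vs, of a b "vs ! b"] ab by simp
  then have ab0: "(-1) ^ a * (l (vs ! a) * \<omega> (drop_nth a vs)) + (-1) ^ b * (l (vs ! b) * \<omega> (drop_nth b vs)) = 0"
    using eq by (simp add: mult.left_commute[of _ "l _"] distrib_left[symmetric])
  have "wedge1 l \<omega> vs = (\<Sum>j\<in>{a, b}. (-1) ^ j * (l (vs ! j) * \<omega> (drop_nth j vs)))"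
    unfolding wedge1_def by (rule sum.mono_neutral_right) (use vs ab 0 in auto)
  then show "wedge1 l \<omega> vs = 0"
    using ab0 ab by simp
qed

text \<open>This is where the dimension enters: expanding the zero for suitable \<open>l\<close>
  gives \<open>alt_form_top_trace\<close> and \<open>alternating_sum_star\<close>.\<close>

lemma wedge1_top: "alt_form 8 \<omega> \<Longrightarrow> linear l \<Longrightarrow> length vs = 9 \<Longrightarrow> wedge1 l \<omega> vs = 0"
  using alt_form_vanish[OF alt_form_wedge1, of 8 \<omega> l vs] by simp

lemma alt_form_replace:
  assumes "alt_form k \<omega>" "length us = k" "l < k"
  shows "\<omega> (u # drop_nth l us) = (-1) ^ l * \<omega> (us[l := u])"
proof -
  have "\<omega> (take l us @ u # drop (Suc l) us) = (-1) ^ l * \<omega> (u # take l us @ drop (Suc l) us)"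
    using alt_form_move[OF assms(1), of "[]" "take l us" "drop (Suc l) us" u] assms by simp
  then show ?thesis
    using assms by (simp add: drop_nth_def upd_conv_take_nth_drop)
qed

text \<open>A coordinate 1-form wedged with a top form vanishes; evaluated on \<open>ax i\<close>
  followed by \<open>us\<close> this is a cofactor expansion, and summing it against the entries of
  \<open>M\<close> gives the trace.\<close>

lemma alt_form_top_trace:
  assumes \<omega>: "alt_form 8 \<omega>" and us: "length us = 8"
  shows "(\<Sum>l<8. \<omega> (us[l := M *v (us ! l)])) = trace M * \<omega> us"
proof -
  have cof: "(\<Sum>l<8. us ! l $ k * \<omega> (us[l := ax i])) = (if i = k then \<omega> us else 0)" for i k
  proof -
    have lin: "linear (\<lambda>v :: real^8. v $ k)"
      by (intro linearI) auto
    have "0 = wedge1 (\<lambda>v. v $ k) \<omega> (ax i # us)"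
      by (rule wedge1_top[OF \<omega> lin, symmetric]) (use us in simp)
    also have "\<dots> = (\<Sum>j<Suc 8. (-1) ^ j * ((ax i # us) ! j $ k * \<omega> (drop_nth j (ax i # us))))"
      using us by (simp add: wedge1_def)
    also have "\<dots> = ax i $ k * \<omega> us
        + (\<Sum>l<8. (-1) ^ Suc l * (us ! l $ k * \<omega> (ax i # drop_nth l us)))"
      by (subst sum.lessThan_Suc_shift) (simp add: drop_nth_def)
    also have "(\<Sum>l<8. (-1) ^ Suc l * (us ! l $ k * \<omega> (ax i # drop_nth l us)))
        = - (\<Sum>l<8. us ! l $ k * \<omega> (us[l := ax i]))"
      unfolding sum_negf[symmetric]
      by (rule sum.cong) (use us in \<open>simp_all add: alt_form_replace[OF \<omega>] mult.left_commute
            power_mult_distrib[symmetric] flip: mult.assoc\<close>)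
    finally show ?thesis by (simp add: axis_def split: if_splits)
  qed
  have "\<omega> (us[l := M *v (us ! l)]) = (\<Sum>i\<in>UNIV. \<Sum>k\<in>UNIV. M $ i $ k * (us ! l $ k * \<omega> (us[l := ax i])))"
    if "l < 8" for l
    using linear_expand_8[OF alt_form_linear_nth[OF \<omega> us that], of "M *v (us ! l)"]
    by (simp add: matrix_vector_mult_def sum_distrib_right mult.assoc)
  then have "(\<Sum>l<8. \<omega> (us[l := M *v (us ! l)]))
      = (\<Sum>l<8. \<Sum>i\<in>UNIV. \<Sum>k\<in>UNIV. M $ i $ k * (us ! l $ k * \<omega> (us[l := ax i])))"
    by simp
  also have "\<dots> = (\<Sum>i\<in>UNIV. \<Sum>l<8. \<Sum>k\<in>UNIV. M $ i $ k * (us ! l $ k * \<omega> (us[l := ax i])))"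
    by (rule sum.swap)
  also have "\<dots> = (\<Sum>i\<in>UNIV. \<Sum>k\<in>UNIV. \<Sum>l<8. M $ i $ k * (us ! l $ k * \<omega> (us[l := ax i])))"
    by (intro sum.cong refl sum.swap)
  also have "\<dots> = (\<Sum>i\<in>UNIV. \<Sum>k\<in>UNIV. M $ i $ k * (if i = k then \<omega> us else 0))"
    by (simp only: sum_distrib_left[symmetric] cof)
  also have "\<dots> = trace M * \<omega> us"
    by (simp add: trace_def sum_distrib_right if_distrib cong: if_cong)
  finally show ?thesis .
qed

text \<open>The position in \<open>idx8\<close>. As \<open>8 = 0\<close> in the index type, the zero
  index comes last.\<close>

definition pos8 :: "8 \<Rightarrow> nat" where
  "pos8 a = (if a = 1 then 0 else if a = 2 then 1 else if a = 3 then 2 else if a = 4 then 3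
     else if a = 5 then 4 else if a = 6 then 5 else if a = 7 then 6 else 7)"

lemma length_8_cases:
  assumes "length vs = 8"
  obtains a b c d e f g h where "vs = [a, b, c, d, e, f, g, h]"
  using assms by (auto simp: numeral_eq_Suc length_Suc_conv)

lemma map_of_idx8: "length vs = 8 \<Longrightarrow> the (map_of (zip idx8 vs) a) = vs ! pos8 a"
proof (elim length_8_cases)
  fix v1 v2 v3 v4 v5 v6 v7 v8 assume vs: "vs = [v1, v2, v3, v4, v5, v6, v7, v8]"
  have "\<forall>a. the (map_of (zip idx8 vs) a) = vs ! pos8 a"
    unfolding forall_8 vs by (simp add: idx8_def pos8_def)
  then show ?thesis ..
qed

lemma det8_eq: "length vs = 8 \<Longrightarrow> det8 vs = det ((\<chi> a. vs ! pos8 a) :: real^8^8)"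
  unfolding det8_def by (simp only: map_of_idx8)

lemma pos8_surj: "j < 8 \<Longrightarrow> \<exists>a. pos8 a = j"
proof -
  assume "j < 8"
  then have "j \<in> {0, 1, 2, 3, 4, 5, 6, 7}" by auto
  moreover have "pos8 1 = 0" "pos8 2 = 1" "pos8 3 = 2" "pos8 4 = 3" "pos8 5 = 4" "pos8 6 = 5" "pos8 7 = 6" "pos8 8 = 7"
    by (simp_all add: pos8_def)
  ultimately show ?thesis by blast
qed

lemma pos8_less: "pos8 a < 8"
  by (simp add: pos8_def)

lemma pos8_eq_iff: "pos8 a = pos8 b \<longleftrightarrow> a = b"
proof -
  have "\<forall>a b. pos8 a = pos8 b \<longrightarrow> a = b"
    unfolding forall_8 by (simp add: pos8_def)
  then show ?thesis by blast
qed

lemma alt_form_det8: "alt_form 8 det8"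
  unfolding alt_form_def
proof (intro conjI allI impI; elim conjE)
  fix vs :: "(real^8) list" and j :: nat assume vs: "length vs = 8" "j < 8"
  obtain k where k: "pos8 k = j" using pos8_surj[OF vs(2)] ..
  have "vs[j := u] ! pos8 a = (if a = k then u else vs ! pos8 a)" for a u
    using vs k pos8_less[of a] pos8_eq_iff[of a k] by (auto simp: nth_list_update)
  then have "det8 (vs[j := u]) = det (\<chi> a. if a = k then u else vs ! pos8 a)" for u
    using vs by (simp add: det8_eq)
  then show "linear (\<lambda>u. det8 (vs[j := u]))"
    by (intro linearI) (simp_all add: det_row_add det_row_mul flip: scalar_mult_eq_scaleR)
next
  fix vs :: "(real^8) list" and i j :: nat
  assume vs: "length vs = 8" "i < j" "j < 8" "vs ! i = vs ! j"
  obtain k l where k: "pos8 k = i" "pos8 l = j" using pos8_surj[of i] pos8_surj[of j] vs by auto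
  show "det8 vs = 0"
    unfolding det8_eq[OF vs(1)]
    by (rule det_identical_rows[of k l]) (use vs k in \<open>auto simp: row_def\<close>)
qed

lemma det8_map: "length vs = 8 \<Longrightarrow> det8 (map ((*v) M) vs) = det M * det8 vs"
proof -
  assume vs: "length vs = 8"
  have "(\<chi> a. map ((*v) M) vs ! pos8 a) = (\<chi> a. vs ! pos8 a) ** transpose M"
    using vs pos8_less
    by (simp add: vec_eq_iff matrix_matrix_mult_def matrix_vector_mult_def transpose_def mult.commute)
  then show ?thesis
    using vs by (simp add: det8_eq det_mul det_transpose)
qed

lemma sum_lists_length_3: "(\<Sum>is\<in>{l :: 'a::finite list. length l = 3}. f is)
    = (\<Sum>a\<in>UNIV. \<Sum>b\<in>UNIV. \<Sum>c\<in>UNIV. f [a, b, c])"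
proof -
  have "(\<Sum>is\<in>{l :: 'a list. length l = 3}. f is) = (\<Sum>(a, b, c)\<in>UNIV. f [a, b, c])"
    by (rule sum.reindex_bij_witness[of _ "\<lambda>(a, b, c). [a, b, c]" "\<lambda>l. (l ! 0, l ! 1, l ! 2)"])
      (auto simp: numeral_eq_Suc length_Suc_conv)
  also have "\<dots> = (\<Sum>a\<in>UNIV. \<Sum>b\<in>UNIV. \<Sum>c\<in>UNIV. f [a, b, c])"
    by (simp add: sum.cartesian_product case_prod_unfold flip: UNIV_Times_UNIV)
  finally show ?thesis .
qed

section \<open>The Hodge star of the standard metric\<close>

definition star :: "form \<Rightarrow> form" where
  "star \<omega> ws = (\<Sum>a\<in>UNIV. \<Sum>b\<in>UNIV. \<Sum>c\<in>UNIV. \<omega> [ax a, ax b, ax c] * det8 ([ax a, ax b, ax c] @ ws)) / 6"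

lemma alt_form_add: "alt_form k \<omega> \<Longrightarrow> alt_form k \<eta> \<Longrightarrow> alt_form k (\<lambda>vs. \<omega> vs + \<eta> vs)"
  unfolding alt_form_def by (auto intro: linear_compose_add)

lemma alt_form_scale: "alt_form k \<omega> \<Longrightarrow> alt_form k (\<lambda>vs. c * \<omega> vs)"
  unfolding alt_form_def using linear_compose[OF _ linear_times[of c]] by (auto simp: o_def)

lemma alt_form_sum: "finite I \<Longrightarrow> (\<And>i. i \<in> I \<Longrightarrow> alt_form k (\<omega> i)) \<Longrightarrow> alt_form k (\<lambda>vs. \<Sum>i\<in>I. \<omega> i vs)"
proof (induction I rule: finite_induct)
  case empty
  show ?case by (auto simp: alt_form_def intro: linearI)
qed (auto intro: alt_form_add)

lemma alt_form_prefix: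
  assumes "alt_form (length us + k) \<omega>"
  shows "alt_form k (\<lambda>ws. \<omega> (us @ ws))"
  unfolding alt_form_def
proof (intro conjI allI impI; elim conjE)
  fix vs :: "(real^8) list" and j assume "length vs = k" "j < k"
  then show "linear (\<lambda>u. \<omega> (us @ vs[j := u]))"
    using alt_form_linear_nth[OF assms, of "us @ vs" "length us + j"] by (simp add: list_update_append)
next
  fix vs :: "(real^8) list" and i j assume vs: "length vs = k" "i < j" "j < k" "vs ! i = vs ! j"
  then have "(us @ vs) ! (length us + i) = (us @ vs) ! (length us + j)" "length us + i < length us + j"
    "length us + j < length us + k" "length (us @ vs) = length us + k" by auto
  then show "\<omega> (us @ vs) = 0"
    using assms unfolding alt_form_def by blast
qed

lemma alt_form_star: "alt_form 5 (star \<omega>)"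
proof -
  have "alt_form 5 (\<lambda>ws. \<Sum>a\<in>UNIV. \<Sum>b\<in>UNIV. \<Sum>c\<in>UNIV. \<omega> [ax a, ax b, ax c] * det8 ([ax a, ax b, ax c] @ ws))"
    using alt_form_det8 by (intro alt_form_sum alt_form_scale alt_form_prefix) auto
  from alt_form_scale[OF this, of "1/6"] show ?thesis
    unfolding star_def by (simp add: fun_eq_iff cong: arg_cong[where f = "alt_form 5"])
qed

text \<open>Because \<open>P ** E = mat 1\<close>, the vectors \<open>transpose E *v ax i\<close>
  and \<open>P *v ax i\<close> form dual bases, so they give the same invariant tensor as the
  standard basis. In this way contractions with the inverse metric in coordinates become
  contractions in the orthonormal frame.\<close>

lemma contraction:
  fixes f :: "real^8 \<Rightarrow> real^8 \<Rightarrow> real"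
  assumes "\<And>w. linear (\<lambda>u. f u w)" "\<And>u. linear (f u)" and "P ** E = mat 1"
  shows "(\<Sum>i\<in>UNIV. f (transpose E *v ax i) (P *v ax i)) = (\<Sum>a\<in>UNIV. f (ax a) (ax a))"
proof -
  have "f (transpose E *v ax i) (P *v ax i) = (\<Sum>a\<in>UNIV. \<Sum>b\<in>UNIV. (P $ b $ i * E $ i $ a) * f (ax a) (ax b))" for i
  proof -
    have 1: "f (transpose E *v ax i) w = (\<Sum>a\<in>UNIV. E $ i $ a * f (ax a) w)" for w
      using linear_expand_8[OF assms(1)[of w], of "transpose E *v ax i"]
      by (simp add: matrix_vector_mult_basis column_def transpose_def del: transpose_matrix_vector)
    have 2: "f u (P *v ax i) = (\<Sum>b\<in>UNIV. P $ b $ i * f u (ax b))" for u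
      using linear_expand_8[OF assms(2)[of u], of "P *v ax i"]
      by (simp add: matrix_vector_mult_basis column_def)
    show ?thesis
      by (simp only: 1) (simp only: 2 sum_distrib_left mult_ac)
  qed
  then have "(\<Sum>i\<in>UNIV. f (transpose E *v ax i) (P *v ax i))
      = (\<Sum>i\<in>UNIV. \<Sum>a\<in>UNIV. \<Sum>b\<in>UNIV. (P $ b $ i * E $ i $ a) * f (ax a) (ax b))"
    by simp
  also have "\<dots> = (\<Sum>a\<in>UNIV. \<Sum>i\<in>UNIV. \<Sum>b\<in>UNIV. (P $ b $ i * E $ i $ a) * f (ax a) (ax b))"
    by (rule sum.swap)
  also have "\<dots> = (\<Sum>a\<in>UNIV. \<Sum>b\<in>UNIV. \<Sum>i\<in>UNIV. (P $ b $ i * E $ i $ a) * f (ax a) (ax b))"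
    by (intro sum.cong refl sum.swap)
  also have "\<dots> = (\<Sum>a\<in>UNIV. \<Sum>b\<in>UNIV. (P ** E) $ b $ a * f (ax a) (ax b))"
    by (simp add: sum_distrib_right matrix_matrix_mult_def)
  also have "\<dots> = (\<Sum>a\<in>UNIV. f (ax a) (ax a))"
    by (simp add: assms(3) mat_def mult_delta_left)
  finally show ?thesis .
qed

lemma linear_mult_const: "linear f \<Longrightarrow> linear (\<lambda>u. f u * c)" "linear f \<Longrightarrow> linear (\<lambda>u. c * f u)"
  for f :: "real^8 \<Rightarrow> real"
  using linear_compose[OF _ linear_times[of c], of f] by (simp_all add: o_def mult.commute)

lemma contraction3:
  fixes f g :: "real^8 \<Rightarrow> real^8 \<Rightarrow> real^8 \<Rightarrow> real"
  assumes f: "\<And>v w. linear (\<lambda>u. f u v w)" "\<And>v w. linear (\<lambda>u. f v u w)" "\<And>v w. linear (\<lambda>u. f v w u)"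
    and g: "\<And>v w. linear (\<lambda>u. g u v w)" "\<And>v w. linear (\<lambda>u. g v u w)" "\<And>v w. linear (\<lambda>u. g v w u)"
    and PE: "P ** E = mat 1"
  shows "(\<Sum>i\<in>UNIV. \<Sum>j\<in>UNIV. \<Sum>k\<in>UNIV. f (transpose E *v ax i) (transpose E *v ax j) (transpose E *v ax k)
      * g (P *v ax i) (P *v ax j) (P *v ax k)) =
    (\<Sum>a\<in>UNIV. \<Sum>b\<in>UNIV. \<Sum>c\<in>UNIV. f (ax a) (ax b) (ax c) * g (ax a) (ax b) (ax c))"
proof -
  let ?E = "\<lambda>i. transpose E *v ax i" and ?P = "\<lambda>i. P *v ax i"
  have 3: "(\<Sum>k\<in>UNIV. f p q (?E k) * g p' q' (?P k)) = (\<Sum>c\<in>UNIV. f p q (ax c) * g p' q' (ax c))" for p q p' q'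
    by (rule contraction[OF _ _ PE, where f = "\<lambda>u w. f p q u * g p' q' w"]) (intro linear_mult_const f g)+
  have 2: "(\<Sum>j\<in>UNIV. f p (?E j) q * g p' (?P j) q') = (\<Sum>c\<in>UNIV. f p (ax c) q * g p' (ax c) q')" for p q p' q'
    by (rule contraction[OF _ _ PE, where f = "\<lambda>u w. f p u q * g p' w q'"]) (intro linear_mult_const f g)+
  have 1: "(\<Sum>i\<in>UNIV. f (?E i) p q * g (?P i) p' q') = (\<Sum>c\<in>UNIV. f (ax c) p q * g (ax c) p' q')" for p q p' q'
    by (rule contraction[OF _ _ PE, where f = "\<lambda>u w. f u p q * g w p' q'"]) (intro linear_mult_const f g)+
  have "(\<Sum>i\<in>UNIV. \<Sum>j\<in>UNIV. \<Sum>k\<in>UNIV. f (?E i) (?E j) (?E k) * g (?P i) (?P j) (?P k))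
      = (\<Sum>i\<in>UNIV. \<Sum>c\<in>UNIV. \<Sum>j\<in>UNIV. f (?E i) (?E j) (ax c) * g (?P i) (?P j) (ax c))"
    by (simp only: 3) (rule sum.cong[OF refl], rule sum.swap)
  also have "\<dots> = (\<Sum>c\<in>UNIV. \<Sum>b\<in>UNIV. \<Sum>i\<in>UNIV. f (?E i) (ax b) (ax c) * g (?P i) (ax b) (ax c))"
    by (simp only: 2) (rule trans[OF sum.swap], rule sum.cong[OF refl], rule sum.swap)
  also have "\<dots> = (\<Sum>c\<in>UNIV. \<Sum>a\<in>UNIV. \<Sum>b\<in>UNIV. f (ax a) (ax b) (ax c) * g (ax a) (ax b) (ax c))"
    by (simp only: 1) (rule sum.cong[OF refl], rule sum.swap)
  also have "\<dots> = (\<Sum>a\<in>UNIV. \<Sum>b\<in>UNIV. \<Sum>c\<in>UNIV. f (ax a) (ax b) (ax c) * g (ax a) (ax b) (ax c))"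
    by (rule trans[OF sum.swap], rule sum.cong[OF refl], rule sum.swap)
  finally show ?thesis .
qed

lemma act_3: "act M \<omega> [a, b, c] = - (\<omega> [M *v a, b, c] + \<omega> [a, M *v b, c] + \<omega> [a, b, M *v c])"
  by (simp add: act_def eval_nat_numeral)

lemma alt_form_3_swap:
  assumes "alt_form 3 \<omega>"
  shows "\<omega> [a, b, c] = - \<omega> [b, a, c]" "\<omega> [a, b, c] = - \<omega> [a, c, b]" "\<omega> [a, b, c] = \<omega> [c, a, b]"
proof -
  show *: "\<omega> [a, b, c] = - \<omega> [b, a, c]" "\<omega> [a, b, c] = - \<omega> [a, c, b]" for a b c
    using alt_form_swap[OF assms, of "[]" "[c]" a b] alt_form_swap[OF assms, of "[a]" "[]" b c] by auto
  show "\<omega> [a, b, c] = \<omega> [c, a, b]"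
    using *(2)[of a b c] *(1)[of a c b] by simp
qed

lemma alt_form_3_linear:
  assumes "alt_form 3 \<omega>"
  shows "linear (\<lambda>u. \<omega> [u, b, c])" "linear (\<lambda>u. \<omega> [a, u, c])" "linear (\<lambda>u. \<omega> [a, b, u])"
  using alt_form_linear[OF assms, of "[]" "[b, c]"] alt_form_linear[OF assms, of "[a]" "[c]"]
    alt_form_linear[OF assms, of "[a, b]" "[]"] by auto

lemma act_3_swap:
  assumes "alt_form 3 \<omega>"
  shows "act M \<omega> [a, b, c] = - act M \<omega> [b, a, c]" "act M \<omega> [a, b, c] = act M \<omega> [c, a, b]"
  using alt_form_3_swap[OF assms] unfolding act_3 by (smt (verit, best))+

lemma sum_lessThan_add_3:
  "(\<Sum>l<n + 3. f l) = f 0 + f 1 + f 2 + (\<Sum>l<n. f (Suc (Suc (Suc l))))" for f :: "nat \<Rightarrow> 'a::comm_monoid_add"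
  unfolding numeral_3_eq_3 add_Suc_right add_0_right
  by (simp add: sum.lessThan_Suc_shift add.assoc numeral_2_eq_2 del: sum.lessThan_Suc)

text \<open>Infinitesimal invariance of the standard inner product under rotations, written for the
  contraction of two linear forms.\<close>

lemma skew_contract:
  fixes f g :: "real^8 \<Rightarrow> real"
  assumes "linear f" "linear g" "transpose M = - M"
  shows "(\<Sum>a\<in>UNIV. f (M *v ax a) * g (ax a)) = - (\<Sum>a\<in>UNIV. f (ax a) * g (M *v ax a))"
proof -
  have 1: "h (M *v ax a) = (\<Sum>k\<in>UNIV. M $ k $ a * h (ax k))" if "linear h" for h :: "real^8 \<Rightarrow> real" and a
    using linear_expand_8[OF that, of "M *v ax a"] by (simp add: matrix_vector_mult_basis column_def)
  have M: "M $ i $ j = - M $ j $ i" for i j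
    using arg_cong[OF assms(3), of "\<lambda>A. A $ j $ i"]
    unfolding transpose_def vec_lambda_beta vector_uminus_component .
  have "(\<Sum>a\<in>UNIV. f (M *v ax a) * g (ax a)) = (\<Sum>a\<in>UNIV. \<Sum>k\<in>UNIV. M $ k $ a * (f (ax k) * g (ax a)))"
    by (simp add: 1[OF assms(1)] sum_distrib_right mult.assoc)
  also have "\<dots> = (\<Sum>k\<in>UNIV. \<Sum>a\<in>UNIV. M $ k $ a * (f (ax k) * g (ax a)))"
    by (rule sum.swap)
  also have "\<dots> = - (\<Sum>k\<in>UNIV. \<Sum>a\<in>UNIV. M $ a $ k * (f (ax k) * g (ax a)))"
    unfolding sum_negf[symmetric] by (intro sum.cong refl) (metis M mult_minus_left)
  also have "\<dots> = - (\<Sum>a\<in>UNIV. f (ax a) * g (M *v ax a))"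
    by (simp add: 1[OF assms(2)] sum_distrib_left mult_ac)
  finally show ?thesis .
qed

lemma trace_skew: "transpose M = - M \<Longrightarrow> trace M = 0" for M :: "real^'n^'n"
proof -
  assume "transpose M = - M"
  then have "transpose M $ i $ i = (- M) $ i $ i" for i
    by simp
  then have "M $ i $ i = 0" for i
    unfolding transpose_def vec_lambda_beta vector_uminus_component by (metis equal_neg_zero)
  then show ?thesis by (simp add: trace_def)
qed

text \<open>The reason is that \<open>M\<close>, having trace zero, annihilates \<open>det8\<close>.\<close>

lemma act_star:
  assumes \<omega>: "alt_form 3 \<omega>" and M: "transpose M = - M" and ws: "length ws = 5"
  shows "act M (star \<omega>) ws = star (act M \<omega>) ws"
proof -
  let ?S = "\<lambda>f. \<Sum>a\<in>UNIV. \<Sum>b\<in>UNIV. \<Sum>c\<in>UNIV. f a b c :: real"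
  define w where "w a b c = \<omega> [ax a, ax b, ax c]" for a b c
  define d where "d u v z = det8 ([u, v, z] @ ws)" for u v z
  define e where "e a b c l = det8 ([ax a, ax b, ax c] @ ws[l := M *v (ws ! l)])" for a b c l
  have lin: "linear (\<lambda>u. d u v z)" "linear (\<lambda>u. d v u z)" "linear (\<lambda>u. d v z u)" for v z
    using alt_form_linear[OF alt_form_det8, of "[]" "v # z # ws"] alt_form_linear[OF alt_form_det8, of "[v]" "z # ws"]
      alt_form_linear[OF alt_form_det8, of "[v, z]" ws] ws by (auto simp: d_def)
  note lin3 = alt_form_3_linear[OF \<omega>]
  have tr: "d (M *v ax a) (ax b) (ax c) + d (ax a) (M *v ax b) (ax c) + d (ax a) (ax b) (M *v ax c)
      + (\<Sum>l<5. e a b c l) = 0" for a b c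
  proof -
    have "(\<Sum>l<8. det8 (([ax a, ax b, ax c] @ ws)[l := M *v (([ax a, ax b, ax c] @ ws) ! l)])) = 0"
      using alt_form_top_trace[OF alt_form_det8, of "[ax a, ax b, ax c] @ ws" M] ws by (simp add: trace_skew[OF M])
    then show ?thesis
      using sum_lessThan_add_3[of "\<lambda>l. det8 (([ax a, ax b, ax c] @ ws)[l := M *v (([ax a, ax b, ax c] @ ws) ! l)])" 5]
      by (simp add: d_def e_def)
  qed
  have "act M (star \<omega>) ws = - (\<Sum>l<5. ?S (\<lambda>a b c. w a b c * e a b c l)) / 6"
    using ws by (simp add: act_def star_def w_def e_def sum_divide_distrib)
  also have "(\<Sum>l<5. ?S (\<lambda>a b c. w a b c * e a b c l)) = ?S (\<lambda>a b c. w a b c * (\<Sum>l<5. e a b c l))"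
    unfolding sum_distrib_left by (rule trans[OF sum.swap], rule sum.cong[OF refl], rule trans[OF sum.swap], rule sum.cong[OF refl], rule sum.swap)
  finally have 1: "act M (star \<omega>) ws = - ?S (\<lambda>a b c. w a b c * (\<Sum>l<5. e a b c l)) / 6" .
  have s1: "?S (\<lambda>a b c. \<omega> [M *v ax a, ax b, ax c] * d (ax a) (ax b) (ax c))
      = - ?S (\<lambda>a b c. w a b c * d (M *v ax a) (ax b) (ax c))"
  proof -
    have "?S (\<lambda>a b c. f a b c) = (\<Sum>b\<in>UNIV. \<Sum>c\<in>UNIV. \<Sum>a\<in>UNIV. f a b c)" for f :: "8 \<Rightarrow> 8 \<Rightarrow> 8 \<Rightarrow> real"
      by (rule trans[OF sum.swap], rule sum.cong[OF refl], rule sum.swap)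
    note r = this
    show ?thesis
      unfolding w_def r[of "\<lambda>a b c. \<omega> [M *v ax a, ax b, ax c] * d (ax a) (ax b) (ax c)"]
        r[of "\<lambda>a b c. \<omega> [ax a, ax b, ax c] * d (M *v ax a) (ax b) (ax c)"]
      by (simp only: skew_contract[OF lin3(1) lin(1) M] sum_negf)
  qed
  have s2: "?S (\<lambda>a b c. \<omega> [ax a, M *v ax b, ax c] * d (ax a) (ax b) (ax c))
      = - ?S (\<lambda>a b c. w a b c * d (ax a) (M *v ax b) (ax c))"
  proof -
    have "?S (\<lambda>a b c. f a b c) = (\<Sum>a\<in>UNIV. \<Sum>c\<in>UNIV. \<Sum>b\<in>UNIV. f a b c)" for f :: "8 \<Rightarrow> 8 \<Rightarrow> 8 \<Rightarrow> real"
      by (rule sum.cong[OF refl], rule sum.swap)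
    note r = this
    show ?thesis
      unfolding w_def r[of "\<lambda>a b c. \<omega> [ax a, M *v ax b, ax c] * d (ax a) (ax b) (ax c)"]
        r[of "\<lambda>a b c. \<omega> [ax a, ax b, ax c] * d (ax a) (M *v ax b) (ax c)"]
      by (simp only: skew_contract[OF lin3(2) lin(2) M] sum_negf)
  qed
  have s3: "?S (\<lambda>a b c. \<omega> [ax a, ax b, M *v ax c] * d (ax a) (ax b) (ax c))
      = - ?S (\<lambda>a b c. w a b c * d (ax a) (ax b) (M *v ax c))"
    unfolding w_def by (simp only: skew_contract[OF lin3(3) lin(3) M] sum_negf)
  have "star (act M \<omega>) ws = ?S (\<lambda>a b c. - (\<omega> [M *v ax a, ax b, ax c] + \<omega> [ax a, M *v ax b, ax c]
      + \<omega> [ax a, ax b, M *v ax c]) * d (ax a) (ax b) (ax c)) / 6"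
    by (simp only: star_def act_3 d_def)
  also have "\<dots> = ?S (\<lambda>a b c. w a b c * (d (M *v ax a) (ax b) (ax c) + d (ax a) (M *v ax b) (ax c)
      + d (ax a) (ax b) (M *v ax c))) / 6"
    using s1 s2 s3 by (simp add: sum.distrib sum_negf sum_subtractf distrib_left distrib_right left_diff_distrib)
  also have "\<dots> = ?S (\<lambda>a b c. w a b c * - (\<Sum>l<5. e a b c l)) / 6"
    using tr by (simp only: add_eq_0_iff2)
  finally show ?thesis
    by (simp add: 1 sum_negf)
qed

text \<open>For \<open>\<alpha> X = \<nabla>\<^sub>X\<omega>\<close> this says that \<open>d\<star>\<omega> = 0\<close> if \<open>\<omega>\<close> has divergence zero: antisymmetrising over the nine
  vectors \<open>a, b, c, ws\<close> in dimension eight gives zero.\<close>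

lemma alternating_sum_star:
  fixes \<alpha> :: "real^8 \<Rightarrow> form"
  assumes lin: "\<And>a b c. linear (\<lambda>X. \<alpha> X [a, b, c])"
    and swap: "\<And>X a b c. \<alpha> X [a, b, c] = - \<alpha> X [b, a, c]" and rot: "\<And>X a b c. \<alpha> X [a, b, c] = \<alpha> X [c, a, b]"
    and div: "\<And>b c. (\<Sum>a\<in>UNIV. \<alpha> (ax a) [ax a, ax b, ax c]) = 0"
    and ws: "length ws = 6"
  shows "(\<Sum>j<6. (-1) ^ j * star (\<alpha> (ws ! j)) (drop_nth j ws)) = 0"
proof -
  let ?S = "\<lambda>f. \<Sum>a\<in>UNIV. \<Sum>b\<in>UNIV. \<Sum>c\<in>UNIV. f a b c :: real"
  define p where "p X a b c = \<alpha> X [ax a, ax b, ax c]" for X a b c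
  define q where "q a b = det8 ([ax a, ax b] @ ws)" for a b
  define r where "r a b c j = det8 ([ax a, ax b, ax c] @ drop_nth j ws)" for a b c j
  have W: "(\<Sum>j<6. (-1) ^ j * (p (ws ! j) a b c * r a b c j))
      = p (ax a) a b c * q b c - p (ax b) a b c * q a c + p (ax c) a b c * q a b" for a b c
  proof -
    have "0 = wedge1 (\<lambda>X. p X a b c) det8 ([ax a, ax b, ax c] @ ws)"
      by (rule wedge1_top[OF alt_form_det8, symmetric]) (use ws lin in \<open>auto simp: p_def\<close>)
    also have "\<dots> = p (ax a) a b c * q b c - p (ax b) a b c * q a c + p (ax c) a b c * q a b
        - (\<Sum>j<6. (-1) ^ j * (p (ws ! j) a b c * r a b c j))"
      using ws
        sum_lessThan_add_3[of "\<lambda>j. (-1) ^ j * (p (([ax a, ax b, ax c] @ ws) ! j) a b c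
            * det8 (drop_nth j ([ax a, ax b, ax c] @ ws)))" 6]
      by (simp add: wedge1_def drop_nth_def q_def r_def sum_negf)
    finally show ?thesis by simp
  qed
  have d1: "(\<Sum>a\<in>UNIV. p (ax a) a b c) = 0" for b c
    using div by (simp add: p_def)
  have d2: "(\<Sum>b\<in>UNIV. p (ax b) a b c) = 0" for a c
    unfolding p_def swap[of _ "ax a"] sum_negf div by simp
  have d3: "(\<Sum>c\<in>UNIV. p (ax c) a b c) = 0" for a b
    unfolding p_def rot[of _ "ax a"] div by simp
  have "(\<Sum>j<6. (-1) ^ j * star (\<alpha> (ws ! j)) (drop_nth j ws))
      = (\<Sum>j<6. ?S (\<lambda>a b c. (-1) ^ j * (p (ws ! j) a b c * r a b c j))) / 6"
    by (simp add: star_def p_def r_def sum_divide_distrib sum_distrib_left)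
  also have "(\<Sum>j<6. ?S (\<lambda>a b c. (-1) ^ j * (p (ws ! j) a b c * r a b c j)))
      = ?S (\<lambda>a b c. \<Sum>j<6. (-1) ^ j * (p (ws ! j) a b c * r a b c j))"
    by (rule trans[OF sum.swap], rule sum.cong[OF refl], rule trans[OF sum.swap], rule sum.cong[OF refl], rule sum.swap)
  also have "\<dots> = ?S (\<lambda>a b c. p (ax a) a b c * q b c) - ?S (\<lambda>a b c. p (ax b) a b c * q a c)
      + ?S (\<lambda>a b c. p (ax c) a b c * q a b)"
    by (simp only: W sum.distrib sum_subtractf)
  also have "?S (\<lambda>a b c. p (ax a) a b c * q b c) = (\<Sum>b\<in>UNIV. \<Sum>c\<in>UNIV. (\<Sum>a\<in>UNIV. p (ax a) a b c) * q b c)"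
    unfolding sum_distrib_right by (rule trans[OF sum.swap], rule sum.cong[OF refl], rule sum.swap)
  also have "?S (\<lambda>a b c. p (ax b) a b c * q a c) = (\<Sum>a\<in>UNIV. \<Sum>c\<in>UNIV. (\<Sum>b\<in>UNIV. p (ax b) a b c) * q a c)"
    unfolding sum_distrib_right by (rule sum.cong[OF refl], rule sum.swap)
  also have "?S (\<lambda>a b c. p (ax c) a b c * q a b) = (\<Sum>a\<in>UNIV. \<Sum>b\<in>UNIV. (\<Sum>c\<in>UNIV. p (ax c) a b c) * q a b)"
    unfolding sum_distrib_right by (rule refl)
  finally show ?thesis by (simp add: d1 d2 d3)
qed

section \<open>Exterior derivative and divergence as algebraic operations\<close>

context bracket
begin

lemma conn_mat_skew: "transpose (conn_mat X) = - conn_mat X"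
proof -
  have "conn_mat X $ i $ j = koszul L X (ax j) \<bullet> ax i" for i j
    by (simp add: conn_mat_def matrix_def inner_axis)
  then have "conn_mat X $ j $ i = - conn_mat X $ i $ j" for i j
    using koszul_skew[of X "ax i" "ax j"] by (simp add: inner_commute)
  then show ?thesis
    unfolding vec_eq_iff transpose_def vec_lambda_beta vector_uminus_component by blast
qed

text \<open>The alternated connection. By \<open>ext_deriv_pull\<close> it is, up to the factor
  \<open>h\<close>, the exterior derivative of the form with these constant coefficients.\<close>

definition d_form :: "form \<Rightarrow> form" where
  "d_form \<omega> ws = (\<Sum>j<length ws. (-1) ^ j * act (conn_mat (ws ! j)) \<omega> (drop_nth j ws))"

definition parallel_form :: "form \<Rightarrow> bool" where
  "parallel_form \<omega> \<longleftrightarrow> (\<forall>X a b c. act (conn_mat X) \<omega> [a, b, c] = 0)"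

definition coclosed :: "form \<Rightarrow> bool" where
  "coclosed \<omega> \<longleftrightarrow> (\<forall>b c. (\<Sum>a\<in>UNIV. act (conn_mat (ax a)) \<omega> [ax a, b, c]) = 0)"

text \<open>Torsion-freeness merges the twelve connection terms into six brackets. The result is the
  Chevalley-Eilenberg formula, which makes the later checks of closedness independent of
  \<open>koszul\<close>.\<close>

lemma d_form_4:
  assumes \<omega>: "alt_form 3 \<omega>"
  shows "d_form \<omega> [a, b, c, d] = - \<omega> [L a b, c, d] + \<omega> [L a c, b, d] - \<omega> [L a d, b, c]
    - \<omega> [L b c, a, d] + \<omega> [L b d, a, c] - \<omega> [L c d, a, b]"
proof -
  note sw = alt_form_3_swap[OF \<omega>]
  have L: "\<omega> [L X Y, u, v] = \<omega> [koszul L X Y, u, v] - \<omega> [koszul L Y X, u, v]" for X Y u v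
    using linear_diff[OF alt_form_3_linear(1)[OF \<omega>]] by (simp add: koszul_torsion_free[symmetric])
  show ?thesis
    unfolding L
    using sw(1)[of b "koszul L a c" d] sw(3)[of b c "koszul L a d"] sw(1)[of a "koszul L b c" d]
      sw(3)[of a c "koszul L b d"] sw(1)[of a "koszul L c b" d] sw(3)[of a b "koszul L c d"]
      sw(1)[of a "koszul L d b" c] sw(3)[of a b "koszul L d c"]
    by (simp add: d_form_def eval_nat_numeral drop_nth_def act_3[unfolded eval_nat_numeral])
qed

lemma linear_act_conn_mat:
  assumes \<omega>: "alt_form 3 \<omega>"
  shows "linear (\<lambda>X. act (conn_mat X) \<omega> [a, b, c])"
proof -
  have k: "linear (\<lambda>X. koszul L X v)" for v
    using koszul_bilinear by (simp add: bilinear_def)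
  have "linear (\<lambda>X. \<omega> [koszul L X a, b, c])" "linear (\<lambda>X. \<omega> [a, koszul L X b, c])"
    "linear (\<lambda>X. \<omega> [a, b, koszul L X c])"
    using linear_compose[OF k alt_form_3_linear(1)[OF \<omega>]] linear_compose[OF k alt_form_3_linear(2)[OF \<omega>]]
      linear_compose[OF k alt_form_3_linear(3)[OF \<omega>]] by (simp_all add: o_def)
  then show ?thesis
    unfolding act_3 conn_mat_mult by (intro linear_compose_neg linear_compose_add)
qed

text \<open>The connection is skew, so by \<open>act_star\<close> it passes through
  \<open>star\<close>; what remains is the alternated star of the covariant derivative, which
  vanishes when the divergence does.\<close>

lemma d_form_star:
  assumes \<omega>: "alt_form 3 \<omega>" and "coclosed \<omega>" and ws: "length ws = 6"
  shows "d_form (star \<omega>) ws = 0"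
proof -
  have "d_form (star \<omega>) ws = (\<Sum>j<6. (-1) ^ j * star (act (conn_mat (ws ! j)) \<omega>) (drop_nth j ws))"
    unfolding d_form_def ws
    by (intro sum.cong refl arg_cong2[where f = "(*)"] act_star \<omega> conn_mat_skew) (use ws in auto)
  also have "\<dots> = 0"
    using act_3_swap[OF \<omega>] assms(2) ws unfolding coclosed_def
    by (intro alternating_sum_star linear_act_conn_mat \<omega>) blast+
  finally show ?thesis .
qed

lemma parallel_form_coclosed: "parallel_form \<omega> \<Longrightarrow> coclosed \<omega>"
  by (simp add: parallel_form_def coclosed_def)

lemma parallel_form_closed: "parallel_form \<omega> \<Longrightarrow> d_form \<omega> [a, b, c, d] = 0"
  by (simp add: parallel_form_def d_form_def eval_nat_numeral drop_nth_def)

lemma coclosed_lincomb: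
  assumes "coclosed \<omega>" "coclosed \<eta>"
  shows "coclosed (\<lambda>vs. r * (\<omega> vs + \<eta> vs))"
proof -
  have "act M (\<lambda>vs. r * (\<omega> vs + \<eta> vs)) [a, b, c] = r * (act M \<omega> [a, b, c] + act M \<eta> [a, b, c])" for M a b c
    by (simp add: act_3 algebra_simps)
  with assms show ?thesis
    by (simp add: coclosed_def sum.distrib flip: sum_distrib_left)
qed

end

section \<open>Forms with constant coefficients in a coframe\<close>

context coframe
begin

lemma pull_has_derivative:
  assumes "alt_form k \<omega>" "length vs = k"
  shows "((\<lambda>y. pull \<omega> y vs) has_derivative
      (\<lambda>u. \<Sum>l<k. \<omega> ((map ((*v) (P x)) vs)[l := D x u (vs ! l)]))) (at x)"
proof -
  have "((\<lambda>y. \<omega> (map (\<lambda>g. g y) (map (\<lambda>v y. P y *v v) vs))) has_derivative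
      (\<lambda>u. \<Sum>l<k. \<omega> ((map (\<lambda>g. g x) (map (\<lambda>v y. P y *v v) vs))[l := (map (\<lambda>v u. D x u v) vs ! l) u]))) (at x)"
    by (rule multilinear_has_derivative) (use assms D in \<open>auto intro: alt_form_linear_nth\<close>)
  then show ?thesis
    using assms by (simp add: pull_def o_def cong: sum.cong_simp)
qed

lemma pull_update_christoffel:
  assumes "alt_form k \<omega>" "length vs = k" "j < k"
  shows "pull \<omega> x (vs[j := christoffel G x u v]) = \<omega> ((map ((*v) (P x)) vs)[j := D x u v])
     + h x * \<omega> ((map ((*v) (P x)) vs)[j := conn_mat (P x *v u) *v (P x *v v)])"
proof -
  have lin: "linear (\<lambda>u. \<omega> ((map ((*v) (P x)) vs)[j := u]))"
    by (rule alt_form_linear_nth[OF assms(1)]) (use assms in auto)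
  show ?thesis
    using linear_add[OF lin] linear_cmul[OF lin]
    by (simp add: pull_def map_update P_christoffel)
qed

text \<open>The derivatives of \<open>P\<close> cancel: they occur in the derivative of the
  coefficients and, with the opposite sign, in the Christoffel terms.\<close>

lemma nabla_form_pull:
  assumes "alt_form k \<omega>" "length vs = k"
  shows "nabla_form G (pull \<omega>) x u vs = h x * act (conn_mat (P x *v u)) \<omega> (map ((*v) (P x)) vs)"
proof -
  have "(\<Sum>j<k. pull \<omega> x (vs[j := christoffel G x u (vs ! j)])) =
      (\<Sum>j<k. \<omega> ((map ((*v) (P x)) vs)[j := D x u (vs ! j)])
        + h x * \<omega> ((map ((*v) (P x)) vs)[j := conn_mat (P x *v u) *v (P x *v (vs ! j))]))"
    by (intro sum.cong refl pull_update_christoffel) (use assms in auto)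
  then show ?thesis
    using assms
    by (simp add: nabla_form_def dir_deriv_eq[OF pull_has_derivative] act_def sum.distrib sum_distrib_left
        del: conn_mat_mult)
qed

text \<open>Each directional derivative is a covariant derivative plus Christoffel terms, and the
  symmetry of the latter makes their alternating sum vanish.\<close>

lemma ext_deriv_pull:
  assumes \<omega>: "alt_form k \<omega>" and vs: "length vs = Suc k"
  shows "ext_deriv (pull \<omega>) x vs = h x * d_form \<omega> (map ((*v) (P x)) vs)"
proof -
  let ?ws = "map ((*v) (P x)) vs"
  let ?C = "\<lambda>i j. P x *v christoffel G x (vs ! i) (vs ! j)"
  have "dir_deriv (\<lambda>y. pull \<omega> y (drop_nth j vs)) x (vs ! j) =
      h x * act (conn_mat (?ws ! j)) \<omega> (drop_nth j ?ws)
      + (\<Sum>l<k. \<omega> ((drop_nth j ?ws)[l := ?C j (if l < j then l else Suc l)]))" if j: "j < Suc k" for j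
  proof -
    have len: "length (drop_nth j vs) = k" using j vs by simp
    have "(\<Sum>l<k. pull \<omega> x ((drop_nth j vs)[l := christoffel G x (vs ! j) (drop_nth j vs ! l)])) =
        (\<Sum>l<k. \<omega> ((drop_nth j ?ws)[l := ?C j (if l < j then l else Suc l)]))"
      using j vs by (intro sum.cong refl) (simp add: pull_def map_update map_drop_nth nth_drop_nth)
    then show ?thesis
      using nabla_form_pull[OF \<omega> len, of x "vs ! j"] j vs len
      by (simp add: nabla_form_def map_drop_nth)
  qed
  then have "ext_deriv (pull \<omega>) x vs = (\<Sum>j<Suc k. (-1) ^ j * (h x * act (conn_mat (?ws ! j)) \<omega> (drop_nth j ?ws)))
      + (\<Sum>j<Suc k. (-1) ^ j * (\<Sum>l<k. \<omega> ((drop_nth j ?ws)[l := ?C j (if l < j then l else Suc l)])))"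
    unfolding ext_deriv_def drop_nth_def[symmetric] vs
    by (simp add: distrib_left sum.distrib del: sum.lessThan_Suc)
  also have "(\<Sum>j<Suc k. (-1) ^ j * (\<Sum>l<k. \<omega> ((drop_nth j ?ws)[l := ?C j (if l < j then l else Suc l)]))) = 0"
    using vs christoffel_sym by (intro alternating_sum_symmetric[OF \<omega>]) auto
  also have "(\<Sum>j<Suc k. (-1) ^ j * (h x * act (conn_mat (?ws ! j)) \<omega> (drop_nth j ?ws)))
      = h x * d_form \<omega> ?ws"
    using vs by (simp add: d_form_def sum_distrib_left mult.left_commute del: sum.lessThan_Suc)
  finally show ?thesis by simp
qed

text \<open>Raising an index with the inverse of \<open>G\<close> and then applying \<open>P\<close>
  gives \<open>transpose E\<close>, so \<open>contraction3\<close> applies. Positivity of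
  \<open>det (P x)\<close> makes it equal to the square root of the determinant of \<open>G\<close>,
  which turns \<open>vol_form\<close> into \<open>det8\<close> of the frame components.\<close>

lemma hodge_pull:
  assumes \<omega>: "alt_form 3 \<omega>" and ws: "length ws = 5"
  shows "hodge (G x) 3 (pull \<omega> x) ws = pull (star \<omega>) x ws"
proof -
  let ?ws = "map ((*v) (P x)) ws"
  let ?E = "\<lambda>i. transpose (E x) *v ax i" and ?P = "\<lambda>i. P x *v ax i"
  note lin3 = alt_form_3_linear[OF \<omega>]
  have lin: "linear (\<lambda>u. det8 ([u, v, z] @ ?ws))" "linear (\<lambda>u. det8 ([v, u, z] @ ?ws))"
    "linear (\<lambda>u. det8 ([v, z, u] @ ?ws))" for v z
    using alt_form_linear[OF alt_form_det8, of "[]" "v # z # ?ws"] alt_form_linear[OF alt_form_det8, of "[v]" "z # ?ws"]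
      alt_form_linear[OF alt_form_det8, of "[v, z]" ?ws] ws by auto
  have vol: "vol_form (G x) us = det8 (map ((*v) (P x)) us)" if "length us = 8" for us
    using that det_P[of x]
    by (simp add: vol_form_def G_def det_mul det_transpose det8_map real_sqrt_mult)
  have inv: "P x *v (matrix_inv (G x) *v v) = transpose (E x) *v v" for v
    by (simp only: G_inv matrix_vector_mul_assoc[symmetric] P_E_mult)
  have "hodge (G x) 3 (pull \<omega> x) ws = (\<Sum>i\<in>UNIV. \<Sum>j\<in>UNIV. \<Sum>k\<in>UNIV.
      \<omega> [?E i, ?E j, ?E k] * det8 ([?P i, ?P j, ?P k] @ ?ws)) / 6"
    using ws
    by (simp add: hodge_def sum_lists_length_3 pull_def inv vol fact_numeral del: transpose_matrix_vector)
  also have "(\<Sum>i\<in>UNIV. \<Sum>j\<in>UNIV. \<Sum>k\<in>UNIV. \<omega> [?E i, ?E j, ?E k] * det8 ([?P i, ?P j, ?P k] @ ?ws))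
      = (\<Sum>a\<in>UNIV. \<Sum>b\<in>UNIV. \<Sum>c\<in>UNIV. \<omega> [ax a, ax b, ax c] * det8 ([ax a, ax b, ax c] @ ?ws))"
    by (rule contraction3[OF lin3 lin P_E])
  finally show ?thesis
    by (simp only: pull_def[of "star \<omega>"] star_def)
qed

lemma norm_sq3_pull:
  assumes \<omega>: "alt_form 3 \<omega>"
  shows "norm_sq3 (G x) (pull \<omega> x) = norm_sq3 (mat 1) \<omega>"
proof -
  let ?E = "\<lambda>i. transpose (E x) *v ax i" and ?P = "\<lambda>i. P x *v ax i"
  note lin3 = alt_form_3_linear[OF \<omega>]
  have inv: "P x *v (matrix_inv (G x) *v v) = transpose (E x) *v v" for v
    by (simp only: G_inv matrix_vector_mul_assoc[symmetric] P_E_mult)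
  have inv1: "matrix_inv (mat 1 :: real^8^8) = mat 1"
    by (rule matrix_inv_eqI) simp
  have "norm_sq3 (G x) (pull \<omega> x) = (\<Sum>i\<in>UNIV. \<Sum>j\<in>UNIV. \<Sum>k\<in>UNIV.
      \<omega> [?E i, ?E j, ?E k] * \<omega> [?P i, ?P j, ?P k]) / 6"
    by (simp add: norm_sq3_def pull_def inv del: transpose_matrix_vector)
  also have "(\<Sum>i\<in>UNIV. \<Sum>j\<in>UNIV. \<Sum>k\<in>UNIV. \<omega> [?E i, ?E j, ?E k] * \<omega> [?P i, ?P j, ?P k])
      = (\<Sum>a\<in>UNIV. \<Sum>b\<in>UNIV. \<Sum>c\<in>UNIV. \<omega> [ax a, ax b, ax c] * \<omega> [ax a, ax b, ax c])"
    by (rule contraction3[OF lin3 lin3 P_E])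
  finally show ?thesis
    by (simp add: norm_sq3_def inv1)
qed

end

section \<open>The orthogonal complement of a stabiliser algebra\<close>

lemma act_linear_left:
  assumes "alt_form k \<omega>" "length vs = k"
  shows "act (B + C) \<omega> vs = act B \<omega> vs + act C \<omega> vs" "act (c *\<^sub>R B) \<omega> vs = c * act B \<omega> vs"
    "act (B - C) \<omega> vs = act B \<omega> vs - act C \<omega> vs" "act 0 \<omega> vs = 0"
proof -
  have lin: "linear (\<lambda>u. \<omega> (vs[j := u]))" if "j < k" for j
    by (rule alt_form_linear_nth[OF assms that])
  show 1: "act (B + C) \<omega> vs = act B \<omega> vs + act C \<omega> vs" for B C
    using assms(2) by (simp add: act_def matrix_vector_mult_add_rdistrib linear_add[OF lin] sum.distrib)
  show 2: "act (c *\<^sub>R B) \<omega> vs = c * act B \<omega> vs" for c B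
    using assms(2)
    by (simp add: act_def scaleR_matrix_vector_assoc[symmetric] linear_cmul[OF lin] sum_distrib_left)
  show "act (B - C) \<omega> vs = act B \<omega> vs - act C \<omega> vs"
    using 1[of B "(-1) *\<^sub>R C"] 2[of "-1" C] by simp
  show "act 0 \<omega> vs = 0"
    using 2[of 0 0] by simp
qed

text \<open>\<open>stab_alg\<close> seen in an orthonormal frame, where the orthogonal Lie algebra
  consists of the skew matrices.\<close>

definition stab0 :: "form \<Rightarrow> (real^8^8) set" where
  "stab0 \<omega> = {D. transpose D = - D \<and> (\<forall>vs. length vs = 3 \<longrightarrow> act D \<omega> vs = 0)}"

lemma transpose_linear: "transpose (A + B) = transpose A + transpose B" "transpose (c *\<^sub>R A) = c *\<^sub>R transpose A"
  "transpose (A - B) = transpose A - transpose B" "transpose (0 :: real^'n^'m) = 0" for A B :: "real^'n^'m"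
  by (simp_all add: transpose_def vec_eq_iff)

text \<open>Orthogonal projection along the stabiliser. Against skew matrices the trace form is
  minus the Euclidean inner product, so both define the same complement; subtracting an element of
  the stabiliser leaves the action on \<open>\<omega>\<close> unchanged.\<close>

lemma perp_part_exists:
  assumes \<omega>: "alt_form 3 \<omega>" and B: "transpose B = - B"
  shows "\<exists>C. transpose C = - C \<and> (\<forall>D\<in>stab0 \<omega>. trace (C ** D) = 0)
    \<and> (\<forall>vs. length vs = 3 \<longrightarrow> act C \<omega> vs = act B \<omega> vs)"
proof -
  have sub: "subspace (stab0 \<omega>)"
    unfolding subspace_def stab0_def
    by (auto simp: transpose_linear act_linear_left[OF \<omega>])
  obtain Y Z where YZ: "Y \<in> span (stab0 \<omega>)" "\<And>D. D \<in> span (stab0 \<omega>) \<Longrightarrow> orthogonal Z D" "B = Y + Z"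
  proof (rule orthogonal_subspace_decomp_exists[of "stab0 \<omega>" B])
    fix y z
    assume "y \<in> span (stab0 \<omega>)" "\<And>w. w \<in> span (stab0 \<omega>) \<Longrightarrow> orthogonal z w" "B = y + z"
    then show ?thesis by (rule that)
  qed
  then have Y: "Y \<in> stab0 \<omega>" using sub by (metis span_eq_iff)
  have Z: "Z = B - Y" using YZ(3) by simp
  have tr: "trace (Z ** D) = - (Z \<bullet> D)" if "transpose D = - D" for D
  proof -
    have "D $ k $ i = - D $ i $ k" for i k
      using arg_cong[OF that, of "\<lambda>A. A $ i $ k"]
      unfolding transpose_def vec_lambda_beta vector_uminus_component .
    note D = this
    have "(\<Sum>i\<in>UNIV. \<Sum>k\<in>UNIV. Z $ i $ k * D $ k $ i) = (\<Sum>i\<in>UNIV. \<Sum>k\<in>UNIV. - (Z $ i $ k * D $ i $ k))"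
      by (intro sum.cong refl, subst D, rule mult_minus_right)
    then show ?thesis
      by (simp add: trace_def matrix_matrix_mult_def inner_vec_def sum_negf)
  qed
  show ?thesis
  proof (intro exI[of _ Z] conjI ballI allI impI)
    show "transpose Z = - Z"
      using Y B by (simp add: Z transpose_linear stab0_def)
  next
    fix D assume D: "D \<in> stab0 \<omega>"
    have "Z \<bullet> D = 0"
      using YZ(2)[OF span_base[OF D]] by (simp add: orthogonal_def)
    moreover have "transpose D = - D"
      using D by (simp add: stab0_def)
    ultimately show "trace (Z ** D) = 0"
      using tr by simp
  next
    fix vs :: "(real^8) list" assume "length vs = 3"
    then show "act Z \<omega> vs = act B \<omega> vs"
      using Y by (simp add: Z act_linear_left[OF \<omega>] stab0_def)
  qed
qed

definition perp_part :: "form \<Rightarrow> real^8^8 \<Rightarrow> real^8^8" where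
  "perp_part \<omega> B = (SOME C. transpose C = - C \<and> (\<forall>D\<in>stab0 \<omega>. trace (C ** D) = 0)
    \<and> (\<forall>vs. length vs = 3 \<longrightarrow> act C \<omega> vs = act B \<omega> vs))"

lemma perp_part:
  assumes "alt_form 3 \<omega>" "transpose B = - B"
  shows "transpose (perp_part \<omega> B) = - perp_part \<omega> B" "D \<in> stab0 \<omega> \<Longrightarrow> trace (perp_part \<omega> B ** D) = 0"
    "length vs = 3 \<Longrightarrow> act (perp_part \<omega> B) \<omega> vs = act B \<omega> vs"
  using someI_ex[OF perp_part_exists[OF assms], folded perp_part_def] by blast+

lemma minus_matrix_vector_mult: "(- A) *v x = - (A *v x)" for A :: "real^'n^'m"
  by (simp add: matrix_vector_mult_def vec_eq_iff sum_negf)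

lemma skew_inner: "transpose C = - C \<Longrightarrow> (C *v u) \<bullet> v = - (u \<bullet> (C *v v))" for C :: "real^'n^'n"
proof -
  assume C: "transpose C = - C"
  have "transpose C *v u = - (C *v u)"
    by (simp only: C minus_matrix_vector_mult)
  then have "u v* C = - (C *v u)" by simp
  then show ?thesis
    using dot_lmul_matrix[of u C v] by simp
qed

lemma inner_skew:
  fixes C :: "real^'n^'n"
  assumes "\<And>u v. (C *v u) \<bullet> v = - (u \<bullet> (C *v v))"
  shows "transpose C = - C"
proof -
  have "(transpose C + C) *v u = 0" for u
  proof -
    have "((transpose C + C) *v u) \<bullet> v = 0" for v
      using assms[of u v] dot_lmul_matrix[of u C v]
      by (simp add: matrix_vector_mult_add_rdistrib inner_add_left)
    then show ?thesis by (metis inner_eq_zero_iff)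
  qed
  then have "transpose C + C = 0"
    by (simp add: matrix_eq)
  then show ?thesis
    by (simp add: add_eq_0_iff2)
qed

lemma alt_form_3I:
  assumes "\<And>b c. linear (\<lambda>u. \<omega> [u, b, c])" "\<And>a c. linear (\<lambda>u. \<omega> [a, u, c])" "\<And>a b. linear (\<lambda>u. \<omega> [a, b, u])"
    and "\<And>a b. \<omega> [a, a, b] = 0" "\<And>a b. \<omega> [a, b, a] = 0" "\<And>a b. \<omega> [b, a, a] = 0"
  shows "alt_form 3 \<omega>"
  unfolding alt_form_def
proof (intro conjI allI impI; elim conjE)
  fix vs :: "(real^8) list" and j :: nat assume "length vs = 3" "j < 3"
  then obtain a b c where "vs = [a, b, c]" "j = 0 \<or> j = 1 \<or> j = 2"
    by (auto simp: numeral_eq_Suc length_Suc_conv less_Suc_eq)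
  then show "linear (\<lambda>u. \<omega> (vs[j := u]))"
    using assms(1-3) by (auto simp: numeral_2_eq_2)
next
  fix vs :: "(real^8) list" and i j :: nat assume "length vs = 3" "i < j" "j < 3" "vs ! i = vs ! j"
  then obtain a b c where "vs = [a, b, c]" "i = 0 \<and> j = 1 \<or> i = 0 \<and> j = 2 \<or> i = 1 \<and> j = 2" "vs ! i = vs ! j"
    by (auto simp: numeral_eq_Suc length_Suc_conv less_Suc_eq)
  then show "\<omega> vs = 0"
    using assms(4-6) by (auto simp: numeral_2_eq_2)
qed

lemma length_3_cases:
  assumes "length vs = 3"
  obtains a b c where "vs = [a, b, c]"
  using assms by (auto simp: numeral_eq_Suc length_Suc_conv)

lemma linear_cliff: "linear (cliff K v)"
  by (rule linearI)
    (auto simp: cliff_def Let_def matrix_vector_right_distrib matrix_vector_mult_scaleR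
      vector_matrix_left_distrib scaleR_vector_matrix_assoc simp del: transpose_matrix_vector)

lemma lie_iso_conj:
  fixes P E :: "real^8^8"
  assumes br: "lie_iso br S b" and PE: "P ** E = mat 1"
  shows "lie_iso (\<lambda>u v. E *v br (P *v u) (P *v v)) S b"
proof -
  obtain f where f: "linear f" "inj f" "range f = S" "\<And>u v. f (br u v) = b (f u) (f v)"
    using br unfolding lie_iso_def by blast
  have EP: "E ** P = mat 1" using PE matrix_left_right_inverse by blast
  have surj: "range ((*v) P) = UNIV"
    using PE by (metis matrix_vector_mul_assoc matrix_vector_mul_lid surj_def)
  show ?thesis
    unfolding lie_iso_def
  proof (intro exI[of _ "f \<circ> (*v) P"] conjI allI)
    show "linear (f \<circ> (*v) P)"
      by (intro linear_compose f matrix_vector_mul_linear)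
    show "inj (f \<circ> (*v) P)"
      using EP by (intro inj_compose f inj_on_inverseI[where g = "(*v) E"]) (simp add: matrix_vector_mul_assoc)
    show "range (f \<circ> (*v) P) = S"
      using surj f(3) by (metis image_comp)
  qed (use PE f(4) in \<open>simp add: matrix_vector_mul_assoc\<close>)
qed

context bracket
begin

text \<open>Four times the covariant derivative of the constant spinor \<open>(p, 0)\<close>, with
  the factor \<open>h\<close> removed.\<close>

definition spin_conn :: "(8 \<Rightarrow> real^8^8) \<Rightarrow> real^8 \<Rightarrow> real^8 \<Rightarrow> spinor" where
  "spin_conn K X p = (\<Sum>a\<in>UNIV. \<Sum>c\<in>UNIV. (koszul L X (ax a) \<bullet> ax c) *\<^sub>R cliff K (ax a) (cliff K (ax c) (p, 0)))"

text \<open>This is the vector half of the derivative of \<open>\<gamma> = mat 1\<close>; since the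
  connection is skew, passing from the components of e_a to those of the fixed vector costs a
  sign.\<close>

lemma sum_koszul: "(\<Sum>a\<in>UNIV. (koszul L X (ax a) \<bullet> p) *\<^sub>R (ax a, 0)) = (- koszul L X p, 0 :: real^8)"
proof -
  have "(\<Sum>a\<in>UNIV. (koszul L X (ax a) \<bullet> p) *\<^sub>R ax a) = - koszul L X p"
    using linear_expand_8[of "\<lambda>v. v" "- koszul L X p"]
    by (simp add: koszul_skew inner_axis' linear_ident)
  moreover have "(\<Sum>a\<in>UNIV. f a *\<^sub>R (ax a, 0 :: real^8)) = ((\<Sum>a\<in>UNIV. f a *\<^sub>R ax a), 0)" for f
    by (simp add: sum_prod)
  ultimately show ?thesis by simp
qed

end

section \<open>Geometric structures with constant coefficients in a coframe\<close>

context coframe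
begin

lemma transpose_E_G_E: "transpose (E x) ** G x ** E x = mat 1"
proof -
  have "transpose (E x) ** G x ** E x = transpose (P x ** E x) ** (P x ** E x)"
    by (simp add: G_def matrix_transpose_mul matrix_mul_assoc)
  then show ?thesis by (simp add: P_E)
qed

lemma det_E: "det (E x) > 0"
proof -
  have "det (P x) * det (E x) = 1"
    using arg_cong[OF P_E[of x], of det] by (simp add: det_mul)
  then show ?thesis
    using det_P[of x] by (metis zero_less_mult_iff zero_less_one not_less_iff_gr_or_eq)
qed

lemma P_entries: "(\<lambda>x. P x $ i $ j) \<in> exp_polys"
proof -
  have "axis i (axis j 1) \<in> (Basis :: (real^8^8) set)"
    by (auto simp: Basis_vec_def)
  then have "(\<lambda>x. P x \<bullet> axis i (axis j 1)) \<in> exp_polys"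
    using P_smooth unfolding exp_poly_map_def by blast
  then show ?thesis by (simp add: inner_axis)
qed

lemma P_mult_entries: "(\<lambda>x. (P x *v v) $ i) \<in> exp_polys"
  by (simp add: matrix_vector_mult_def) (intro exp_polys_intros P_entries)

lemma G_smooth: "exp_poly_map G"
  by (rule exp_poly_map_matrix)
    (simp add: G_def matrix_matrix_mult_def transpose_def, intro exp_polys_intros P_entries)

lemma pull_smooth:
  assumes \<omega>: "alt_form 3 \<omega>" and "length vs = 3"
  shows "(\<lambda>x. pull \<omega> x vs) \<in> exp_polys"
proof -
  obtain a b c where vs: "vs = [a, b, c]" by (rule length_3_cases[OF assms(2)])
  note lin = alt_form_3_linear[OF \<omega>]
  have "\<omega> [u, v, w] = (\<Sum>i\<in>UNIV. \<Sum>j\<in>UNIV. \<Sum>k\<in>UNIV. u $ i * (v $ j * (w $ k * \<omega> [ax i, ax j, ax k])))" for u v w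
    apply (subst linear_expand_8[OF lin(1)], rule sum.cong[OF refl])
    apply (subst linear_expand_8[OF lin(2)], subst scaleR_sum_right, rule sum.cong[OF refl])
    apply (subst linear_expand_8[OF lin(3)])
    by (simp add: sum_distrib_left)
  note e = this
  have "pull \<omega> x vs = (\<Sum>i\<in>UNIV. \<Sum>j\<in>UNIV. \<Sum>k\<in>UNIV.
      (P x *v a) $ i * ((P x *v b) $ j * ((P x *v c) $ k * \<omega> [ax i, ax j, ax k])))" for x
    unfolding pull_def vs list.map by (rule e)
  then show ?thesis
    by (simp only:) (intro exp_polys_intros P_mult_entries)
qed

lemma alt_form_pull:
  assumes \<omega>: "alt_form 3 \<omega>"
  shows "alt_form 3 (pull \<omega> x)"
proof (rule alt_form_3I)
  note lin = alt_form_3_linear[OF \<omega>]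
  note l = linear_compose[OF matrix_vector_mul_linear[of "P x"], unfolded o_def]
  show "linear (\<lambda>u. pull \<omega> x [u, b, c])" "linear (\<lambda>u. pull \<omega> x [a, u, c])" "linear (\<lambda>u. pull \<omega> x [a, b, u])" for a b c
    using l[OF lin(1)] l[OF lin(2)] l[OF lin(3)] by (simp_all add: pull_def)
  show "pull \<omega> x [a, a, b] = 0" "pull \<omega> x [a, b, a] = 0" "pull \<omega> x [b, a, a] = 0" for a b
    using alt_form_eq_0[OF \<omega>, of "[]" "[]" "[P x *v b]" "P x *v a"] alt_form_eq_0[OF \<omega>, of "[]" "[P x *v b]" "[]" "P x *v a"]
      alt_form_eq_0[OF \<omega>, of "[P x *v b]" "[]" "[]" "P x *v a"] by (simp_all add: pull_def)
qed

text \<open>The 1-forms given by the rows of \<open>P\<close> agree on overlaps, so they are global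
  on the manifold and everything with constant coefficients in them glues.\<close>

definition invariant_atlas :: "'p chart set \<Rightarrow> bool" where
  "invariant_atlas A \<longleftrightarrow> (\<forall>c\<in>A. \<forall>d\<in>A. \<forall>x\<in>overlap c d. P (coord_change c d x) ** jac c d x = P x)"

lemma riemannian_metric_G:
  assumes "invariant_atlas A"
  shows "riemannian_metric A (\<lambda>c. G)"
  unfolding riemannian_metric_def
proof (intro conjI ballI allI impI)
  fix x v :: "real^8" assume "v \<noteq> 0"
  then have "P x *v v \<noteq> 0" by (metis P_E_mult(2) matrix_vector_mult_0_right)
  then show "ip (G x) v v > 0" by (simp add: ip_G)
next
  fix c d x u v assume "c \<in> A" "d \<in> A" "x \<in> overlap c d"
  then have "P (coord_change c d x) ** jac c d x = P x"
    using assms unfolding invariant_atlas_def by blast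
  then show "ip (G (coord_change c d x)) (jac c d x *v u) (jac c d x *v v) = ip (G x) u v"
    by (simp add: ip_G matrix_vector_mul_assoc)
qed (auto intro: exp_poly_map_smooth G_smooth simp: G_def matrix_transpose_mul)

lemma diff_form_pull:
  assumes "invariant_atlas A" and \<omega>: "alt_form 3 \<omega>"
  shows "diff_form A 3 (\<lambda>c. pull \<omega>)"
  unfolding diff_form_def
proof (intro conjI ballI allI impI)
  fix c :: "'a chart" and vs :: "(real^8) list" assume "length vs = 3"
  then show "smooth_on (cdom c) (\<lambda>x. pull \<omega> x vs)"
    using pull_smooth[OF \<omega>] by (intro exp_poly_map_smooth) (simp add: exp_poly_map_def)
next
  fix c d x and vs :: "(real^8) list" assume "c \<in> A" "d \<in> A" "x \<in> overlap c d"
  then have "P (coord_change c d x) ** jac c d x = P x"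
    using assms unfolding invariant_atlas_def by blast
  then show "pull \<omega> (coord_change c d x) (map ((*v) (jac c d x)) vs) = pull \<omega> x vs"
    by (simp add: pull_def o_def matrix_vector_mul_assoc)
qed (rule alt_form_pull[OF \<omega>])

lemma integrable3_pull:
  assumes \<omega>: "alt_form 3 \<omega>" and d: "\<And>a b c e. d_form \<omega> [a, b, c, e] = 0" and co: "coclosed \<omega>"
  shows "integrable3 A (\<lambda>c. G) (\<lambda>c. pull \<omega>)"
  unfolding integrable3_def closed_form_def
proof (intro conjI ballI allI impI)
  fix x and vs :: "(real^8) list" assume vs: "length vs = Suc 3"
  then obtain a b c e where "vs = [a, b, c, e]"
    by (auto simp: numeral_eq_Suc length_Suc_conv)
  then show "ext_deriv (pull \<omega>) x vs = 0"
    using ext_deriv_pull[OF \<omega> vs] d by simp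
next
  fix x and vs :: "(real^8) list" assume vs: "length vs = Suc 5"
  have "ext_deriv (\<lambda>x. hodge (G x) 3 (pull \<omega> x)) x vs = ext_deriv (pull (star \<omega>)) x vs"
    unfolding ext_deriv_def drop_nth_def[symmetric]
    by (intro sum.cong refl arg_cong2[where f = "(*)"] arg_cong2[where f = "\<lambda>f. dir_deriv f x"] ext hodge_pull \<omega>)
      (use vs in auto)
  also have "\<dots> = h x * d_form (star \<omega>) (map ((*v) (P x)) vs)"
    by (rule ext_deriv_pull[OF alt_form_star vs])
  also have "\<dots> = 0"
    using d_form_star[OF \<omega> co] vs by simp
  finally show "ext_deriv (\<lambda>x. hodge (G x) 3 (pull \<omega> x)) x vs = 0" .
qed

lemma not_parallel3_pull:
  assumes \<omega>: "alt_form 3 \<omega>" and "\<not> parallel_form \<omega>" and "c \<in> A" "x \<in> cdom c" "h x \<noteq> 0"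
  shows "\<not> parallel3 A (\<lambda>c. G) (\<lambda>c. pull \<omega>)"
proof -
  obtain X u v w where n: "act (conn_mat X) \<omega> [u, v, w] \<noteq> 0"
    using assms(2) unfolding parallel_form_def by blast
  have "nabla_form G (pull \<omega>) x (E x *v X) (map ((*v) (E x)) [u, v, w]) \<noteq> 0"
    using n assms(5) by (subst nabla_form_pull[OF \<omega>]) auto
  then show ?thesis
    using assms(3,4) unfolding parallel3_def by force
qed

text \<open>By \<open>nabla_form_pull\<close> the matrix
  \<open>h x *\<^sub>R conn_mat (P x *v u)\<close> acts on \<open>\<omega>\<close> as the covariant
  derivative does. Its part orthogonal to the stabiliser acts in the same way, and conjugation by
  the frame carries it back to coordinates.\<close>

lemma psu3_torsion_exists:
  assumes \<omega>: "alt_form 3 \<omega>"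
  shows "\<exists>T. psu3_torsion A (\<lambda>c. G) (\<lambda>c. pull \<omega>) T"
proof -
  define C where "C x u = perp_part \<omega> (h x *\<^sub>R conn_mat (P x *v u))" for x u
  have skew: "transpose (h x *\<^sub>R conn_mat (P x *v u)) = - (h x *\<^sub>R conn_mat (P x *v u))" for x u
    by (simp add: transpose_linear conn_mat_skew)
  note C = perp_part[OF \<omega> skew, folded C_def]
  define T where "T c x u = E x ** C x u ** P x" for c :: "'a chart" and x u
  have PT: "P x *v (T c x u *v v) = C x u *v (P x *v v)" for c x u v
    by (simp add: T_def matrix_vector_mul_assoc[symmetric])
  have "T c x u \<in> stab_perp (G x) (pull \<omega> x)" for c x u
    unfolding stab_perp_def so_alg_def mem_Collect_eq
  proof (intro conjI allI ballI)
    show "ip (G x) (T c x u *v a) b = - ip (G x) a (T c x u *v b)" for a b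
      by (simp add: ip_G PT skew_inner[OF C(1)])
  next
    fix D assume D: "D \<in> stab_alg (G x) (pull \<omega> x)"
    define D' where "D' = P x ** D ** E x"
    have D': "D' *v v = P x *v (D *v (E x *v v))" for v
      by (simp add: D'_def matrix_vector_mul_assoc[symmetric])
    have so: "ip (G x) (D *v a) b = - ip (G x) a (D *v b)" for a b
      using D unfolding stab_alg_def so_alg_def by blast
    have "D' \<in> stab0 \<omega>"
      unfolding stab0_def mem_Collect_eq
    proof (intro conjI allI impI)
      show "transpose D' = - D'"
        by (rule inner_skew) (use so[of "E x *v _" "E x *v _"] in \<open>simp add: ip_G D'\<close>)
    next
      fix vs :: "(real^8) list" assume vs: "length vs = 3"
      then have "act D (pull \<omega> x) (map ((*v) (E x)) vs) = 0"
        using D unfolding stab_alg_def by simp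
      moreover have "pull \<omega> x ((map ((*v) (E x)) vs)[j := D *v (map ((*v) (E x)) vs ! j)]) = \<omega> (vs[j := D' *v (vs ! j)])"
        if "j < 3" for j
        using vs that by (simp add: pull_def map_update D' o_def)
      ultimately show "act D' \<omega> vs = 0"
        using vs by (simp add: act_def)
    qed
    then have "trace (C x u ** D') = 0" by (rule C(2))
    also have "C x u ** D' = (C x u ** P x ** D) ** E x"
      by (simp add: D'_def matrix_mul_assoc)
    also have "trace \<dots> = trace (E x ** (C x u ** P x ** D))"
      by (rule trace_mul_sym)
    also have "E x ** (C x u ** P x ** D) = T c x u ** D"
      by (simp add: T_def matrix_mul_assoc)
    finally show "trace (T c x u ** D) = 0" .
  qed
  moreover have "nabla_form G (pull \<omega>) x u vs = act (T c x u) (pull \<omega> x) vs" if vs: "length vs = 3" for c x u vs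
  proof -
    have "nabla_form G (pull \<omega>) x u vs = act (h x *\<^sub>R conn_mat (P x *v u)) \<omega> (map ((*v) (P x)) vs)"
      using vs by (simp add: nabla_form_pull[OF \<omega>] act_linear_left[OF \<omega>])
    also have "\<dots> = act (C x u) \<omega> (map ((*v) (P x)) vs)"
      using C(3)[of "map ((*v) (P x)) vs"] vs by simp
    also have "\<dots> = act (T c x u) (pull \<omega> x) vs"
      using vs by (simp add: act_def pull_def map_update PT)
    finally show ?thesis .
  qed
  ultimately show ?thesis
    unfolding psu3_torsion_def by (intro exI[of _ T]) blast
qed

lemma psu3_torsion_nonzero:
  assumes "alt_form 3 \<omega>" "psu3_torsion A (\<lambda>c. G) (\<lambda>c. pull \<omega>) T" "\<not> parallel3 A (\<lambda>c. G) (\<lambda>c. pull \<omega>)"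
  shows "\<not> torsion_zero A T"
proof
  assume "torsion_zero A T"
  with assms(2) have "parallel3 A (\<lambda>c. G) (\<lambda>c. pull \<omega>)"
    using act_linear_left(4)[OF alt_form_pull[OF assms(1)]]
    unfolding parallel3_def psu3_torsion_def torsion_zero_def by metis
  with assms(3) show False ..
qed

lemma psu3_torsion_0:
  assumes \<omega>: "alt_form 3 \<omega>" and "parallel_form \<omega>"
  shows "psu3_torsion A (\<lambda>c. G) (\<lambda>c. pull \<omega>) (\<lambda>c x u. 0)"
  unfolding psu3_torsion_def
proof (intro ballI allI conjI impI)
  fix x u and vs :: "(real^8) list" assume vs: "length vs = 3"
  then obtain a b c where "vs = [a, b, c]" by (rule length_3_cases)
  then show "nabla_form G (pull \<omega>) x u vs = act 0 (pull \<omega> x) vs"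
    using assms(2) act_linear_left(4)[OF alt_form_pull[OF \<omega>] vs] nabla_form_pull[OF \<omega> vs]
    by (simp add: parallel_form_def)
qed (auto simp: stab_perp_def so_alg_def ip_def trace_def matrix_matrix_mult_def)

lemma psu3_structure_pull:
  assumes "oriented_manifold8 X A" "invariant_atlas A" and \<omega>: "alt_form 3 rho0"
  shows "psu3_structure X A (\<lambda>c. G) (\<lambda>c. pull rho0)"
proof -
  have "psu3_frame (pull rho0 x) (E x)" for x
    using det_E[of x] by (simp add: psu3_frame_def pull_def o_def)
  then show ?thesis
    using assms riemannian_metric_G diff_form_pull transpose_E_G_E
    unfolding psu3_structure_def by blast
qed

lemma bracket_structure_pull:
  assumes "oriented_manifold8 X A" "invariant_atlas A" and \<omega>: "alt_form 3 \<omega>" and n: "norm_sq3 (mat 1) \<omega> = 1"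
    and br: "\<And>u v w. br u v \<bullet> w = \<omega> [u, v, w]"
    and Q: "\<And>x. Q (\<lambda>u v. E x *v br (P x *v u) (P x *v v))"
  shows "bracket_structure Q X A (\<lambda>c. G) (\<lambda>c. pull \<omega>)"
  unfolding bracket_structure_def
proof (intro conjI ballI)
  fix x
  show "\<exists>br. (\<forall>u v w. ip (G x) (br u v) w = pull \<omega> x [u, v, w]) \<and> Q br"
    by (rule exI[of _ "\<lambda>u v. E x *v br (P x *v u) (P x *v v)"]) (simp add: ip_G br Q pull_def)
qed (use assms in \<open>auto intro: riemannian_metric_G diff_form_pull simp: norm_sq3_pull\<close>)

lemma conn_E: "conn G E x u a b = h x * (koszul L (P x *v u) (ax a) \<bullet> ax b)"
proof -
  have "(\<lambda>y. ax a) differentiable (at x)" by simp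
  from E_differentiable[OF this] have 1: "(\<lambda>y. E y *v ax a) differentiable (at x)" .
  have 2: "((\<lambda>y. P y *v (E y *v ax a)) has_derivative (\<lambda>u. 0)) (at x)"
    by simp
  show ?thesis
    using P_nabla_vec[OF 1 2, of u] by (simp add: conn_def ip_G)
qed

lemma frame_trans_E:
  assumes "invariant_atlas A" "c \<in> A" "d \<in> A" "x \<in> overlap c d"
  shows "frame_trans (\<lambda>c. E) c d x = mat 1"
proof -
  have "matrix_inv (E y) = P y" for y
    by (rule matrix_inv_eqI) (rule E_P)
  then show ?thesis
    using assms P_E unfolding frame_trans_def invariant_atlas_def by simp
qed

text \<open>The frame is global, so its transition matrices are the identity and lift to the
  constant cocycle \<open>id\<close>. In this frame \<open>mat 1\<close> is a constant
  identification of tangent vectors with half-spinors.\<close>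

lemma type3_plus_structure_E:
  assumes "oriented_manifold8 X A" and inv: "invariant_atlas A" and "half_spin_rep K" and "type3_plus_at K (mat 1)"
  shows "type3_plus_structure K X A (\<lambda>c. G) (\<lambda>c. E) (\<lambda>c d x. id) (\<lambda>c x. mat 1)"
proof -
  have "orth_frame A (\<lambda>c. G) (\<lambda>c. E)"
    using det_E transpose_E_G_E exp_poly_map_smooth[OF E_smooth] by (simp add: orth_frame_def)
  moreover have "smooth_on S (\<lambda>x :: real^8. mat 1 :: real^8^8)" for S
    by (rule exp_poly_map_smooth) (simp add: exp_poly_map_def exp_polys.const)
  ultimately show ?thesis
    using assms riemannian_metric_G[OF inv]
    by (auto simp: type3_plus_structure_def spin_structure_def covers_def gamma_plus_section_def
        frame_trans_E[OF inv] Spin8.one)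
qed

lemma twisted_dirac_E:
  "twisted_dirac K G E (\<lambda>x. mat 1) x b = h x *\<^sub>R (\<Sum>i\<in>UNIV.
     cliff K (ax i) ((- koszul L (ax i) (ax b), 0) + (1/4) *\<^sub>R spin_conn K (ax i) (ax b)))"
proof -
  have "dir_deriv (\<lambda>y. (mat 1 *v ax b, 0) :: spinor) x u = 0" for u
    by (rule dir_deriv_eq[of _ "\<lambda>u. 0", simplified]) simp
  then have "twisted_dirac K G E (\<lambda>x. mat 1) x b = h x *\<^sub>R (\<Sum>i\<in>UNIV.
      (\<Sum>a\<in>UNIV. (koszul L (ax i) (ax a) \<bullet> ax b) *\<^sub>R cliff K (ax i) (ax a, 0))
      + (1/4) *\<^sub>R cliff K (ax i) (spin_conn K (ax i) (ax b)))"
    unfolding twisted_dirac_def nabla_spinor_def Let_def conn_E spin_conn_def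
    by (simp add: linear_cmul[OF linear_cliff] linear_sum[OF linear_cliff] scaleR_sum_right scaleR_add_right mult_ac)
  then show ?thesis
    unfolding sum_koszul[symmetric]
    by (simp only: linear_add[OF linear_cliff] linear_cmul[OF linear_cliff] linear_sum[OF linear_cliff])
qed

lemma nabla_gamma_E:
  "nabla_gamma K G E (\<lambda>x. mat 1) x (E x *v X) b = h x *\<^sub>R
     ((- koszul L X (ax b), 0) + (1/4) *\<^sub>R spin_conn K X (ax b))"
proof -
  have "dir_deriv (\<lambda>y. (mat 1 *v ax b, 0) :: spinor) x u = 0" for u
    by (rule dir_deriv_eq[of _ "\<lambda>u. 0", simplified]) simp
  then show ?thesis
    unfolding nabla_gamma_def nabla_spinor_def conn_E sum_koszul[symmetric] spin_conn_def
    by (simp add: scaleR_sum_right scaleR_add_right mult_ac)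
qed

end

section \<open>Euclidean space with its standard chart\<close>

abbreviation std_chart :: "(real^8) chart" where
  "std_chart \<equiv> (UNIV, id)"

lemma std_chart: "cdom std_chart = UNIV" "overlap std_chart std_chart = UNIV"
  "coord_change std_chart std_chart = id" "jac std_chart std_chart x = mat 1"
proof -
  show *: "coord_change std_chart std_chart = id"
    by (auto simp: coord_change_def inv_into_def fun_eq_iff)
  have "dir_deriv (id :: real^8 \<Rightarrow> real^8) x = (\<lambda>u. u)"
    using dir_deriv_eq[of "id :: real^8 \<Rightarrow> real^8" "\<lambda>u. u" x] by (auto simp: id_def)
  then show "jac std_chart std_chart x = mat 1"
    unfolding jac_def * by (simp add: matrix_def mat_def axis_def vec_eq_iff)
qed (simp_all add: cdom_def overlap_def)

lemma second_countable_euclidean: "second_countable (euclidean :: 'a::second_countable_topology topology)"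
proof -
  obtain B :: "'a set set" where B: "countable B" "topological_basis B"
    using ex_countable_basis by blast
  show ?thesis
    unfolding second_countable_def open_openin[symmetric]
  proof (intro exI[of _ B] conjI ballI allI impI B(1))
    show "open V" if "V \<in> B" for V
      using topological_basis_open[OF B(2) that] .
  next
    fix U :: "'a set" and x assume U: "open U \<and> x \<in> U"
    then obtain V where "V \<in> B" "x \<in> V" "V \<subseteq> U"
      using topological_basisE[OF B(2)] by metis
    then show "\<exists>V\<in>B. x \<in> V \<and> V \<subseteq> U" by blast
  qed
qed

lemma std_oriented_manifold8: "oriented_manifold8 (euclidean :: (real^8) topology) {std_chart}"
proof -
  have "exp_poly_map (id :: real^8 \<Rightarrow> real^8)"
    by (rule exp_poly_map_vec) (simp add: exp_polys.coord)
  moreover have "is_chart euclidean std_chart"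
    by (simp add: is_chart_def std_chart)
  ultimately show ?thesis
    using connectedin_topspace[of "euclidean :: (real^8) topology"] convex_connected[OF convex_UNIV, where 'a = "real^8"]
    by (simp add: oriented_manifold8_def std_chart exp_poly_map_smooth second_countable_euclidean)
qed

lemma not_compact_euclidean: "\<not> compact_space (euclidean :: (real^8) topology)"
  using not_bounded_UNIV compact_imp_bounded by (auto simp: compact_space_def)

lemma (in coframe) invariant_std: "invariant_atlas {std_chart}"
  by (simp add: invariant_atlas_def std_chart)

section \<open>Compact quotients of 2-step nilpotent groups\<close>

text \<open>
  The group is \<open>real^8\<close> with \<open>x \<cdot> y = x + y + B(x, y)\<close>, where \<open>B\<close> takes values in the span of the coordinates
  in \<open>C\<close> and only depends on the other coordinates. The points of the quotient by the lattice of integral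
  vectors are represented by the half-open unit cube.
\<close>

locale nil_group =
  fixes B :: "real^8 \<Rightarrow> real^8 \<Rightarrow> real^8" and C :: "8 set"
  assumes bilinear_B: "bilinear B"
    and B_values: "k \<notin> C \<Longrightarrow> B x y $ k = 0"
    and B_left: "(\<And>k. k \<notin> C \<Longrightarrow> x $ k = 0) \<Longrightarrow> B x y = 0"
    and B_right: "(\<And>k. k \<notin> C \<Longrightarrow> y $ k = 0) \<Longrightarrow> B x y = 0"
    and B_integral: "(\<And>k. x $ k \<in> \<int>) \<Longrightarrow> (\<And>k. y $ k \<in> \<int>) \<Longrightarrow> B x y $ k \<in> \<int>"
begin

lemma B_B [simp]: "B (B x y) z = 0" "B z (B x y) = 0"
  using B_values by (auto intro: B_left B_right)

lemmas B_simps = bilinear_ladd[OF bilinear_B] bilinear_radd[OF bilinear_B] bilinear_lneg[OF bilinear_B]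
  bilinear_rneg[OF bilinear_B] bilinear_lsub[OF bilinear_B] bilinear_rsub[OF bilinear_B]

definition mul :: "real^8 \<Rightarrow> real^8 \<Rightarrow> real^8" where
  "mul x y = x + y + B x y"

definition lattice :: "(real^8) set" where
  "lattice = {x. \<forall>k. x $ k \<in> \<int>}"

definition inver :: "real^8 \<Rightarrow> real^8" where
  "inver x = B x x - x"

lemma mul_assoc: "mul (mul x y) z = mul x (mul y z)"
  by (simp add: mul_def B_simps algebra_simps)

lemma mul_zero [simp]: "mul 0 x = x" "mul x 0 = x"
  using bilinear_lzero[OF bilinear_B] bilinear_rzero[OF bilinear_B] by (simp_all add: mul_def)

lemma mul_inver [simp]: "mul x (inver x) = 0" "mul (inver x) x = 0"
  by (simp_all add: mul_def inver_def B_simps)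

lemma mul_lattice: "x \<in> lattice \<Longrightarrow> y \<in> lattice \<Longrightarrow> mul x y \<in> lattice"
  using B_integral by (simp add: lattice_def mul_def)

lemma inver_lattice: "x \<in> lattice \<Longrightarrow> inver x \<in> lattice"
  using B_integral by (simp add: lattice_def inver_def)

text \<open>An integer of absolute value below 1 is zero. Outside \<open>C\<close> the translation
  adds just the coordinates of \<open>\<gamma>\<close>; once these vanish, so does the twist
  \<open>B \<gamma> x\<close>, and the coordinates in \<open>C\<close> follow.\<close>

lemma lattice_small:
  assumes "\<gamma> \<in> lattice" "\<And>k. \<bar>mul \<gamma> x $ k - x $ k\<bar> < 1"
  shows "\<gamma> = 0"
proof -
  have int: "z = 0" if "z \<in> \<int>" "\<bar>z\<bar> < 1" for z :: real
    using that by (auto elim!: Ints_cases)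
  have "\<gamma> $ k = 0" if "k \<notin> C" for k
    using assms(2)[of k] assms(1) B_values[OF that] by (intro int) (auto simp: mul_def lattice_def)
  then have "B \<gamma> x = 0" by (rule B_left)
  then have "\<gamma> $ k = 0" for k
    using assms(2)[of k] assms(1) by (intro int) (auto simp: mul_def lattice_def)
  then show ?thesis by (simp add: vec_eq_iff)
qed

definition cube :: "(real^8) set" where
  "cube = {x. \<forall>k. 0 \<le> x $ k \<and> x $ k < 1}"

lemma cube_exists: "\<exists>\<gamma>\<in>lattice. mul \<gamma> x \<in> cube"
proof -
  \<comment> \<open>Coordinates outside \<open>C\<close> come first, because moving them disturbs
    those in \<open>C\<close> through \<open>B\<close>; the second translation is central and
    disturbs nothing.\<close>
  define \<gamma>1 where "\<gamma>1 = (\<chi> k. if k \<in> C then 0 else - real_of_int \<lfloor>x $ k\<rfloor>)"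
  define y where "y = mul \<gamma>1 x"
  define \<gamma>2 where "\<gamma>2 = (\<chi> k. if k \<in> C then - real_of_int \<lfloor>y $ k\<rfloor> else 0)"
  have c: "\<gamma>1 $ k = (if k \<in> C then 0 else - real_of_int \<lfloor>x $ k\<rfloor>)"
    "\<gamma>2 $ k = (if k \<in> C then - real_of_int \<lfloor>y $ k\<rfloor> else 0)" for k
    by (simp_all add: \<gamma>1_def \<gamma>2_def)
  have B0: "B \<gamma>2 y = 0"
    by (rule B_left) (simp add: c)
  have frac: "0 \<le> t - of_int \<lfloor>t\<rfloor>" "t - of_int \<lfloor>t\<rfloor> < 1" for t :: real
    by linarith+
  have "0 \<le> mul \<gamma>2 y $ k \<and> mul \<gamma>2 y $ k < 1" for k
  proof (cases "k \<in> C")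
    case True
    then show ?thesis using frac[of "y $ k"] by (simp add: mul_def B0 c)
  next
    case False
    then have "mul \<gamma>2 y $ k = x $ k - of_int \<lfloor>x $ k\<rfloor>"
      using B_values[OF False] by (simp add: mul_def[of \<gamma>2] B0 c) (simp add: y_def mul_def c)
    then show ?thesis using frac[of "x $ k"] by simp
  qed
  then have "mul (mul \<gamma>2 \<gamma>1) x \<in> cube"
    by (simp add: cube_def mul_assoc y_def)
  moreover have "mul \<gamma>2 \<gamma>1 \<in> lattice"
    by (rule mul_lattice) (auto simp: lattice_def \<gamma>1_def \<gamma>2_def)
  ultimately show ?thesis by blast
qed

definition proj :: "real^8 \<Rightarrow> real^8" where
  "proj x = (SOME y. y \<in> cube \<and> (\<exists>\<gamma>\<in>lattice. y = mul \<gamma> x))"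

lemma proj: "proj x \<in> cube" "\<exists>\<gamma>\<in>lattice. proj x = mul \<gamma> x"
proof -
  have "\<exists>y. y \<in> cube \<and> (\<exists>\<gamma>\<in>lattice. y = mul \<gamma> x)"
    using cube_exists[of x] by blast
  from someI_ex[OF this] show "proj x \<in> cube" "\<exists>\<gamma>\<in>lattice. proj x = mul \<gamma> x"
    unfolding proj_def by blast+
qed

lemma proj_cube:
  assumes "x \<in> cube"
  shows "proj x = x"
proof -
  obtain \<gamma> where \<gamma>: "\<gamma> \<in> lattice" "proj x = mul \<gamma> x" using proj(2) by blast
  have "\<bar>mul \<gamma> x $ k - x $ k\<bar> < 1" for k
  proof -
    have "0 \<le> mul \<gamma> x $ k \<and> mul \<gamma> x $ k < 1" "0 \<le> x $ k \<and> x $ k < 1"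
      using assms proj(1)[of x] unfolding \<gamma>(2) cube_def by blast+
    then show ?thesis by linarith
  qed
  then have "\<gamma> = 0" by (rule lattice_small[OF \<gamma>(1)])
  then show ?thesis using \<gamma>(2) by simp
qed

text \<open>The two representatives differ by a lattice element, and as both lie in the half-open
  cube it moves every coordinate by less than 1.\<close>

lemma proj_mul: "\<gamma> \<in> lattice \<Longrightarrow> proj (mul \<gamma> x) = proj x"
proof -
  assume \<gamma>: "\<gamma> \<in> lattice"
  obtain \<gamma>1 where 1: "\<gamma>1 \<in> lattice" "proj x = mul \<gamma>1 x" using proj(2) by blast
  obtain \<gamma>2 where 2: "\<gamma>2 \<in> lattice" "proj (mul \<gamma> x) = mul \<gamma>2 (mul \<gamma> x)" using proj(2) by blast
  let ?\<delta> = "mul (mul \<gamma>2 \<gamma>) (inver \<gamma>1)"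
  have "x = mul (inver \<gamma>1) (proj x)"
    by (simp add: 1 flip: mul_assoc)
  then have eq: "proj (mul \<gamma> x) = mul ?\<delta> (proj x)"
    using 2(2) by (metis mul_assoc)
  have "\<bar>mul ?\<delta> (proj x) $ k - proj x $ k\<bar> < 1" for k
  proof -
    have "0 \<le> proj (mul \<gamma> x) $ k \<and> proj (mul \<gamma> x) $ k < 1" "0 \<le> proj x $ k \<and> proj x $ k < 1"
      using proj(1)[of x] proj(1)[of "mul \<gamma> x"] unfolding cube_def by blast+
    then show ?thesis unfolding eq[symmetric] by linarith
  qed
  then have "?\<delta> = 0"
    by (rule lattice_small[rotated]) (intro mul_lattice inver_lattice \<gamma> 1 2)
  then show ?thesis using eq by simp
qed

lemma proj_eq_iff: "proj x = proj y \<longleftrightarrow> (\<exists>\<gamma>\<in>lattice. y = mul \<gamma> x)"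
proof
  assume eq: "proj x = proj y"
  obtain \<gamma>1 where 1: "\<gamma>1 \<in> lattice" "proj x = mul \<gamma>1 x" using proj(2) by blast
  obtain \<gamma>2 where 2: "\<gamma>2 \<in> lattice" "proj y = mul \<gamma>2 y" using proj(2) by blast
  have "y = mul (inver \<gamma>2) (mul \<gamma>2 y)" by (simp flip: mul_assoc)
  also have "\<dots> = mul (mul (inver \<gamma>2) \<gamma>1) x"
    using eq 1(2) 2(2) by (simp add: mul_assoc)
  finally show "\<exists>\<gamma>\<in>lattice. y = mul \<gamma> x"
    using mul_lattice[OF inver_lattice[OF 2(1)] 1(1)] by blast
qed (use proj_mul in auto)

section \<open>The quotient as a topological space\<close>

definition quotient :: "(real^8) topology" where
  "quotient = topology (\<lambda>U. U \<subseteq> cube \<and> open (proj -` U))"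

lemma openin_quotient: "openin quotient U \<longleftrightarrow> U \<subseteq> cube \<and> open (proj -` U)"
proof -
  have "istopology (\<lambda>U. U \<subseteq> cube \<and> open (proj -` U))"
    unfolding istopology_def by (auto simp: vimage_Union)
  then show ?thesis
    by (simp add: quotient_def)
qed

lemma topspace_quotient: "topspace quotient = cube"
proof -
  have "proj -` cube = UNIV" using proj(1) by auto
  then have "openin quotient cube" by (simp add: openin_quotient)
  then show ?thesis
    by (meson openin_quotient openin_subset openin_topspace subset_antisym)
qed

lemma proj_image: "proj ` UNIV = cube"
  by (auto simp: proj(1)) (metis proj_cube rangeI)

lemma continuous_proj: "continuous_map euclidean quotient proj"
  using proj(1) by (auto simp: continuous_map_def topspace_quotient openin_quotient vimage_def)

lemma continuous_mul: "continuous_on S (\<lambda>x. mul (f x) (g x))" if "continuous_on S f" "continuous_on S g"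
proof -
  have "continuous_on S (\<lambda>x. B (f x) (g x))"
    using bilinear_B[unfolded bilinear_conv_bounded_bilinear] that
    by (rule bounded_bilinear.continuous_on)
  then show ?thesis
    unfolding mul_def using that by (intro continuous_intros)
qed

lemma open_mul_vimage: "open U \<Longrightarrow> open (mul \<gamma> -` U)"
  by (rule open_vimage) (auto intro: continuous_mul continuous_intros)

lemma open_proj: "open_map euclidean quotient proj"
  unfolding open_map_def
proof (intro allI impI)
  fix U :: "(real^8) set" assume "openin euclidean U"
  then have "open (\<Union>\<gamma>\<in>lattice. mul \<gamma> -` U)"
    by (intro open_UN ballI open_mul_vimage) simp
  moreover have "proj -` proj ` U = (\<Union>\<gamma>\<in>lattice. mul \<gamma> -` U)"
    by (auto simp: proj_eq_iff) (metis proj_eq_iff image_eqI)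
  ultimately show "openin quotient (proj ` U)"
    using proj(1) by (auto simp: openin_quotient)
qed

lemma compact_quotient: "compact_space quotient"
proof -
  have "compactin quotient (proj ` cbox 0 1)"
    using continuous_proj by (intro image_compactin[of euclidean]) auto
  moreover have "proj ` cbox 0 1 = cube"
  proof
    show "cube \<subseteq> proj ` cbox 0 1"
    proof
      fix x assume x: "x \<in> cube"
      then have "x \<in> cbox 0 1"
        by (auto simp: cube_def mem_box_cart less_imp_le)
      then show "x \<in> proj ` cbox 0 1"
        using proj_cube[OF x] by force
    qed
  qed (use proj(1) in auto)
  ultimately show ?thesis
    by (simp add: compact_space_def topspace_quotient)
qed

lemma connected_quotient: "connected_space quotient"
proof -
  have "connectedin quotient (proj ` UNIV)"
    by (rule connectedin_continuous_map_image[OF continuous_proj]) (simp add: convex_connected)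
  then show ?thesis
    by (simp add: proj_image connectedin_topspace flip: topspace_quotient)
qed

lemma second_countable_quotient: "second_countable quotient"
  using continuous_proj open_proj _ second_countable_euclidean
  by (rule second_countable_open_map_image) (simp add: proj_image topspace_quotient)

lemma closed_lattice: "closed lattice"
proof -
  have "closed ((\<lambda>x :: real^8. x $ k) -` \<int>)" for k
    by (intro closed_vimage closed_Ints continuous_intros)
  then have "closed (\<Inter>k. (\<lambda>x :: real^8. x $ k) -` \<int>)"
    by (intro closed_INT ballI)
  also have "(\<Inter>k. (\<lambda>x. x $ k) -` \<int>) = lattice"
    by (auto simp: lattice_def)
  finally show ?thesis .
qed

text \<open>Two points are identified exactly when the continuous expression
  \<open>mul y (inver x)\<close> lands in the closed set \<open>lattice\<close>. If it does not, the
  same holds on a product of neighbourhoods, whose images are then disjoint and, \<open>proj\<close>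
  being open, open.\<close>

lemma Hausdorff_quotient: "Hausdorff_space quotient"
  unfolding Hausdorff_space_def topspace_quotient
proof (intro allI impI, elim conjE)
  fix x y assume xy: "x \<in> cube" "y \<in> cube" "x \<noteq> y"
  let ?f = "\<lambda>p. mul (snd p) (inver (fst p))"
  have "continuous_on UNIV (\<lambda>p :: (real^8) \<times> (real^8). B (fst p) (fst p))"
    by (rule bounded_bilinear.continuous_on[OF bilinear_B[unfolded bilinear_conv_bounded_bilinear]])
      (intro continuous_intros)+
  then have "continuous_on UNIV ?f"
    unfolding inver_def by (intro continuous_mul continuous_intros)
  then have op: "open (?f -` (- lattice))"
    using closed_lattice by (intro open_vimage) auto
  have "?f (x, y) \<notin> lattice"
  proof
    assume "?f (x, y) \<in> lattice"
    then have "proj (mul (?f (x, y)) x) = proj x" by (rule proj_mul)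
    then have "proj y = proj x" by (simp add: mul_assoc)
    then show False using xy proj_cube by simp
  qed
  then have "(x, y) \<in> ?f -` (- lattice)" by simp
  then obtain U V where "open U" "open V" "(x, y) \<in> U \<times> V" "U \<times> V \<subseteq> ?f -` (- lattice)"
    by (rule open_prod_elim[OF op]) (rule that)
  then have UV: "open U" "open V" "x \<in> U" "y \<in> V" "U \<times> V \<subseteq> ?f -` (- lattice)"
    by auto
  have "disjnt (proj ` U) (proj ` V)"
    unfolding disjnt_iff
  proof (intro allI notI, elim conjE imageE)
    fix z u v assume z: "z = proj u" "z = proj v" "u \<in> U" "v \<in> V"
    then obtain \<gamma> where "\<gamma> \<in> lattice" "v = mul \<gamma> u" using proj_eq_iff by metis
    then have "?f (u, v) \<in> lattice" by (simp add: mul_assoc)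
    moreover have "(u, v) \<in> U \<times> V" using z by simp
    ultimately show False using UV(5) by blast
  qed
  moreover have "openin quotient (proj ` U)" "openin quotient (proj ` V)"
    using open_proj UV unfolding open_map_def by auto
  moreover have "x \<in> proj ` U" "y \<in> proj ` V"
    using UV proj_cube xy by (metis image_eqI)+
  ultimately show "\<exists>U V. openin quotient U \<and> openin quotient V \<and> x \<in> U \<and> y \<in> V \<and> disjnt U V"
    by blast
qed

section \<open>Charts of the quotient and their coordinate changes\<close>

definition nbh :: "real^8 \<Rightarrow> (real^8) set" where
  "nbh a = {x. \<forall>k. \<bar>x $ k - a $ k\<bar> < 1/2}"

lemma open_nbh: "open (nbh a)"
proof -
  have "\<bar>x $ k - a $ k\<bar> < 1/2 \<longleftrightarrow> a $ k - 1/2 < x $ k \<and> x $ k < a $ k + 1/2" for x k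
    by linarith
  then have "nbh a = box (\<chi> k. a $ k - 1/2) (\<chi> k. a $ k + 1/2)"
    unfolding nbh_def set_eq_iff mem_box_cart by simp
  then show ?thesis by (simp only: open_box)
qed

text \<open>The open cube has side length 1, so a lattice element that identifies two of its points
  moves every coordinate by less than 1.\<close>

lemma inj_on_nbh: "inj_on proj (nbh a)"
proof (rule inj_onI)
  fix x y assume xy: "x \<in> nbh a" "y \<in> nbh a" "proj x = proj y"
  then obtain \<gamma> where \<gamma>: "\<gamma> \<in> lattice" "y = mul \<gamma> x" using proj_eq_iff by metis
  have "\<bar>mul \<gamma> x $ k - x $ k\<bar> < 1" for k
  proof -
    have "\<bar>x $ k - a $ k\<bar> < 1/2" "\<bar>mul \<gamma> x $ k - a $ k\<bar> < 1/2"
      using xy \<gamma>(2) unfolding nbh_def by blast+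
    then show ?thesis by linarith
  qed
  then have "\<gamma> = 0" by (rule lattice_small[OF \<gamma>(1)])
  then show "x = y" using \<gamma>(2) by simp
qed

definition nil_chart :: "real^8 \<Rightarrow> (real^8) chart" where
  "nil_chart a = (proj ` nbh a, inv_into (nbh a) proj)"

definition atlas :: "(real^8) chart set" where
  "atlas = range nil_chart"

lemma cdom_nil_chart: "cdom (nil_chart a) = nbh a"
  using inv_into_image_cancel[OF inj_on_nbh order_refl] by (simp add: cdom_def nil_chart_def)

lemma overlap_nil_chart: "overlap (nil_chart a) (nil_chart b) = {x \<in> nbh a. proj x \<in> proj ` nbh b}"
proof -
  have inv: "inv_into (nbh a) proj (proj x) = x" if "x \<in> nbh a" for x
    by (rule inv_into_f_f[OF inj_on_nbh that])
  show ?thesis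
    unfolding overlap_def nil_chart_def fst_conv snd_conv
  proof (intro set_eqI iffI)
    fix z assume "z \<in> inv_into (nbh a) proj ` (proj ` nbh a \<inter> proj ` nbh b)"
    then obtain x where "x \<in> nbh a" "proj x \<in> proj ` nbh b" "z = inv_into (nbh a) proj (proj x)"
      by blast
    then show "z \<in> {x \<in> nbh a. proj x \<in> proj ` nbh b}"
      using inv by simp
  next
    fix z assume z: "z \<in> {x \<in> nbh a. proj x \<in> proj ` nbh b}"
    then have "z = inv_into (nbh a) proj (proj z)"
      using inv[of z] by simp
    then show "z \<in> inv_into (nbh a) proj ` (proj ` nbh a \<inter> proj ` nbh b)"
      by (rule image_eqI) (use z in auto)
  qed
qed

lemma coord_change_nil_chart:
  assumes "x \<in> nbh a" "\<gamma> \<in> lattice" "mul \<gamma> x \<in> nbh b"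
  shows "coord_change (nil_chart a) (nil_chart b) x = mul \<gamma> x"
proof -
  have "inv_into (proj ` nbh a) (inv_into (nbh a) proj) x = proj x"
    using inv_into_inv_into_eq[of proj "nbh a" "proj ` nbh a" x] inj_on_nbh assms(1)
    by (simp add: bij_betw_def)
  then have "coord_change (nil_chart a) (nil_chart b) x = inv_into (nbh b) proj (proj (mul \<gamma> x))"
    using proj_mul[OF assms(2)] by (simp add: coord_change_def nil_chart_def)
  also have "\<dots> = mul \<gamma> x"
    by (rule inv_into_f_f[OF inj_on_nbh assms(3)])
  finally show ?thesis .
qed

lemma coord_change_local:
  assumes "x \<in> overlap (nil_chart a) (nil_chart b)"
  obtains \<gamma> T where "\<gamma> \<in> lattice" "open T" "x \<in> T"
    "\<And>y. y \<in> T \<Longrightarrow> coord_change (nil_chart a) (nil_chart b) y = mul \<gamma> y"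
proof -
  obtain y where y: "x \<in> nbh a" "y \<in> nbh b" "proj x = proj y"
    using assms unfolding overlap_nil_chart by blast
  then obtain \<gamma> where \<gamma>: "\<gamma> \<in> lattice" "y = mul \<gamma> x" using proj_eq_iff by metis
  show thesis
  proof (rule that[OF \<gamma>(1)])
    show "open (nbh a \<inter> mul \<gamma> -` nbh b)"
      by (intro open_Int open_nbh open_mul_vimage)
  qed (use y \<gamma> coord_change_nil_chart in auto)
qed

lemma has_derivative_mul: "(mul \<gamma> has_derivative (\<lambda>v. v + B \<gamma> v)) (at x)"
proof -
  have "(B \<gamma> has_derivative B \<gamma>) (at x)"
    using bilinear_B unfolding bilinear_def
    by (intro linear_imp_has_derivative) blast
  then have "((\<lambda>x. \<gamma> + x + B \<gamma> x) has_derivative (\<lambda>v. 0 + v + B \<gamma> v)) (at x)"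
    by (intro derivative_intros)
  then show ?thesis by (simp add: mul_def[abs_def])
qed

lemma jac_nil_chart:
  assumes "x \<in> overlap (nil_chart a) (nil_chart b)"
  obtains \<gamma> where "\<gamma> \<in> lattice" "coord_change (nil_chart a) (nil_chart b) x = mul \<gamma> x"
    "jac (nil_chart a) (nil_chart b) x = mat 1 + matrix (B \<gamma>)"
proof -
  obtain \<gamma> T where \<gamma>: "\<gamma> \<in> lattice" "open T" "x \<in> T"
    "\<And>y. y \<in> T \<Longrightarrow> coord_change (nil_chart a) (nil_chart b) y = mul \<gamma> y"
    using coord_change_local[OF assms] by blast
  have "(coord_change (nil_chart a) (nil_chart b) has_derivative (\<lambda>v. v + B \<gamma> v)) (at x)"
    by (rule has_derivative_transform_within_open[OF has_derivative_mul \<gamma>(2,3)]) (simp add: \<gamma>(4))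
  then have "dir_deriv (coord_change (nil_chart a) (nil_chart b)) x = (\<lambda>v. v + B \<gamma> v)"
    by (intro ext dir_deriv_eq)
  then have "jac (nil_chart a) (nil_chart b) x = mat 1 + matrix (B \<gamma>)"
    by (simp add: jac_def matrix_def mat_def axis_def vec_eq_iff)
  then show thesis
    using that[OF \<gamma>(1)] \<gamma>(3,4) by blast
qed

lemma matrix_B_mult [simp]: "matrix (B x) *v y = B x y"
  using bilinear_B unfolding bilinear_def by (metis matrix_vector_mul(2))

text \<open>The map from \<open>x\<close> to this matrix turns sums into products. Hence the matrix
  is invertible, and it is the square of the one for half of \<open>x\<close>, so its determinant is
  a nonzero square.\<close>

lemma det_unipotent: "det (mat 1 + matrix (B x)) > 0"
proof -
  have sq: "(mat 1 + matrix (B y)) ** (mat 1 + matrix (B z)) = mat 1 + matrix (B (y + z))" for y z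
    by (simp add: matrix_eq matrix_vector_mul_assoc[symmetric] matrix_vector_mult_add_rdistrib
        matrix_vector_right_distrib B_simps add.assoc)
  have "mat 1 + matrix (B 0) = (mat 1 :: real^8^8)"
    by (simp add: matrix_eq matrix_vector_mult_add_rdistrib bilinear_lzero[OF bilinear_B])
  then have "det (mat 1 + matrix (B x)) * det (mat 1 + matrix (B (- x))) = 1"
    using sq[of x "- x"] by (simp add: det_mul[symmetric])
  then have "det (mat 1 + matrix (B x)) \<noteq> 0" by auto
  moreover have "x = (1/2) *\<^sub>R x + (1/2) *\<^sub>R x"
    by (simp flip: scaleR_add_left)
  then have "det (mat 1 + matrix (B x)) = (det (mat 1 + matrix (B ((1/2) *\<^sub>R x))))\<^sup>2"
    using sq[of "(1/2) *\<^sub>R x" "(1/2) *\<^sub>R x"] by (metis det_mul power2_eq_square)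
  ultimately show ?thesis by (simp add: zero_less_power2)
qed

lemma exp_poly_map_mul: "exp_poly_map (mul \<gamma>)"
proof (rule exp_poly_map_vec)
  fix i
  have "linear (\<lambda>v. B \<gamma> v $ i)"
    using bilinear_B by (intro linearI) (auto simp: bilinear_radd bilinear_rmul)
  then have "mul \<gamma> x $ i = \<gamma> $ i + x $ i + (\<Sum>k\<in>UNIV. x $ k * B \<gamma> (ax k) $ i)" for x
    using linear_expand_8[of "\<lambda>v. B \<gamma> v $ i" x] by (simp add: mul_def)
  then show "(\<lambda>x. mul \<gamma> x $ i) \<in> exp_polys"
    by (simp only:) (intro exp_polys_intros)
qed

lemma matrix_B_exp_polys: "(\<lambda>x. matrix (B x) $ i $ j) \<in> exp_polys"
proof -
  have "linear (\<lambda>x. B x (ax j) $ i)"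
    using bilinear_B by (intro linearI) (auto simp: bilinear_ladd bilinear_lmul)
  then have "matrix (B x) $ i $ j = (\<Sum>k\<in>UNIV. x $ k * B (ax k) (ax j) $ i)" for x
    using linear_expand_8[of "\<lambda>x. B x (ax j) $ i" x] by (simp add: matrix_def)
  then show ?thesis
    by (simp only:) (intro exp_polys_intros)
qed

lemma is_chart_nil_chart: "is_chart quotient (nil_chart a)"
proof -
  have op: "openin quotient (proj ` nbh a)"
    using open_proj open_nbh unfolding open_map_def by auto
  have sub: "proj ` nbh a \<subseteq> cube" using proj(1) by auto
  have "homeomorphic_map (top_of_set (nbh a)) (subtopology quotient (proj ` nbh a)) proj"
  proof (rule bijective_open_imp_homeomorphic_map)
    show "continuous_map (top_of_set (nbh a)) (subtopology quotient (proj ` nbh a)) proj"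
      by (intro continuous_map_into_subtopology continuous_map_from_subtopology continuous_proj) auto
    show "open_map (top_of_set (nbh a)) (subtopology quotient (proj ` nbh a)) proj"
      using open_nbh by (intro open_map_into_subtopology open_map_from_subtopology open_proj) auto
  qed (use inj_on_nbh sub in \<open>auto simp: topspace_quotient\<close>)
  then obtain g where g: "homeomorphic_maps (top_of_set (nbh a)) (subtopology quotient (proj ` nbh a)) proj g"
    unfolding homeomorphic_map_maps by blast
  then have g1: "homeomorphic_map (subtopology quotient (proj ` nbh a)) (top_of_set (nbh a)) g"
    and g2: "\<And>x. x \<in> nbh a \<Longrightarrow> g (proj x) = x"
    unfolding homeomorphic_maps_map by auto
  have "homeomorphic_map (subtopology quotient (proj ` nbh a)) (top_of_set (nbh a)) (inv_into (nbh a) proj)"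
  proof (rule homeomorphic_map_eq[OF g1])
    fix z assume "z \<in> topspace (subtopology quotient (proj ` nbh a))"
    then obtain x where "x \<in> nbh a" "z = proj x" by auto
    then show "g z = inv_into (nbh a) proj z"
      using g2 inv_into_f_f[OF inj_on_nbh] by simp
  qed
  moreover have "fst (nil_chart a) = proj ` nbh a" "snd (nil_chart a) = inv_into (nbh a) proj"
    by (simp_all add: nil_chart_def)
  ultimately show ?thesis
    using op open_nbh by (simp add: is_chart_def cdom_nil_chart)
qed

lemma oriented_quotient: "oriented_manifold8 quotient atlas"
  unfolding oriented_manifold8_def
proof (intro conjI ballI)
  show "topspace quotient \<noteq> {}"
    using proj(1) by (auto simp: topspace_quotient)
next
  show "(\<Union>c\<in>atlas. fst c) = topspace quotient"
  proof
    show "topspace quotient \<subseteq> (\<Union>c\<in>atlas. fst c)"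
    proof
      fix x assume "x \<in> topspace quotient"
      then have "x = proj x" "x \<in> nbh x"
        by (auto simp: topspace_quotient proj_cube nbh_def)
      then show "x \<in> (\<Union>c\<in>atlas. fst c)"
        unfolding atlas_def nil_chart_def by force
    qed
  qed (use proj(1) in \<open>auto simp: atlas_def nil_chart_def topspace_quotient\<close>)
next
  fix c d assume "c \<in> atlas" "d \<in> atlas"
  then obtain a b where cd: "c = nil_chart a" "d = nil_chart b" unfolding atlas_def by blast
  have "locally_exp_poly (overlap c d) (coord_change c d)"
    unfolding locally_exp_poly_def cd
  proof
    fix x assume "x \<in> overlap (nil_chart a) (nil_chart b)"
    then obtain \<gamma> T where "\<gamma> \<in> lattice" "open T" "x \<in> T"
      "\<And>y. y \<in> T \<Longrightarrow> coord_change (nil_chart a) (nil_chart b) y = mul \<gamma> y"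
      using coord_change_local by blast
    then show "\<exists>T \<phi>. open T \<and> x \<in> T \<and> exp_poly_map \<phi> \<and> (\<forall>y\<in>T. coord_change (nil_chart a) (nil_chart b) y = \<phi> y)"
      using exp_poly_map_mul[of \<gamma>] by (intro exI[of _ T] exI[of _ "mul \<gamma>"]) auto
  qed
  then show "smooth_on (overlap c d) (coord_change c d)"
    by (rule locally_exp_poly_smooth)
  fix x assume "x \<in> overlap c d"
  then show "det (jac c d x) > 0"
    unfolding cd using det_unipotent by (metis jac_nil_chart)
qed (auto simp: Hausdorff_quotient second_countable_quotient connected_quotient is_chart_nil_chart atlas_def)

end

text \<open>The forms dx - B(x, dx) are invariant under left translations. The constant matrix
  \<open>R\<close> allows an orthonormal frame that is not aligned with the coordinates in which the
  lattice is integral.\<close>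

locale nil_coframe = nil_group B C for B C +
  fixes R R' :: "real^8^8"
  assumes R_R': "R ** R' = mat 1" and det_R: "det R > 0"
begin

definition P :: "real^8 \<Rightarrow> real^8^8" where "P x = R ** (mat 1 - matrix (B x))"
definition E :: "real^8 \<Rightarrow> real^8^8" where "E x = (mat 1 + matrix (B x)) ** R'"
definition L :: "real^8 \<Rightarrow> real^8 \<Rightarrow> real^8" where
  "L X Y = R *v (B (R' *v X) (R' *v Y) - B (R' *v Y) (R' *v X))"

lemma R'_R: "R' ** R = mat 1"
  using R_R' matrix_left_right_inverse by blast

lemma R_mult [simp]: "R *v (R' *v x) = x" "R' *v (R *v x) = x"
  by (simp_all add: matrix_vector_mul_assoc R_R' R'_R)

lemma P_mult: "P x *v v = R *v (v - B x v)"
  by (simp add: P_def matrix_vector_mul_assoc[symmetric] matrix_vector_mult_diff_rdistrib)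

lemma E_mult: "E x *v v = R' *v v + B x (R' *v v)"
  by (simp add: E_def matrix_vector_mul_assoc[symmetric] matrix_vector_mult_add_rdistrib)

text \<open>\<open>P x\<close> is affine in \<open>x\<close>: its derivative is constant and its
  second derivative zero.\<close>

sublocale coframe L P E "\<lambda>x u v. - (R *v B u v)" "\<lambda>x w u v. 0" "\<lambda>x. 1" "\<lambda>X. 0"
proof
  have "bilinear (\<lambda>X Y. B (R' *v X) (R' *v Y))"
    using bilinear_B unfolding bilinear_def
    by (auto intro: linear_compose[OF matrix_vector_mul_linear, unfolded o_def])
  then have "linear (L X)" "linear (\<lambda>X. L X Y)" for X Y
    unfolding L_def bilinear_def
    by (auto intro!: linear_compose[OF _ matrix_vector_mul_linear, unfolded o_def] linear_compose_sub)
  then show "bilinear L" by (simp add: bilinear_def)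
  show "L X Y = - L Y X" for X Y
    by (simp add: L_def matrix_vector_mult_diff_distrib)
  show "exp_poly_map P"
    by (rule exp_poly_map_matrix)
      (simp add: P_def matrix_matrix_mult_def mat_def, intro exp_polys_intros matrix_B_exp_polys)
  show "exp_poly_map E"
    by (rule exp_poly_map_matrix)
      (simp add: E_def matrix_matrix_mult_def mat_def, intro exp_polys_intros matrix_B_exp_polys)
  show "P x ** E x = mat 1" for x
    by (simp add: matrix_eq matrix_vector_mul_assoc[symmetric] P_mult E_mult B_simps)
  have eq: "mat 1 - matrix (B x) = mat 1 + matrix (B (- x))" for x
    by (simp add: matrix_eq matrix_vector_mult_diff_rdistrib matrix_vector_mult_add_rdistrib B_simps)
  show "det (P x) > 0" for x
    unfolding P_def det_mul eq by (intro mult_pos_pos det_R det_unipotent)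
  have lin: "linear (\<lambda>y. R *v B y v)" for v
    using bilinear_B unfolding bilinear_def
    by (auto intro!: linear_compose[OF _ matrix_vector_mul_linear, unfolded o_def])
  show "((\<lambda>y. P y *v v) has_derivative (\<lambda>u. - (R *v B u v))) (at x)" for x v
  proof -
    have "((\<lambda>y. R *v v - R *v B y v) has_derivative (\<lambda>u. 0 - R *v B u v)) (at x)"
      by (intro has_derivative_diff has_derivative_const linear_imp_has_derivative lin)
    then show ?thesis
      by (simp add: P_mult matrix_vector_mult_diff_distrib)
  qed
  show "- (R *v B u v) - - (R *v B v u) = - (1 *\<^sub>R L (P x *v u) (P x *v v))" for x u v
    by (simp add: L_def P_mult B_simps matrix_vector_mult_diff_distrib)
qed (auto simp: linear_iff)

lemma invariant_quotient: "invariant_atlas atlas"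
  unfolding invariant_atlas_def atlas_def
proof (intro ballI, elim rangeE)
  fix c d x a b
  assume x: "x \<in> overlap c d" and cd: "c = nil_chart a" "d = nil_chart b"
  show "P (coord_change c d x) ** jac c d x = P x"
    using x unfolding cd
  proof (rule jac_nil_chart)
    fix \<gamma> assume "coord_change (nil_chart a) (nil_chart b) x = mul \<gamma> x"
      "jac (nil_chart a) (nil_chart b) x = mat 1 + matrix (B \<gamma>)"
    then show "P (coord_change (nil_chart a) (nil_chart b) x) ** jac (nil_chart a) (nil_chart b) x = P x"
      by (simp add: matrix_eq matrix_vector_mul_assoc[symmetric] P_mult matrix_vector_mult_add_rdistrib
          mul_def B_simps)
  qed
qed

end

section \<open>Exponential coordinates\<close>

lemma exp_polys_prod: "(\<And>i. i \<in> I \<Longrightarrow> f i \<in> exp_polys) \<Longrightarrow> (\<lambda>x. \<Prod>i\<in>I. f i x) \<in> exp_polys"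
  by (induction I rule: infinite_finite_induct) (auto intro: exp_polys.intros)

lemma exp_polys_exp_inner: "(\<lambda>x. exp (q \<bullet> x)) \<in> exp_polys"
proof -
  have "exp (q \<bullet> x) = (\<Prod>i\<in>UNIV. exp (q $ i * x $ i))" for x
    by (simp add: inner_vec_def exp_sum)
  then show ?thesis
    by (simp only:) (intro exp_polys_prod exp_polys.intros)
qed

text \<open>Invariant forms of the nilpotent group, rescaled by exponentials of linear functions.
  This covers the invariant forms of a solvable group, with \<open>h = 1\<close>, as well as the
  Gibbons-Hawking coframe.\<close>

locale exp_coframe = nil_group B C + bracket L for B C L +
  fixes c :: "8 \<Rightarrow> real" and q :: "8 \<Rightarrow> real^8" and h lam
  assumes c: "c i > 0"
    and h': "(h has_derivative (\<lambda>u. (h x)\<^sup>2 * lam (\<chi> i. c i * exp (q i \<bullet> x) * (u - B x u) $ i))) (at x)"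
    and lam': "linear lam"
    and structure': "c i * exp (q i \<bullet> x) * ((q i \<bullet> u) * (v - B x v) $ i - (q i \<bullet> v) * (u - B x u) $ i - B u v $ i + B v u $ i) =
      - (h x * L (\<chi> i. c i * exp (q i \<bullet> x) * (u - B x u) $ i) (\<chi> i. c i * exp (q i \<bullet> x) * (v - B x v) $ i) $ i)"
begin

definition P :: "real^8 \<Rightarrow> real^8^8" where
  "P x = matrix (\<lambda>v. \<chi> i. c i * exp (q i \<bullet> x) * (v - B x v) $ i)"
definition E :: "real^8 \<Rightarrow> real^8^8" where
  "E x = (mat 1 + matrix (B x)) ** (\<chi> i j. if i = j then exp (- q i \<bullet> x) / c i else 0)"
definition D :: "real^8 \<Rightarrow> real^8 \<Rightarrow> real^8 \<Rightarrow> real^8" where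
  "D x u v = (\<chi> i. c i * exp (q i \<bullet> x) * ((q i \<bullet> u) * (v - B x v) $ i - B u v $ i))"
definition D2 :: "real^8 \<Rightarrow> real^8 \<Rightarrow> real^8 \<Rightarrow> real^8 \<Rightarrow> real^8" where
  "D2 x w u v = (\<chi> i. c i * exp (q i \<bullet> x) *
     ((q i \<bullet> w) * (q i \<bullet> u) * (v - B x v) $ i - (q i \<bullet> w) * B u v $ i - (q i \<bullet> u) * B w v $ i))"

lemma linear_B: "linear (B x)" "linear (\<lambda>x. B x v)"
  using bilinear_B by (auto simp: bilinear_def)

lemma P_mult: "P x *v v = (\<chi> i. c i * exp (q i \<bullet> x) * (v - B x v) $ i)"
proof -
  have "linear (\<lambda>v. \<chi> i. c i * exp (q i \<bullet> x) * (v - B x v) $ i)"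
    using linear_B(1)[of x]
    by (intro linearI) (auto simp: vec_eq_iff linear_add linear_cmul algebra_simps)
  then show ?thesis
    unfolding P_def by (rule fun_cong[OF matrix_vector_mul(2)])
qed

text \<open>Diagonal times unipotent: both the inverse \<open>E\<close> and the positive determinant
  are read off from this factorisation.\<close>

lemma P_diag: "P x = (\<chi> i j. if i = j then c i * exp (q i \<bullet> x) else 0) ** (mat 1 - matrix (B x))"
proof -
  have "P x *v v = (\<chi> i j. if i = j then c i * exp (q i \<bullet> x) else 0) *v (v - B x v)" for v
    unfolding P_mult by (simp add: vec_eq_iff matrix_vector_mult_def mult_delta_left del: vector_minus_component)
  then show ?thesis
    by (simp add: matrix_eq matrix_vector_mul_assoc[symmetric] matrix_vector_mult_diff_rdistrib)
qed

sublocale coframe L P E D D2 h lam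
proof
  show "exp_poly_map P"
  proof (rule exp_poly_map_matrix)
    fix i j
    have "(\<lambda>x. c i * exp (q i \<bullet> x) * (mat 1 $ i $ j - matrix (B x) $ i $ j)) \<in> exp_polys"
      by (intro exp_polys_intros exp_polys_exp_inner matrix_B_exp_polys)
    then show "(\<lambda>x. P x $ i $ j) \<in> exp_polys"
      by (simp add: P_def matrix_def mat_def axis_def)
  qed
  show "exp_poly_map E"
  proof (rule exp_poly_map_matrix)
    fix i j
    have "(\<lambda>x. (mat 1 $ i $ j + matrix (B x) $ i $ j) * (exp ((- q j) \<bullet> x) * (1 / c j))) \<in> exp_polys"
      by (intro exp_polys_intros exp_polys_exp_inner matrix_B_exp_polys)
    then show "(\<lambda>x. E x $ i $ j) \<in> exp_polys"
      by (simp add: E_def matrix_matrix_mult_def mult_delta_right)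
  qed
  show "P x ** E x = mat 1" for x
  proof -
    have 1: "(mat 1 - matrix (B x)) ** (mat 1 + matrix (B x)) = mat 1"
      by (simp add: matrix_eq matrix_vector_mul_assoc[symmetric] matrix_vector_mult_diff_rdistrib
          matrix_vector_mult_add_rdistrib B_simps)
    have "c i * exp (q i \<bullet> x) * (exp (- (q i \<bullet> x)) / c i) = 1" for i
      using c[of i] by (simp add: exp_minus)
    then have 2: "(\<chi> i j. if i = j then c i * exp (q i \<bullet> x) else 0)
        ** (\<chi> i j. if i = j then exp (- q i \<bullet> x) / c i else 0) = (mat 1 :: real^8^8)"
      by (simp add: vec_eq_iff matrix_matrix_mult_def mat_def mult_delta_left)
    show ?thesis
      unfolding P_diag E_def using 2
      by (simp only: matrix_mul_assoc[symmetric] matrix_mul_assoc[of "mat 1 - matrix (B x)"] 1 matrix_mul_lid)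
  qed
  show "det (P x) > 0" for x
  proof -
    have eq: "mat 1 - matrix (B x) = mat 1 + matrix (B (- x))"
      by (simp add: matrix_eq matrix_vector_mult_diff_rdistrib matrix_vector_mult_add_rdistrib B_simps)
    have "det ((\<chi> i j. if i = j then c i * exp (q i \<bullet> x) else 0) :: real^8^8) > 0"
      by (subst det_diagonal) (simp_all add: c prod_pos)
    then show ?thesis
      unfolding P_diag det_mul eq by (intro mult_pos_pos det_unipotent)
  qed
  have ex: "((\<lambda>y. exp (q i \<bullet> y)) has_derivative (\<lambda>u. exp (q i \<bullet> x) * (q i \<bullet> u))) (at x)" for i x
    by (rule derivative_eq_intros refl)+ (simp add: mult.commute)
  have b: "((\<lambda>y. B y v $ i) has_derivative (\<lambda>u. B u v $ i)) (at x)" for v i x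
    by (rule bounded_linear.has_derivative[OF bounded_linear_vec_nth linear_imp_has_derivative[OF linear_B(2)]])
  have vec: "(f has_derivative f') (at x)" if "\<And>i. ((\<lambda>y. f y $ i) has_derivative (\<lambda>u. f' u $ i)) (at x)"
    for f f' :: "real^8 \<Rightarrow> real^8" and x
    by (subst has_derivative_componentwise_within)
      (use that in \<open>auto simp: Basis_vec_def inner_axis\<close>)
  show "((\<lambda>y. P y *v v) has_derivative (\<lambda>u. D x u v)) (at x)" for x v
  proof (rule vec)
    fix i
    have "((\<lambda>y. c i * exp (q i \<bullet> y) * (v $ i - B y v $ i)) has_derivative
        (\<lambda>u. c i * exp (q i \<bullet> x) * (0 - B u v $ i) + c i * (exp (q i \<bullet> x) * (q i \<bullet> u)) * (v $ i - B x v $ i))) (at x)"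
      by (intro has_derivative_mult has_derivative_mult_right has_derivative_diff has_derivative_const ex b)
    then show "((\<lambda>y. (P y *v v) $ i) has_derivative (\<lambda>u. D x u v $ i)) (at x)"
      by (simp add: P_mult D_def algebra_simps)
  qed
  show "((\<lambda>y. D y u v) has_derivative (\<lambda>w. D2 x w u v)) (at x)" for x u v
  proof (rule vec)
    fix i
    have "((\<lambda>y. c i * exp (q i \<bullet> y) * ((q i \<bullet> u) * (v $ i - B y v $ i) - B u v $ i)) has_derivative
        (\<lambda>w. c i * exp (q i \<bullet> x) * ((q i \<bullet> u) * (0 - B w v $ i) - 0)
          + c i * (exp (q i \<bullet> x) * (q i \<bullet> w)) * ((q i \<bullet> u) * (v $ i - B x v $ i) - B u v $ i))) (at x)"
      by (intro has_derivative_mult has_derivative_mult_right has_derivative_diff has_derivative_const ex b)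
    then show "((\<lambda>y. D y u v $ i) has_derivative (\<lambda>w. D2 x w u v $ i)) (at x)"
      by (simp add: D_def D2_def algebra_simps)
  qed
  show "D2 x w u v = D2 x u w v" for x w u v
    by (simp add: D2_def vec_eq_iff algebra_simps)
  show "(h has_derivative (\<lambda>u. (h x)\<^sup>2 * lam (P x *v u))) (at x)" for x
    unfolding P_mult by (rule h')
  show "lam (X + Y) = lam X + lam Y" "lam (r *\<^sub>R X) = r *\<^sub>R lam X" for X Y r
    by (rule linear_add[OF lam'] linear_cmul[OF lam'])+
  show "D x u v - D x v u = - (h x *\<^sub>R L (P x *v u) (P x *v v))" for x u v
  proof (subst vec_eq_iff, intro allI)
    fix i
    have "(D x u v - D x v u) $ i = c i * exp (q i \<bullet> x) *
        ((q i \<bullet> u) * (v - B x v) $ i - (q i \<bullet> v) * (u - B x u) $ i - B u v $ i + B v u $ i)"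
      by (simp add: D_def algebra_simps)
    also have "\<dots> = - (h x * L (P x *v u) (P x *v v) $ i)"
      unfolding P_mult by (rule structure')
    finally show "(D x u v - D x v u) $ i = (- (h x *\<^sub>R L (P x *v u) (P x *v v))) $ i"
      by simp
  qed
qed

end

section \<open>Coordinates in dimension eight\<close>

definition vec8 :: "'a \<Rightarrow> 'a \<Rightarrow> 'a \<Rightarrow> 'a \<Rightarrow> 'a \<Rightarrow> 'a \<Rightarrow> 'a \<Rightarrow> 'a \<Rightarrow> 'a^8" where
  "vec8 x1 x2 x3 x4 x5 x6 x7 x8 = (\<chi> i. if i = 1 then x1 else if i = 2 then x2 else if i = 3 then x3
     else if i = 4 then x4 else if i = 5 then x5 else if i = 6 then x6 else if i = 7 then x7 else x8)"

lemma vec8_nth [simp]: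
  "vec8 x1 x2 x3 x4 x5 x6 x7 x8 $ 1 = x1" "vec8 x1 x2 x3 x4 x5 x6 x7 x8 $ 2 = x2"
  "vec8 x1 x2 x3 x4 x5 x6 x7 x8 $ 3 = x3" "vec8 x1 x2 x3 x4 x5 x6 x7 x8 $ 4 = x4"
  "vec8 x1 x2 x3 x4 x5 x6 x7 x8 $ 5 = x5" "vec8 x1 x2 x3 x4 x5 x6 x7 x8 $ 6 = x6"
  "vec8 x1 x2 x3 x4 x5 x6 x7 x8 $ 7 = x7" "vec8 x1 x2 x3 x4 x5 x6 x7 x8 $ 8 = x8"
  by (simp_all add: vec8_def)

lemma inner_8: "x \<bullet> y = x $ 1 * y $ 1 + x $ 2 * y $ 2 + x $ 3 * y $ 3 + x $ 4 * y $ 4 + x $ 5 * y $ 5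
    + x $ 6 * y $ 6 + x $ 7 * y $ 7 + x $ 8 * y $ 8" for x y :: "real^8"
  by (simp add: inner_vec_def sum_8)

lemma ax_nth: "ax i $ j = (if i = j then 1 else 0)"
  by (simp add: axis_def)

lemma vec_eq_8: "x = y \<longleftrightarrow> x $ 1 = y $ 1 \<and> x $ 2 = y $ 2 \<and> x $ 3 = y $ 3 \<and> x $ 4 = y $ 4 \<and> x $ 5 = y $ 5
    \<and> x $ 6 = y $ 6 \<and> x $ 7 = y $ 7 \<and> x $ 8 = y $ 8" for x y :: "'a^8"
  by (simp add: vec_eq_iff forall_8)

lemma e3_3: "e3 a b c [u, v, w] = u $ a * (v $ b * w $ c - v $ c * w $ b)
     - u $ b * (v $ a * w $ c - v $ c * w $ a) + u $ c * (v $ a * w $ b - v $ b * w $ a)"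
  by (simp add: e3_def Let_def)

lemma alt_form_e3: "alt_form 3 (e3 a b c)"
  by (rule alt_form_3I) (auto simp: e3_3 algebra_simps intro!: linearI)

lemma alt_form_diff: "alt_form k \<omega> \<Longrightarrow> alt_form k \<eta> \<Longrightarrow> alt_form k (\<lambda>vs. \<omega> vs - \<eta> vs)"
  using alt_form_add[of k \<omega> "\<lambda>vs. - 1 * \<eta> vs"] alt_form_scale[of k \<eta> "- 1"] by simp

lemma alt_form_rho0: "alt_form 3 rho0"
  unfolding rho0_def[abs_def] by (intro alt_form_add alt_form_diff alt_form_scale alt_form_e3)

lemma sqrt_3_mult: "sqrt 3 * (sqrt 3 * x) = 3 * x"
  by (simp flip: mult.assoc)

text \<open>Only the six orderings of the three indices contribute, so a sum over 512 triples never
  has to be expanded.\<close>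

lemma sum_e3: "(\<Sum>i\<in>UNIV. \<Sum>j\<in>UNIV. \<Sum>k\<in>UNIV. e3 a b c [ax i, ax j, ax k] *\<^sub>R f i j k)
    = f a b c - f a c b - f b a c + f b c a + f c a b - f c b a" for f :: "8 \<Rightarrow> 8 \<Rightarrow> 8 \<Rightarrow> 'a::real_vector"
proof -
  have s: "(\<Sum>i\<in>UNIV. ax i $ a *\<^sub>R g i) = g a" for a and g :: "8 \<Rightarrow> 'a"
  proof -
    have "ax i $ a *\<^sub>R g i = (if i = a then g i else 0)" for i
      by (simp add: ax_nth)
    then show ?thesis by simp
  qed
  have "(\<Sum>i\<in>UNIV. \<Sum>j\<in>UNIV. \<Sum>k\<in>UNIV. (ax i $ a * (ax j $ b * ax k $ c)) *\<^sub>R f i j k) = f a b c" for a b c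
    by (simp only: scaleR_scaleR[symmetric] scaleR_sum_right[symmetric] s)
  note t = this
  have "(\<Sum>i\<in>UNIV. \<Sum>j\<in>UNIV. \<Sum>k\<in>UNIV. e3 a b c [ax i, ax j, ax k] *\<^sub>R f i j k) =
      (\<Sum>i\<in>UNIV. \<Sum>j\<in>UNIV. \<Sum>k\<in>UNIV. (ax i $ a * (ax j $ b * ax k $ c)) *\<^sub>R f i j k
        - (ax i $ a * (ax j $ c * ax k $ b)) *\<^sub>R f i j k - (ax i $ b * (ax j $ a * ax k $ c)) *\<^sub>R f i j k
        + (ax i $ b * (ax j $ c * ax k $ a)) *\<^sub>R f i j k + (ax i $ c * (ax j $ a * ax k $ b)) *\<^sub>R f i j k
        - (ax i $ c * (ax j $ b * ax k $ a)) *\<^sub>R f i j k)"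
    by (intro sum.cong refl) (simp only: e3_3 right_diff_distrib scaleR_diff_left scaleR_add_left, simp)
  also have "\<dots> = f a b c - f a c b - f b a c + f b c a + f c a b - f c b a"
    by (simp only: sum.distrib sum_subtractf t)
  finally show ?thesis .
qed

lemma norm_sq3_mat_1: "norm_sq3 (mat 1) \<omega> = (\<Sum>i\<in>UNIV. \<Sum>j\<in>UNIV. \<Sum>k\<in>UNIV. (\<omega> [ax i, ax j, ax k])\<^sup>2) / 6"
proof -
  have "matrix_inv (mat 1 :: real^8^8) = mat 1"
    by (rule matrix_inv_eqI) simp
  then show ?thesis
    by (simp add: norm_sq3_def power2_eq_square)
qed

lemma norm_sq3_e3: "distinct [a, b, c] \<Longrightarrow> norm_sq3 (mat 1) (e3 a b c) = 1"
  unfolding norm_sq3_mat_1 power2_eq_square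
  using sum_e3[of a b c "\<lambda>i j k. e3 a b c [ax i, ax j, ax k]"]
  by (simp add: e3_3 ax_nth)

lemma norm_sq3_e3_add:
  assumes "distinct [a, b, c, a', b', c']"
  shows "norm_sq3 (mat 1) (\<lambda>vs. 1 / sqrt 2 * (e3 a b c vs + e3 a' b' c' vs)) = 1"
proof -
  let ?f = "\<lambda>i j k. e3 a b c [ax i, ax j, ax k] + e3 a' b' c' [ax i, ax j, ax k]"
  have "(1 / sqrt 2 * ?f i j k)\<^sup>2 = (1/2) *\<^sub>R (e3 a b c [ax i, ax j, ax k] *\<^sub>R ?f i j k
      + e3 a' b' c' [ax i, ax j, ax k] *\<^sub>R ?f i j k)" for i j k
    by (simp add: power_mult_distrib power_divide) (simp add: power2_eq_square algebra_simps)
  moreover have "(\<Sum>i\<in>UNIV. \<Sum>j\<in>UNIV. \<Sum>k\<in>UNIV. (1/2) *\<^sub>R (e3 a b c [ax i, ax j, ax k] *\<^sub>R ?f i j k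
      + e3 a' b' c' [ax i, ax j, ax k] *\<^sub>R ?f i j k)) = 6"
    unfolding scaleR_sum_right[symmetric] sum.distrib sum_e3[of a b c ?f] sum_e3[of a' b' c' ?f] using assms
    by (auto simp: e3_3 ax_nth)
  ultimately show ?thesis
    unfolding norm_sq3_mat_1 by (simp only:)
qed

section \<open>A nilpotent group with a closed and coclosed PSU(3)-structure\<close>

text \<open>The 5-dimensional Heisenberg group times a flat 3-space. Here
  \<open>d e^8 = -(e^46 - e^57)\<close> is self-dual in the space 4567 and orthogonal to
  \<open>e^45 + e^67\<close>, while the 2-forms that \<open>rho0\<close> pairs with
  \<open>e^1, e^2, e^3\<close> are anti-self-dual. All wedge products that occur in the derivatives
  of \<open>rho0\<close> and of its star therefore vanish.\<close>

definition nil_B :: "real^8 \<Rightarrow> real^8 \<Rightarrow> real^8" where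
  "nil_B x y = (x $ 4 * y $ 6 - x $ 5 * y $ 7) *\<^sub>R ax 8"

interpretation nil: nil_coframe nil_B "{8}" "mat 1" "mat 1"
  by unfold_locales
    (auto simp: nil_B_def bilinear_def algebra_simps axis_def intro!: linearI)

lemma nil_L: "nil.L X Y = vec8 0 0 0 0 0 0 0 (X $ 4 * Y $ 6 - X $ 6 * Y $ 4 - (X $ 5 * Y $ 7 - X $ 7 * Y $ 5))"
  by (simp add: nil.L_def nil_B_def vec_eq_8 axis_def)

lemma koszul_nil: "koszul nil.L X Y = vec8 0 0 0
    (X $ 6 * Y $ 8 / 2 + X $ 8 * Y $ 6 / 2)
    (- (X $ 7 * Y $ 8 / 2) - X $ 8 * Y $ 7 / 2)
    (- (X $ 4 * Y $ 8 / 2) - X $ 8 * Y $ 4 / 2)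
    (X $ 5 * Y $ 8 / 2 + X $ 8 * Y $ 5 / 2)
    (X $ 4 * Y $ 6 / 2 - X $ 5 * Y $ 7 / 2 - X $ 6 * Y $ 4 / 2 + X $ 7 * Y $ 5 / 2)"
  by (simp add: vec_eq_8 koszul_def nil_L inner_8 axis_def field_simps)

lemma nil_d_form: "nil.d_form rho0 [a, b, c, d] = 0"
  by (simp add: nil.d_form_4[OF alt_form_rho0] nil_L rho0_def e3_3 algebra_simps)

lemma nil_coclosed: "nil.coclosed rho0"
  unfolding nil.coclosed_def
  by (simp add: sum_8 act_3 koszul_nil rho0_def e3_3 axis_def algebra_simps)

lemma nil_not_parallel: "\<not> nil.parallel_form rho0"
proof
  assume "nil.parallel_form rho0"
  \<comment> \<open>The derivative along the fourth frame vector takes the eighth to minus half the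
    sixth, so this entry picks up the coefficient of \<open>e^246\<close> in
    \<open>rho0\<close>.\<close>
  then have "act (nil.conn_mat (ax 4)) rho0 [ax 2, ax 4, ax 8] = 0"
    by (simp only: nil.parallel_form_def)
  then show False
    by (simp add: act_3 koszul_nil rho0_def e3_3 axis_def)
qed

text \<open>On a 2-step nilpotent group Ricci is positive along the commutator and zero on a flat
  factor. These two values exclude an Einstein metric.\<close>

lemma nil_ricci: "ricci nil.G 0 (ax 8) (ax 8) = 1" "ricci nil.G 0 (ax 1) (ax 1) = 0"
  by (simp_all add: nil.ricci_G nil.P_mult nil_B_def nil.curv_def sum_8 nil_L koszul_nil axis_def)

section \<open>The symmetric space SL(3,C)/SU(3)\<close>

text \<open>
  As a solvable group, the noncompact dual of \<open>SU(3)\<close>: \<open>e\<^sub>3, e\<^sub>8\<close> span the abelian part, the planes \<open>e\<^sub>1\<^sub>2\<close>,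
  \<open>e\<^sub>6\<^sub>7\<close> are the simple root spaces and \<open>e\<^sub>4\<^sub>5\<close> is their commutator.
\<close>

definition sym_L :: "real^8 \<Rightarrow> real^8 \<Rightarrow> real^8" where
  "sym_L X Y = vec8
      (- (X $ 1 * Y $ 3 - X $ 3 * Y $ 1))
      (- (X $ 2 * Y $ 3 - X $ 3 * Y $ 2)) 0
      ((X $ 1 * Y $ 6 - X $ 6 * Y $ 1) - (X $ 2 * Y $ 7 - X $ 7 * Y $ 2) + (X $ 3 * Y $ 4 - X $ 4 * Y $ 3) / 2 - sqrt 3 / 2 * (X $ 4 * Y $ 8 - X $ 8 * Y $ 4))
      ((X $ 1 * Y $ 7 - X $ 7 * Y $ 1) + (X $ 2 * Y $ 6 - X $ 6 * Y $ 2) + (X $ 3 * Y $ 5 - X $ 5 * Y $ 3) / 2 - sqrt 3 / 2 * (X $ 5 * Y $ 8 - X $ 8 * Y $ 5))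
      (- ((X $ 3 * Y $ 6 - X $ 6 * Y $ 3) / 2) - sqrt 3 / 2 * (X $ 6 * Y $ 8 - X $ 8 * Y $ 6))
      (- ((X $ 3 * Y $ 7 - X $ 7 * Y $ 3) / 2) - sqrt 3 / 2 * (X $ 7 * Y $ 8 - X $ 8 * Y $ 7)) 0"

lemma koszul_sym: "koszul sym_L X Y = vec8
      (- X $ 1 * Y $ 3 + X $ 4 * Y $ 6 / 2 + X $ 5 * Y $ 7 / 2 + X $ 6 * Y $ 4 / 2 + X $ 7 * Y $ 5 / 2)
      (- X $ 2 * Y $ 3 - X $ 4 * Y $ 7 / 2 + X $ 5 * Y $ 6 / 2 + X $ 6 * Y $ 5 / 2 - X $ 7 * Y $ 4 / 2)
      (X $ 1 * Y $ 1 + X $ 2 * Y $ 2 + X $ 4 * Y $ 4 / 2 + X $ 5 * Y $ 5 / 2 - X $ 6 * Y $ 6 / 2 - X $ 7 * Y $ 7 / 2)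
      (X $ 1 * Y $ 6 / 2 - X $ 2 * Y $ 7 / 2 - X $ 4 * Y $ 3 / 2 - sqrt 3 / 2 * X $ 4 * Y $ 8 - X $ 6 * Y $ 1 / 2 + X $ 7 * Y $ 2 / 2)
      (X $ 1 * Y $ 7 / 2 + X $ 2 * Y $ 6 / 2 - X $ 5 * Y $ 3 / 2 - sqrt 3 / 2 * X $ 5 * Y $ 8 - X $ 6 * Y $ 2 / 2 - X $ 7 * Y $ 1 / 2)
      (- (X $ 1 * Y $ 4 / 2) - X $ 2 * Y $ 5 / 2 - X $ 4 * Y $ 1 / 2 - X $ 5 * Y $ 2 / 2 + X $ 6 * Y $ 3 / 2 - sqrt 3 / 2 * X $ 6 * Y $ 8)
      (- (X $ 1 * Y $ 5 / 2) + X $ 2 * Y $ 4 / 2 + X $ 4 * Y $ 2 / 2 - X $ 5 * Y $ 1 / 2 + X $ 7 * Y $ 3 / 2 - sqrt 3 / 2 * X $ 7 * Y $ 8)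
      (sqrt 3 / 2 * X $ 4 * Y $ 4 + sqrt 3 / 2 * X $ 5 * Y $ 5 + sqrt 3 / 2 * X $ 6 * Y $ 6 + sqrt 3 / 2 * X $ 7 * Y $ 7)"
  by (simp add: vec_eq_8 koszul_def sym_L_def inner_8 axis_def field_simps)

definition sym_B :: "real^8 \<Rightarrow> real^8 \<Rightarrow> real^8" where
  "sym_B x y = vec8 0 0 0 (x $ 1 * y $ 6 - x $ 2 * y $ 7) (x $ 1 * y $ 7 + x $ 2 * y $ 6) 0 0 0"

text \<open>Minus the roots on the abelian part. The simple ones, at 12 and 67, are unit vectors at
  120 degrees and add up to the one at 45; each has multiplicity two.\<close>

definition sym_q :: "8 \<Rightarrow> real^8" where
  "sym_q i = (if i = 1 \<or> i = 2 then - ax 3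
     else if i = 4 \<or> i = 5 then - (1/2) *\<^sub>R ax 3 - (sqrt 3 / 2) *\<^sub>R ax 8
     else if i = 6 \<or> i = 7 then (1/2) *\<^sub>R ax 3 - (sqrt 3 / 2) *\<^sub>R ax 8 else 0)"

lemma sym_structure:
  fixes x u v :: "real^8"
  shows "exp (sym_q i \<bullet> x) * ((sym_q i \<bullet> u) * (v - sym_B x v) $ i - (sym_q i \<bullet> v) * (u - sym_B x u) $ i
      - sym_B u v $ i + sym_B v u $ i) =
    - sym_L (\<chi> i. exp (sym_q i \<bullet> x) * (u - sym_B x u) $ i) (\<chi> i. exp (sym_q i \<bullet> x) * (v - sym_B x v) $ i) $ i"
proof -
  \<comment> \<open>As the third root is the sum of the simple ones, all weights are monomials in
    \<open>a\<close> and \<open>f\<close>, and the structure equation becomes a polynomial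
    identity.\<close>
  define a where "a = exp (- x $ 3)"
  define f where "f = exp (x $ 3 / 2 - sqrt 3 / 2 * x $ 8)"
  have w: "exp (sym_q 1 \<bullet> x) = a" "exp (sym_q 2 \<bullet> x) = a" "exp (sym_q 3 \<bullet> x) = 1" "exp (sym_q 4 \<bullet> x) = a * f"
    "exp (sym_q 5 \<bullet> x) = a * f" "exp (sym_q 6 \<bullet> x) = f" "exp (sym_q 7 \<bullet> x) = f" "exp (sym_q 8 \<bullet> x) = 1"
    by (simp_all add: sym_q_def a_def f_def inner_diff_left inner_axis' mult_exp_exp)
  have "\<forall>i. exp (sym_q i \<bullet> x) * ((sym_q i \<bullet> u) * (v - sym_B x v) $ i - (sym_q i \<bullet> v) * (u - sym_B x u) $ i
      - sym_B u v $ i + sym_B v u $ i) =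
    - sym_L (\<chi> i. exp (sym_q i \<bullet> x) * (u - sym_B x u) $ i) (\<chi> i. exp (sym_q i \<bullet> x) * (v - sym_B x v) $ i) $ i"
    unfolding forall_8 sym_L_def vec8_nth vec_lambda_beta w
    by (simp add: sym_q_def sym_B_def inner_diff_left inner_axis' algebra_simps add_divide_distrib diff_divide_distrib)
  then show ?thesis ..
qed

interpretation sym: exp_coframe sym_B "{4, 5}" sym_L "\<lambda>i. 1" sym_q "\<lambda>x. 1" "\<lambda>X. 0"
proof
  show "(1 :: real) * exp (sym_q i \<bullet> x) * ((sym_q i \<bullet> u) * (v - sym_B x v) $ i - (sym_q i \<bullet> v) * (u - sym_B x u) $ i
      - sym_B u v $ i + sym_B v u $ i) = - (1 * sym_L (\<chi> i. 1 * exp (sym_q i \<bullet> x) * (u - sym_B x u) $ i)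
      (\<chi> i. 1 * exp (sym_q i \<bullet> x) * (v - sym_B x v) $ i) $ i)" for i x u v
    using sym_structure by simp
  show "bilinear sym_B" "bilinear sym_L"
    by (auto simp: bilinear_def sym_B_def sym_L_def vec_eq_8 algebra_simps diff_divide_distrib add_divide_distrib intro!: linearI)
  show "k \<notin> {4, 5} \<Longrightarrow> sym_B x y $ k = 0" for k x y
    by (simp add: sym_B_def vec8_def)
  show "(\<And>k. x $ k \<in> \<int>) \<Longrightarrow> (\<And>k. y $ k \<in> \<int>) \<Longrightarrow> sym_B x y $ k \<in> \<int>" for k x y
    by (simp add: sym_B_def vec8_def)
qed (auto simp: sym_B_def sym_L_def vec_eq_8 algebra_simps add_divide_distrib diff_divide_distrib)

text \<open>Up to scale \<open>rho0\<close> is the form of structure constants of su(3), hence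
  invariant under the isotropy group, and invariant forms on a symmetric space are parallel. In the
  solvable frame this is confirmed on basis vectors \<open>X\<close>.\<close>

lemma sym_parallel: "sym.parallel_form rho0"
  unfolding sym.parallel_form_def
proof (intro allI)
  fix X a b c
  have basis: "\<forall>i. act (sym.conn_mat (ax i)) rho0 [a, b, c] = 0"
    unfolding forall_8
    by (intro conjI) (simp_all add: act_3 koszul_sym rho0_def e3_3 axis_def algebra_simps sqrt_3_mult)
  show "act (sym.conn_mat X) rho0 [a, b, c] = 0"
    by (rule linear_vanish[OF sym.linear_act_conn_mat[OF alt_form_rho0]], rule spec[OF basis])
qed

text \<open>Minus the sum over all root vectors of the squared value of the root: two contributions
  of 1 and four of 1/4.\<close>

lemma sym_ricci: "ricci sym.G 0 (ax 3) (ax 3) = - 3"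
  by (simp add: sym.ricci_G sym.P_mult sum_8 sym.curv_def sym_q_def sym_B_def axis_def sym_L_def koszul_sym)

section \<open>A Ricci-flat hyperkaehler metric with two further closed forms\<close>

text \<open>
  The product of \<open>\<real>\<^sup>4\<close> (coordinates 1, 2, 3, 8) with the Gibbons-Hawking metric
  \<open>z (dx\<^sup>2 + dy\<^sup>2 + dz\<^sup>2) + z\<^sup>-\<^sup>1 (dt + x dy)\<^sup>2\<close> for the potential \<open>z\<close>. Here \<open>x, t, y\<close> are the coordinates 4, 5, 7 and
  \<open>z = exp(2 x\<^sub>6)\<close>. Besides the Kaehler forms, also \<open>e\<^sup>4\<^sup>5\<close> and \<open>e\<^sup>6\<^sup>7\<close> are closed (Nurowski and Przanowski).
\<close>

definition np_L :: "real^8 \<Rightarrow> real^8 \<Rightarrow> real^8" where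
  "np_L X Y = vec8 0 0 0
      ((X $ 4 * Y $ 6 - X $ 6 * Y $ 4) / 2)
      (- (X $ 4 * Y $ 7 - X $ 7 * Y $ 4) - (X $ 5 * Y $ 6 - X $ 6 * Y $ 5) / 2) 0
      (- ((X $ 6 * Y $ 7 - X $ 7 * Y $ 6) / 2)) 0"

lemma koszul_np: "koszul np_L X Y = vec8 0 0 0
      (X $ 4 * Y $ 6 / 2 - X $ 5 * Y $ 7 / 2 - X $ 7 * Y $ 5 / 2)
      (- (X $ 4 * Y $ 7 / 2) - X $ 5 * Y $ 6 / 2 + X $ 7 * Y $ 4 / 2)
      (- (X $ 4 * Y $ 4 / 2) + X $ 5 * Y $ 5 / 2 - X $ 7 * Y $ 7 / 2)
      (X $ 4 * Y $ 5 / 2 + X $ 5 * Y $ 4 / 2 + X $ 7 * Y $ 6 / 2) 0"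
  by (simp add: vec_eq_8 koszul_def np_L_def inner_8 axis_def field_simps)

text \<open>Makes the fifth component of dx - B(x, dx) equal to dt + x dy.\<close>

definition np_B :: "real^8 \<Rightarrow> real^8 \<Rightarrow> real^8" where
  "np_B x y = vec8 0 0 0 0 (- x $ 4 * y $ 7) 0 0 0"

text \<open>With a = exp(x_6), the square root of z, the nontrivial coframe elements are a dx, (dt +
  x dy)/a, 2 a^3 dx_6 and a dy. The third is the normalised dz, whence the weight 3 here and the
  factor 2 in \<open>np_c\<close>.\<close>

definition np_q :: "8 \<Rightarrow> real^8" where
  "np_q i = (if i = 4 \<or> i = 7 then ax 6 else if i = 5 then - ax 6 else if i = 6 then 3 *\<^sub>R ax 6 else 0)"

definition np_c :: "8 \<Rightarrow> real" where
  "np_c i = (if i = 6 then 2 else 1)"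

text \<open>This is z^(-3/2). Its differential is -3 \<open>h\<close> dx_6, and dx_6 is
  \<open>h\<close>/2 times the sixth coframe element, which gives the constant -3/2 of
  \<open>np_lam\<close>.\<close>

definition np_h :: "real^8 \<Rightarrow> real" where
  "np_h x = exp (- 3 * x $ 6)"

definition np_lam :: "real^8 \<Rightarrow> real" where
  "np_lam X = - (3/2) * X $ 6"

lemma np_structure:
  fixes x u v :: "real^8"
  shows "np_c i * exp (np_q i \<bullet> x) * ((np_q i \<bullet> u) * (v - np_B x v) $ i - (np_q i \<bullet> v) * (u - np_B x u) $ i
      - np_B u v $ i + np_B v u $ i) =
    - (np_h x * np_L (\<chi> i. np_c i * exp (np_q i \<bullet> x) * (u - np_B x u) $ i)
        (\<chi> i. np_c i * exp (np_q i \<bullet> x) * (v - np_B x v) $ i) $ i)"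
proof -
  define a where "a = exp (x $ 6)"
  have a: "a \<noteq> 0" by (simp add: a_def)
  have h: "np_h x = 1 / a ^ 3"
    by (simp add: np_h_def a_def exp_minus inverse_eq_divide flip: exp_of_nat_mult)
  have w: "exp (np_q 1 \<bullet> x) = 1" "exp (np_q 2 \<bullet> x) = 1" "exp (np_q 3 \<bullet> x) = 1" "exp (np_q 4 \<bullet> x) = a"
    "exp (np_q 5 \<bullet> x) = 1 / a" "exp (np_q 6 \<bullet> x) = a ^ 3" "exp (np_q 7 \<bullet> x) = a" "exp (np_q 8 \<bullet> x) = 1"
    by (simp_all add: np_q_def a_def inner_axis' exp_minus inverse_eq_divide flip: exp_of_nat_mult)
  have "\<forall>i. np_c i * exp (np_q i \<bullet> x) * ((np_q i \<bullet> u) * (v - np_B x v) $ i - (np_q i \<bullet> v) * (u - np_B x u) $ i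
      - np_B u v $ i + np_B v u $ i) =
    - (np_h x * np_L (\<chi> i. np_c i * exp (np_q i \<bullet> x) * (u - np_B x u) $ i)
        (\<chi> i. np_c i * exp (np_q i \<bullet> x) * (v - np_B x v) $ i) $ i)"
    unfolding forall_8 np_L_def vec8_nth vec_lambda_beta w h using a
    by (intro conjI; simp add: np_q_def np_B_def np_c_def inner_axis' field_simps power3_eq_cube)
  then show ?thesis ..
qed

interpretation np: exp_coframe np_B "{5}" np_L np_c np_q np_h np_lam
proof
  show "np_c i > 0" for i
    by (simp add: np_c_def)
  show "(np_h has_derivative (\<lambda>u. (np_h x)\<^sup>2 * np_lam (\<chi> i. np_c i * exp (np_q i \<bullet> x) * (u - np_B x u) $ i))) (at x)" for x
  proof -
    have "(np_h has_derivative (\<lambda>u. exp (- 3 * x $ 6) * (- 3 * u $ 6))) (at x)"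
      unfolding np_h_def
      by (rule derivative_eq_intros bounded_linear_imp_has_derivative bounded_linear_vec_nth refl)+ (simp add: mult_ac)
    moreover have "exp (- 3 * x $ 6) = (np_h x)\<^sup>2 * exp (np_q 6 \<bullet> x)"
      by (simp add: np_h_def np_q_def inner_axis' mult_exp_exp power2_eq_square)
    ultimately show ?thesis
      by (simp add: np_lam_def np_c_def np_B_def algebra_simps)
  qed
  show "np_lam (X + Y) = np_lam X + np_lam Y" "np_lam (r *\<^sub>R X) = r *\<^sub>R np_lam X" for X Y r
    by (simp_all add: np_lam_def algebra_simps)
  show "np_c i * exp (np_q i \<bullet> x) * ((np_q i \<bullet> u) * (v - np_B x v) $ i - (np_q i \<bullet> v) * (u - np_B x u) $ i
      - np_B u v $ i + np_B v u $ i) =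
    - (np_h x * np_L (\<chi> i. np_c i * exp (np_q i \<bullet> x) * (u - np_B x u) $ i)
        (\<chi> i. np_c i * exp (np_q i \<bullet> x) * (v - np_B x v) $ i) $ i)" for i x u v
    by (rule np_structure)
  show "bilinear np_B" "bilinear np_L"
    by (auto simp: bilinear_def np_B_def np_L_def vec_eq_8 algebra_simps diff_divide_distrib add_divide_distrib intro!: linearI)
  show "k \<notin> {5} \<Longrightarrow> np_B x y $ k = 0" for k x y
    by (simp add: np_B_def vec8_def)
  show "(\<And>k. x $ k \<in> \<int>) \<Longrightarrow> (\<And>k. y $ k \<in> \<int>) \<Longrightarrow> np_B x y $ k \<in> \<int>" for k x y
    by (simp add: np_B_def vec8_def)
qed (auto simp: np_B_def np_L_def vec_eq_8 algebra_simps add_divide_distrib diff_divide_distrib)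

lemma np_h_pos: "np_h x > 0"
  by (simp add: np_h_def)

text \<open>In coordinates \<open>e^45 = dx \<and> (dt + x dy)\<close> and
  \<open>e^67 = z dz \<and> dy\<close>. Both are closed, and so are the other two 2-forms in
  \<open>rho0\<close>; the remaining factors are differentials of coordinates of the flat
  space.\<close>

lemma np_d_form:
  "np.d_form rho0 [a, b, c, d] = 0" "np.d_form (e3 1 4 5) [a, b, c, d] = 0" "np.d_form (e3 2 6 7) [a, b, c, d] = 0"
  by (simp_all add: np.d_form_4[OF alt_form_rho0] np.d_form_4[OF alt_form_e3] np_L_def rho0_def e3_3 algebra_simps
      add_divide_distrib diff_divide_distrib)

text \<open>The star on the space 4567 exchanges \<open>e^45\<close> and \<open>e^67\<close> and
  preserves the 2-forms of \<open>rho0\<close> up to sign, so the stars are again built from closed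
  forms.\<close>

lemma np_coclosed: "np.coclosed rho0" "np.coclosed (e3 1 4 5)" "np.coclosed (e3 2 6 7)"
  unfolding np.coclosed_def
  by (simp_all add: sum_8 act_3 koszul_np rho0_def e3_3 axis_def algebra_simps add_divide_distrib diff_divide_distrib)

lemma np_not_parallel: "\<not> np.parallel_form rho0" "\<not> np.parallel_form (e3 1 4 5)"
  "\<not> np.parallel_form (\<lambda>vs. 1 / sqrt 2 * (e3 1 4 5 vs + e3 2 6 7 vs))"
proof -
  \<comment> \<open>The form \<open>e^45 + e^67\<close> has the duality opposite to the Kaehler
    forms. Along the fourth frame vector, 4 goes to -6/2 and 7 to -5/2, and the two contributions
    add up.\<close>
  have "act (np.conn_mat (ax 4)) rho0 [ax 4, ax 7, ax 8] \<noteq> 0"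
    by (simp add: act_3 koszul_np rho0_def e3_3 axis_def)
  then show "\<not> np.parallel_form rho0" by (auto simp: np.parallel_form_def)
  have "act (np.conn_mat (ax 4)) (e3 1 4 5) [ax 1, ax 4, ax 7] \<noteq> 0"
    by (simp add: act_3 koszul_np e3_3 axis_def)
  then show "\<not> np.parallel_form (e3 1 4 5)" by (auto simp: np.parallel_form_def)
  have "act (np.conn_mat (ax 4)) (\<lambda>vs. 1 / sqrt 2 * (e3 1 4 5 vs + e3 2 6 7 vs)) [ax 1, ax 4, ax 7] \<noteq> 0"
    by (simp add: act_3 koszul_np e3_3 axis_def)
  then show "\<not> np.parallel_form (\<lambda>vs. 1 / sqrt 2 * (e3 1 4 5 vs + e3 2 6 7 vs))"
    by (auto simp: np.parallel_form_def)
qed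

text \<open>The metric is hyperkaehler. For the verification, linearity reduces the first argument
  to basis vectors, while \<open>W\<close> stays symbolic.\<close>

lemma np_ricci: "ricci np.G x v w = 0"
proof -
  have "(\<Sum>a\<in>UNIV. np.curv np_lam (ax a) V W $ a) = 0" for V W
  proof -
    have lin: "linear (\<lambda>V. \<Sum>a\<in>UNIV. np.curv np_lam (ax a) V W $ a)"
      using linear_compose[OF np.linear_curv_2[OF np.lam'] bounded_linear.linear[OF bounded_linear_vec_nth]]
      by (intro linear_compose_sum ballI) (simp add: o_def)
    have basis: "\<forall>i. (\<Sum>a\<in>UNIV. np.curv np_lam (ax a) (ax i) W $ a) = 0"
      unfolding forall_8
      by (intro conjI; simp add: sum_8 np.curv_def np_lam_def np_L_def koszul_np axis_def)
    show ?thesis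
      by (rule linear_vanish[OF lin], rule spec[OF basis])
  qed
  then show ?thesis
    by (simp only: np.ricci_G mult_zero_right)
qed

section \<open>Brackets of the form su(2) + su(2) + R^2 and su(2) + R^5\<close>

definition cross8 :: "8 \<Rightarrow> 8 \<Rightarrow> 8 \<Rightarrow> real^8 \<Rightarrow> real^8 \<Rightarrow> real^8" where
  "cross8 a b c u v = (u $ b * v $ c - u $ c * v $ b) *\<^sub>R ax a + (u $ c * v $ a - u $ a * v $ c) *\<^sub>R ax b
     + (u $ a * v $ b - u $ b * v $ a) *\<^sub>R ax c"

lemma cross8_e3: "cross8 a b c u v \<bullet> w = e3 a b c [u, v, w]"
  by (simp add: cross8_def e3_3 inner_add_left inner_axis' algebra_simps)

text \<open>\<open>- i/2\<close> times the combination of the Pauli matrices with coefficients \<open>p, q, r\<close>.\<close>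

definition pauli :: "real \<Rightarrow> real \<Rightarrow> real \<Rightarrow> complex^2^2" where
  "pauli p q r = vector [vector [Complex 0 (- r / 2), Complex (- q / 2) (- p / 2)],
     vector [Complex (q / 2) (- p / 2), Complex 0 (r / 2)]]"

lemma pauli_nth: "pauli p q r $ 1 $ 1 = Complex 0 (- r / 2)" "pauli p q r $ 1 $ 2 = Complex (- q / 2) (- p / 2)"
  "pauli p q r $ 2 $ 1 = Complex (q / 2) (- p / 2)" "pauli p q r $ 2 $ 2 = Complex 0 (r / 2)"
  by (simp_all add: pauli_def vector_def)

lemma comm_pauli: "comm (pauli p q r) (pauli p' q' r') = pauli (q * r' - r * q') (r * p' - p * r') (p * q' - q * p')"
  by (simp add: comm_def vec_eq_iff forall_2 matrix_matrix_mult_def sum_2 pauli_nth complex_eq_iff field_simps)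

lemma su2_pauli: "A \<in> su2 \<longleftrightarrow> (\<exists>p q r. A = pauli p q r)"
proof
  assume "A \<in> su2"
  then have sym: "\<forall>i j. A $ j $ i = - cnj (A $ i $ j)" and tr: "trace A = 0"
    unfolding su2_def by blast+
  have "Re (A $ j $ i) = - Re (A $ i $ j)" "Im (A $ j $ i) = Im (A $ i $ j)" for i j
    using arg_cong[OF sym[rule_format], of Re j i] arg_cong[OF sym[rule_format], of Im j i] by simp_all
  note this[of 1 1] this[of 1 2] this[of 2 2]
  moreover have "Im (A $ 1 $ 1) + Im (A $ 2 $ 2) = 0"
    using arg_cong[OF tr, of Im] by (simp add: trace_def sum_2)
  ultimately have "A = pauli (- 2 * Im (A $ 1 $ 2)) (- 2 * Re (A $ 1 $ 2)) (- 2 * Im (A $ 1 $ 1))"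
    by (simp add: vec_eq_iff forall_2 pauli_nth complex_eq_iff)
  then show "\<exists>p q r. A = pauli p q r" by blast
next
  assume "\<exists>p q r. A = pauli p q r"
  then show "A \<in> su2"
    by (auto simp: su2_def trace_def sum_2 forall_2 pauli_nth complex_eq_iff)
qed

lemma pauli_in_su2: "pauli p q r \<in> su2"
  using su2_pauli by blast

lemma pauli_eq_iff: "pauli p q r = pauli p' q' r' \<longleftrightarrow> p = p' \<and> q = q' \<and> r = r'"
  by (auto simp: vec_eq_iff forall_2 pauli_nth complex_eq_iff)

lemma pauli_linear: "pauli (p + p') (q + q') (r + r') = pauli p q r + pauli p' q' r'"
  "pauli (s * p) (s * q) (s * r) = s *\<^sub>R pauli p q r"
  by (simp_all add: vec_eq_iff forall_2 pauli_nth complex_eq_iff add_divide_distrib)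

text \<open>The three selected coordinates go to \<open>pauli\<close>; a bijection \<open>g\<close>
  onto the other five indices, which exists by counting, names the coordinates of the abelian
  factor.\<close>

lemma is_su2_R5_cross8:
  assumes abc: "distinct [a, b, c]"
  shows "is_su2_R5 (cross8 a b c)"
proof -
  have "card (UNIV :: 5 set) = card (- {a, b, c})"
    using abc by (simp add: Compl_eq_Diff_UNIV card_Diff_subset)
  then obtain g :: "5 \<Rightarrow> 8" where "bij_betw g UNIV (- {a, b, c})"
    using finite_same_card_bij by (metis finite_code)
  then have g: "inj g" "range g = - {a, b, c}"
    by (simp_all add: bij_betw_def)
  define f :: "real^8 \<Rightarrow> (complex^2^2) \<times> (real^5)" where
    "f u = (pauli (u $ a) (u $ b) (u $ c), \<chi> k. u $ g k)" for u
  have ga: "g k \<noteq> a" "g k \<noteq> b" "g k \<noteq> c" for k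
    using g(2) by auto
  have "linear f"
    by (intro linearI) (simp_all add: f_def pauli_linear vec_eq_iff)
  moreover have "inj f"
  proof (rule injI)
    fix u v assume "f u = f v"
    then have eq: "u $ a = v $ a" "u $ b = v $ b" "u $ c = v $ c" "(\<chi> k. u $ g k) = (\<chi> k. v $ g k)"
      by (simp_all add: f_def pauli_eq_iff)
    have "u $ g k = v $ g k" for k
      using arg_cong[OF eq(4), of "\<lambda>w. w $ k"] by simp
    note eq(1-3) this
    moreover have "i = a \<or> i = b \<or> i = c \<or> (\<exists>k. i = g k)" for i
      using g(2) by blast
    ultimately show "u = v" by (metis vec_eq_iff)
  qed
  moreover have "range f = su2 \<times> UNIV"
  proof
    show "range f \<subseteq> su2 \<times> UNIV"
      unfolding f_def using pauli_in_su2 by blast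
    show "su2 \<times> UNIV \<subseteq> range f"
    proof
      fix z assume "z \<in> su2 \<times> (UNIV :: (real^5) set)"
      then obtain p q r y where z: "z = (pauli p q r, y)" by (auto simp: su2_pauli)
      define u where "u = (\<chi> i. if i = a then p else if i = b then q else if i = c then r else y $ inv g i)"
      have "u $ a = p" "u $ b = q" "u $ c = r"
        using abc by (auto simp: u_def)
      moreover have "u $ g k = y $ k" for k
        using ga[of k] by (simp add: u_def inv_f_f[OF g(1)])
      ultimately have "f u = z"
        by (simp add: f_def z)
      then show "z \<in> range f" by blast
    qed
  qed
  moreover have "f (cross8 a b c u v) = (comm (fst (f u)) (fst (f v)), 0)" for u v
    using abc ga by (auto simp: f_def cross8_def comm_pauli axis_def vec_eq_iff pauli_eq_iff)
  ultimately show ?thesis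
    unfolding is_su2_R5_def lie_iso_def
    by (intro exI[of _ f]) (simp add: case_prod_unfold)
qed

text \<open>Multiplying a bracket by \<open>s\<close> gives an isomorphic one through scaling of
  vectors by \<open>s\<close>, which explains the factors inside \<open>pauli\<close>.\<close>

lemma is_su2_su2_R2_cross8:
  assumes abc: "distinct [a, b, c, a', b', c']" and s: "s \<noteq> 0"
  shows "is_su2_su2_R2 (\<lambda>u v. s *\<^sub>R (cross8 a b c u v + cross8 a' b' c' u v))"
proof -
  have "card (UNIV :: 2 set) = card (- {a, b, c, a', b', c'})"
    using abc by (simp add: Compl_eq_Diff_UNIV card_Diff_subset)
  then obtain g :: "2 \<Rightarrow> 8" where "bij_betw g UNIV (- {a, b, c, a', b', c'})"
    using finite_same_card_bij by (metis finite_code)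
  then have g: "inj g" "range g = - {a, b, c, a', b', c'}"
    by (simp_all add: bij_betw_def)
  define f :: "real^8 \<Rightarrow> (complex^2^2) \<times> (complex^2^2) \<times> (real^2)" where
    "f u = (pauli (s * u $ a) (s * u $ b) (s * u $ c), pauli (s * u $ a') (s * u $ b') (s * u $ c'), \<chi> k. u $ g k)" for u
  have ga: "g k \<noteq> a" "g k \<noteq> b" "g k \<noteq> c" "g k \<noteq> a'" "g k \<noteq> b'" "g k \<noteq> c'" for k
    using g(2) by auto
  have "linear f"
    by (intro linearI) (simp_all add: f_def pauli_linear vec_eq_iff distrib_left mult.left_commute[of s])
  moreover have "inj f"
  proof (rule injI)
    fix u v assume "f u = f v"
    then have "u $ a = v $ a" "u $ b = v $ b" "u $ c = v $ c" "u $ a' = v $ a'" "u $ b' = v $ b'" "u $ c' = v $ c'"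
      and eq: "(\<chi> k. u $ g k) = (\<chi> k. v $ g k)"
      using s by (simp_all add: f_def pauli_eq_iff)
    note eqs = this(1-6)
    have geq: "u $ g k = v $ g k" for k
      using arg_cong[OF eq, of "\<lambda>w. w $ k"] by simp
    have cover: "i = a \<or> i = b \<or> i = c \<or> i = a' \<or> i = b' \<or> i = c' \<or> (\<exists>k. i = g k)" for i
      using g(2) by blast
    have "u $ i = v $ i" for i
      using cover[of i] by (elim disjE exE) (simp_all only: eqs geq)
    then show "u = v" by (simp add: vec_eq_iff)
  qed
  moreover have "range f = su2 \<times> su2 \<times> UNIV"
  proof
    show "range f \<subseteq> su2 \<times> su2 \<times> UNIV"
      unfolding f_def using pauli_in_su2 by blast
    show "su2 \<times> su2 \<times> UNIV \<subseteq> range f"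
    proof
      fix z assume "z \<in> su2 \<times> su2 \<times> (UNIV :: (real^2) set)"
      then obtain p q r p' q' r' y where z: "z = (pauli p q r, pauli p' q' r', y)" by (auto simp: su2_pauli)
      define u where "u = (\<chi> i. if i = a then p / s else if i = b then q / s else if i = c then r / s else
        if i = a' then p' / s else if i = b' then q' / s else if i = c' then r' / s else y $ inv g i)"
      have "u $ a = p / s" "u $ b = q / s" "u $ c = r / s" "u $ a' = p' / s" "u $ b' = q' / s" "u $ c' = r' / s"
        using abc by (auto simp: u_def)
      moreover have "u $ g k = y $ k" for k
        using ga[of k] by (simp add: u_def inv_f_f[OF g(1)])
      ultimately have "f u = z"
        using s by (simp add: f_def z)
      then show "z \<in> range f" by blast
    qed
  qed
  moreover have "f (s *\<^sub>R (cross8 a b c u v + cross8 a' b' c' u v)) =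
      (comm (fst (f u)) (fst (f v)), comm (fst (snd (f u))) (fst (snd (f v))), 0)" for u v
    using abc ga by (auto simp: f_def cross8_def comm_pauli axis_def vec_eq_iff pauli_eq_iff algebra_simps)
  ultimately show ?thesis
    unfolding is_su2_su2_R2_def lie_iso_def
    by (intro exI[of _ f]) (simp add: case_prod_unfold)
qed

section \<open>The half-spin representations\<close>

text \<open>
  Octonion multiplication, with the identification of \<open>\<Delta>\<^sub>+\<close> with vectors chosen such that the 3-form
  \<open>e\<^sup>1\<^sup>2\<^sup>3\<close> of \<open>\<Delta>\<^sub>-\<close> corresponds to the identity.
\<close>

definition kprod :: "real^8 \<Rightarrow> real^8 \<Rightarrow> real^8" where
  "kprod v p = vec8
    (- v $ 1 * p $ 4 - v $ 2 * p $ 3 + v $ 3 * p $ 2 + v $ 4 * p $ 1 + v $ 5 * p $ 8 - v $ 6 * p $ 7 + v $ 7 * p $ 6 - v $ 8 * p $ 5)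
    (v $ 1 * p $ 3 - v $ 2 * p $ 4 - v $ 3 * p $ 1 + v $ 4 * p $ 2 + v $ 5 * p $ 7 + v $ 6 * p $ 8 - v $ 7 * p $ 5 - v $ 8 * p $ 6)
    (- v $ 1 * p $ 2 + v $ 2 * p $ 1 - v $ 3 * p $ 4 + v $ 4 * p $ 3 - v $ 5 * p $ 6 + v $ 6 * p $ 5 + v $ 7 * p $ 8 - v $ 8 * p $ 7)
    (- v $ 1 * p $ 1 - v $ 2 * p $ 2 - v $ 3 * p $ 3 - v $ 4 * p $ 4 + v $ 5 * p $ 5 + v $ 6 * p $ 6 + v $ 7 * p $ 7 + v $ 8 * p $ 8)
    (- v $ 1 * p $ 8 - v $ 2 * p $ 7 + v $ 3 * p $ 6 - v $ 4 * p $ 5 - v $ 5 * p $ 4 + v $ 6 * p $ 3 - v $ 7 * p $ 2 - v $ 8 * p $ 1)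
    (v $ 1 * p $ 7 - v $ 2 * p $ 8 - v $ 3 * p $ 5 - v $ 4 * p $ 6 - v $ 5 * p $ 3 - v $ 6 * p $ 4 + v $ 7 * p $ 1 - v $ 8 * p $ 2)
    (- v $ 1 * p $ 6 + v $ 2 * p $ 5 - v $ 3 * p $ 8 - v $ 4 * p $ 7 + v $ 5 * p $ 2 - v $ 6 * p $ 1 - v $ 7 * p $ 4 - v $ 8 * p $ 3)
    (v $ 1 * p $ 5 + v $ 2 * p $ 6 + v $ 3 * p $ 7 - v $ 4 * p $ 8 + v $ 5 * p $ 1 + v $ 6 * p $ 2 + v $ 7 * p $ 3 - v $ 8 * p $ 4)"

text \<open>The transpose of \<open>kprod v\<close>, in explicit form so that Clifford products can
  be evaluated by rewriting.\<close>

definition ktr :: "real^8 \<Rightarrow> real^8 \<Rightarrow> real^8" where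
  "ktr v p = vec8
    (- v $ 1 * p $ 4 + v $ 2 * p $ 3 - v $ 3 * p $ 2 + v $ 4 * p $ 1 + v $ 5 * p $ 8 - v $ 6 * p $ 7 + v $ 7 * p $ 6 - v $ 8 * p $ 5)
    (- v $ 1 * p $ 3 - v $ 2 * p $ 4 + v $ 3 * p $ 1 + v $ 4 * p $ 2 + v $ 5 * p $ 7 + v $ 6 * p $ 8 - v $ 7 * p $ 5 - v $ 8 * p $ 6)
    (v $ 1 * p $ 2 - v $ 2 * p $ 1 - v $ 3 * p $ 4 + v $ 4 * p $ 3 - v $ 5 * p $ 6 + v $ 6 * p $ 5 + v $ 7 * p $ 8 - v $ 8 * p $ 7)
    (- v $ 1 * p $ 1 - v $ 2 * p $ 2 - v $ 3 * p $ 3 - v $ 4 * p $ 4 - v $ 5 * p $ 5 - v $ 6 * p $ 6 - v $ 7 * p $ 7 - v $ 8 * p $ 8)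
    (v $ 1 * p $ 8 + v $ 2 * p $ 7 - v $ 3 * p $ 6 - v $ 4 * p $ 5 + v $ 5 * p $ 4 + v $ 6 * p $ 3 - v $ 7 * p $ 2 - v $ 8 * p $ 1)
    (- v $ 1 * p $ 7 + v $ 2 * p $ 8 + v $ 3 * p $ 5 - v $ 4 * p $ 6 - v $ 5 * p $ 3 + v $ 6 * p $ 4 + v $ 7 * p $ 1 - v $ 8 * p $ 2)
    (v $ 1 * p $ 6 - v $ 2 * p $ 5 + v $ 3 * p $ 8 - v $ 4 * p $ 7 + v $ 5 * p $ 2 - v $ 6 * p $ 1 + v $ 7 * p $ 4 - v $ 8 * p $ 3)
    (- v $ 1 * p $ 5 - v $ 2 * p $ 6 - v $ 3 * p $ 7 - v $ 4 * p $ 8 + v $ 5 * p $ 1 + v $ 6 * p $ 2 + v $ 7 * p $ 3 + v $ 8 * p $ 4)"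

definition spin_K :: "8 \<Rightarrow> real^8^8" where
  "spin_K a = matrix (kprod (ax a))"

lemma kprod_ax:
  "kprod (ax 1) p = vec8 (- p $ 4) (p $ 3) (- p $ 2) (- p $ 1) (- p $ 8) (p $ 7) (- p $ 6) (p $ 5)"
  "kprod (ax 2) p = vec8 (- p $ 3) (- p $ 4) (p $ 1) (- p $ 2) (- p $ 7) (- p $ 8) (p $ 5) (p $ 6)"
  "kprod (ax 3) p = vec8 (p $ 2) (- p $ 1) (- p $ 4) (- p $ 3) (p $ 6) (- p $ 5) (- p $ 8) (p $ 7)"
  "kprod (ax 4) p = vec8 (p $ 1) (p $ 2) (p $ 3) (- p $ 4) (- p $ 5) (- p $ 6) (- p $ 7) (- p $ 8)"
  "kprod (ax 5) p = vec8 (p $ 8) (p $ 7) (- p $ 6) (p $ 5) (- p $ 4) (- p $ 3) (p $ 2) (p $ 1)"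
  "kprod (ax 6) p = vec8 (- p $ 7) (p $ 8) (p $ 5) (p $ 6) (p $ 3) (- p $ 4) (- p $ 1) (p $ 2)"
  "kprod (ax 7) p = vec8 (p $ 6) (- p $ 5) (p $ 8) (p $ 7) (- p $ 2) (p $ 1) (- p $ 4) (p $ 3)"
  "kprod (ax 8) p = vec8 (- p $ 5) (- p $ 6) (- p $ 7) (p $ 8) (- p $ 1) (- p $ 2) (- p $ 3) (- p $ 4)"
  by (simp_all add: kprod_def vec_eq_8 ax_nth)

lemma ktr_ax:
  "ktr (ax 1) p = vec8 (- p $ 4) (- p $ 3) (p $ 2) (- p $ 1) (p $ 8) (- p $ 7) (p $ 6) (- p $ 5)"
  "ktr (ax 2) p = vec8 (p $ 3) (- p $ 4) (- p $ 1) (- p $ 2) (p $ 7) (p $ 8) (- p $ 5) (- p $ 6)"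
  "ktr (ax 3) p = vec8 (- p $ 2) (p $ 1) (- p $ 4) (- p $ 3) (- p $ 6) (p $ 5) (p $ 8) (- p $ 7)"
  "ktr (ax 4) p = vec8 (p $ 1) (p $ 2) (p $ 3) (- p $ 4) (- p $ 5) (- p $ 6) (- p $ 7) (- p $ 8)"
  "ktr (ax 5) p = vec8 (p $ 8) (p $ 7) (- p $ 6) (- p $ 5) (p $ 4) (- p $ 3) (p $ 2) (p $ 1)"
  "ktr (ax 6) p = vec8 (- p $ 7) (p $ 8) (p $ 5) (- p $ 6) (p $ 3) (p $ 4) (- p $ 1) (p $ 2)"
  "ktr (ax 7) p = vec8 (p $ 6) (- p $ 5) (p $ 8) (- p $ 7) (- p $ 2) (p $ 1) (p $ 4) (p $ 3)"
  "ktr (ax 8) p = vec8 (- p $ 5) (- p $ 6) (- p $ 7) (- p $ 8) (- p $ 1) (- p $ 2) (- p $ 3) (p $ 4)"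
  by (simp_all add: ktr_def vec_eq_8 ax_nth)

lemma transpose_mult: "transpose M *v p = (\<chi> j. (M *v ax j) \<bullet> p)" for M :: "real^8^8"
  by (simp add: vec_eq_iff vector_matrix_mult_def matrix_vector_mult_basis column_def inner_vec_def mult.commute)

lemma linear_kprod: "linear (kprod v)" "linear (\<lambda>v. kprod v p)"
  by (intro linearI; simp add: kprod_def vec_eq_8 algebra_simps)+

lemma cliff_spin_K: "cliff spin_K v (p, q) = (- ktr v q, kprod v p)"
proof -
  let ?M = "\<Sum>a\<in>UNIV. v $ a *\<^sub>R spin_K a"
  have "?M *v p = (\<Sum>a\<in>UNIV. v $ a *\<^sub>R kprod (ax a) p)" for p
  proof -
    have "spin_K a *v p = kprod (ax a) p" for a
      unfolding spin_K_def by (rule fun_cong[OF matrix_vector_mul(2)[OF linear_kprod(1)]])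
    moreover have lin: "linear (\<lambda>M :: real^8^8. M *v p)"
      by (intro linearI) (auto simp: matrix_vector_mult_add_rdistrib scaleR_matrix_vector_assoc)
    ultimately show ?thesis
      by (simp add: linear_sum[OF lin] linear_cmul[OF lin])
  qed
  then have M: "?M *v p = kprod v p" for p
    by (simp add: linear_expand_8[OF linear_kprod(2)[of p], of v])
  have "transpose ?M *v q = ktr v q"
    unfolding transpose_mult M by (simp add: vec_eq_8 kprod_def ktr_def inner_8 ax_nth)
  then show ?thesis
    unfolding cliff_def Let_def using M by simp
qed

lemma half_spin_rep_spin_K: "half_spin_rep spin_K"
  unfolding half_spin_rep_def
proof (intro conjI allI)
  fix v and s :: spinor
  obtain p q where s: "s = (p, q)" by (cases s)
  have "ktr v (kprod v p) = (v \<bullet> v) *\<^sub>R p" "kprod v (ktr v q) = (v \<bullet> v) *\<^sub>R q"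
    unfolding vec_eq_8 vector_scaleR_component inner_8 kprod_def ktr_def vec8_nth
    by (intro conjI; simp add: algebra_simps)+
  moreover have "kprod v (- q) = - kprod v q" for q
    by (rule linear_neg[OF linear_kprod(1)])
  ultimately show "cliff spin_K v (cliff spin_K v s) = - (v \<bullet> v) *\<^sub>R s"
    by (simp add: s cliff_spin_K)
next
  fix p
  show "foldr (\<lambda>a s. cliff spin_K (ax a) s) idx8 (p, 0) = (p, 0)"
    by (simp add: idx8_def cliff_spin_K kprod_ax ktr_ax vec_eq_8)
qed

lemma in_cliff_kernel_spin_K: "in_cliff_kernel spin_K (mat 1)"
  by (simp add: in_cliff_kernel_def sum_8 cliff_spin_K kprod_ax ktr_ax ax_nth vec_eq_8 zero_prod_def)

lemma minus_mult_mult: "minus_mult spin_K q *v v = - ktr v q"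
proof -
  have "linear (\<lambda>v. - ktr v q)"
    by (intro linearI) (simp_all add: ktr_def vec_eq_8 algebra_simps)
  then show ?thesis
    unfolding minus_mult_def cliff_spin_K fst_conv by (rule fun_cong[OF matrix_vector_mul(2)])
qed

lemma minus_mult_spin_K:
  "minus_mult spin_K (ax 1) *v v = vec8 (- v $ 4) (- v $ 3) (v $ 2) (v $ 1) (v $ 8) (- v $ 7) (v $ 6) (- v $ 5)"
  "minus_mult spin_K (ax 2) *v v = vec8 (v $ 3) (- v $ 4) (- v $ 1) (v $ 2) (v $ 7) (v $ 8) (- v $ 5) (- v $ 6)"
  "minus_mult spin_K (ax 3) *v v = vec8 (- v $ 2) (v $ 1) (- v $ 4) (v $ 3) (- v $ 6) (v $ 5) (v $ 8) (- v $ 7)"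
  by (simp_all add: minus_mult_mult ktr_def vec_eq_8 ax_nth)

lemma transpose_minus_mult_spin_K:
  "transpose (minus_mult spin_K (ax 1)) *v p = vec8 (p $ 4) (p $ 3) (- p $ 2) (- p $ 1) (- p $ 8) (p $ 7) (- p $ 6) (p $ 5)"
  "transpose (minus_mult spin_K (ax 2)) *v p = vec8 (- p $ 3) (p $ 4) (p $ 1) (- p $ 2) (- p $ 7) (- p $ 8) (p $ 5) (p $ 6)"
  "transpose (minus_mult spin_K (ax 3)) *v p = vec8 (p $ 2) (- p $ 1) (p $ 4) (- p $ 3) (p $ 6) (- p $ 5) (- p $ 8) (p $ 7)"
  unfolding transpose_mult by (simp_all add: minus_mult_spin_K inner_8 vec_eq_8 ax_nth)

text \<open>The product is 1 for the even orderings of the three spinors and -1 for the odd ones, so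
  all six signed terms agree and the factor 1/6 leaves the identity.\<close>

lemma triality3_e3: "triality3 spin_K (e3 1 2 3) = mat 1"
proof -
  let ?m = "\<lambda>i. minus_mult spin_K (ax i)"
  have "?m 1 ** transpose (?m 2) ** ?m 3 = mat 1" "?m 2 ** transpose (?m 3) ** ?m 1 = mat 1"
    "?m 3 ** transpose (?m 1) ** ?m 2 = mat 1"
    "?m 1 ** transpose (?m 3) ** ?m 2 = - mat 1" "?m 3 ** transpose (?m 2) ** ?m 1 = - mat 1"
    "?m 2 ** transpose (?m 1) ** ?m 3 = - mat 1"
    unfolding matrix_eq
    by (intro allI; simp add: matrix_vector_mul_assoc[symmetric] minus_mult_spin_K transpose_minus_mult_spin_K vec_eq_8
        minus_matrix_vector_mult del: transpose_matrix_vector)+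
  moreover have "(1/6) *\<^sub>R (I - - I - - I + I + I - - I) = I" for I :: "real^8^8"
    by (simp add: vec_eq_iff)
  ultimately show ?thesis
    unfolding triality3_def sum_e3 by (simp only:)
qed

lemma type3_plus_at_spin_K: "type3_plus_at spin_K (mat 1)"
  unfolding type3_plus_at_def
proof (intro conjI exI[of _ "e3 1 2 3"] exI[of _ "cross8 1 2 3"] exI[of _ "1 :: real"] allI)
  show "is_su2_R5 (cross8 1 2 3)" "norm_sq3 (mat 1) (e3 1 2 3) = 1"
    by (rule is_su2_R5_cross8 norm_sq3_e3; simp)+
qed (simp_all add: orthogonal_matrix_id in_cliff_kernel_spin_K alt_form_e3 triality3_e3 cross8_e3)

section \<open>Salamon's nilpotent group\<close>

text \<open>Rotation by one angle in the planes 25 and 47, with cosine \<open>c\<close> and sine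
  \<open>s\<close>.\<close>

definition rot :: "real \<Rightarrow> real \<Rightarrow> real^8 \<Rightarrow> real^8" where
  "rot c s v = vec8 (v $ 1) (c * v $ 2 - s * v $ 5) (v $ 3) (c * v $ 4 - s * v $ 7)
     (s * v $ 2 + c * v $ 5) (v $ 6) (s * v $ 4 + c * v $ 7) (v $ 8)"

definition rot_mat :: "real \<Rightarrow> real \<Rightarrow> real^8^8" where
  "rot_mat c s = matrix (rot c s)"

lemma rot_mat_mult: "rot_mat c s *v v = rot c s v"
proof -
  have "linear (rot c s)"
    by (intro linearI) (simp_all add: rot_def vec_eq_8 algebra_simps)
  then show ?thesis
    unfolding rot_mat_def by (rule fun_cong[OF matrix_vector_mul(2)])
qed

lemma rot_mat_mul: "rot_mat c s ** rot_mat c' s' = rot_mat (c * c' - s * s') (c * s' + s * c')"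
  by (simp add: matrix_eq matrix_vector_mul_assoc[symmetric] rot_mat_mult rot_def vec_eq_8 algebra_simps)

lemma rot_mat_1: "rot_mat 1 0 = mat 1"
  by (simp add: matrix_eq rot_mat_mult rot_def vec_eq_8)

lemma rot_mat_inverse: "rot_mat (1/2) (sqrt 3 / 2) ** rot_mat (1/2) (- (sqrt 3 / 2)) = mat 1"
  by (simp add: rot_mat_mul rot_mat_1)

text \<open>The rotation by 60 degrees is the square of the one by 30 degrees, so its nonzero
  determinant is a square.\<close>

lemma det_rot_mat: "det (rot_mat (1/2) (sqrt 3 / 2)) > 0"
proof -
  have "rot_mat (sqrt 3 / 2) (1/2) ** rot_mat (sqrt 3 / 2) (1/2) = rot_mat (1/2) (sqrt 3 / 2)"
    by (simp add: rot_mat_mul)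
  then have "det (rot_mat (1/2) (sqrt 3 / 2)) = (det (rot_mat (sqrt 3 / 2) (1/2)))\<^sup>2"
    by (metis det_mul power2_eq_square)
  moreover have "det (rot_mat (1/2) (sqrt 3 / 2)) \<noteq> 0"
    using arg_cong[OF rot_mat_inverse, of det] by (auto simp: det_mul)
  ultimately show ?thesis by (simp add: zero_less_power2)
qed

text \<open>The nonzero brackets are \<open>[f\<^sub>7, f\<^sub>5] = f\<^sub>1\<close> and \<open>[f\<^sub>6, f\<^sub>7] = f\<^sub>2\<close>; the frame \<open>f\<close> makes an angle of 60 degrees
  with a quaternionic one in the planes 25 and 47.\<close>

definition sal_B :: "real^8 \<Rightarrow> real^8 \<Rightarrow> real^8" where
  "sal_B x y = vec8 (x $ 7 * y $ 5) (x $ 6 * y $ 7) 0 0 0 0 0 0"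

text \<open>The matrix \<open>R\<close> is a rotation, so it leaves the metric
  \<open>transpose P ** P\<close> as it is. It changes the frame in which \<open>\<gamma>\<close> is
  the identity, hence the structure; at this angle the Dirac operator vanishes on it.\<close>

interpretation sal: nil_coframe sal_B "{1, 2}" "rot_mat (1/2) (sqrt 3 / 2)" "rot_mat (1/2) (- (sqrt 3 / 2))"
proof
  show "bilinear sal_B"
    by (auto simp: bilinear_def sal_B_def vec_eq_8 algebra_simps intro!: linearI)
  show "k \<notin> {1, 2} \<Longrightarrow> sal_B x y $ k = 0" for k x y
    by (simp add: sal_B_def vec8_def)
  show "(\<And>k. x $ k \<in> \<int>) \<Longrightarrow> (\<And>k. y $ k \<in> \<int>) \<Longrightarrow> sal_B x y $ k \<in> \<int>" for k x y
    by (simp add: sal_B_def vec8_def)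
qed (simp_all add: sal_B_def vec_eq_8 rot_mat_inverse det_rot_mat)

lemma sal_L: "sal.L X Y = vec8
    (- (3 / 4 * (X $ 2 * Y $ 4 - X $ 4 * Y $ 2)) + sqrt 3 / 4 * (X $ 2 * Y $ 7 - X $ 7 * Y $ 2) - sqrt 3 / 4 * (X $ 4 * Y $ 5 - X $ 5 * Y $ 4) - (X $ 5 * Y $ 7 - X $ 7 * Y $ 5) / 4)
    (sqrt 3 / 4 * (X $ 4 * Y $ 6 - X $ 6 * Y $ 4) + (X $ 6 * Y $ 7 - X $ 7 * Y $ 6) / 4)
    0 0
    (3 / 4 * (X $ 4 * Y $ 6 - X $ 6 * Y $ 4) + sqrt 3 / 4 * (X $ 6 * Y $ 7 - X $ 7 * Y $ 6))
    0 0 0"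
  by (simp add: sal.L_def rot_mat_mult rot_def sal_B_def vec_eq_8 field_simps sqrt_3_mult)

lemma koszul_sal: "koszul sal.L X Y = vec8
    (- (3 / 8 * X $ 2 * Y $ 4) + sqrt 3 / 8 * X $ 2 * Y $ 7 + 3 / 8 * X $ 4 * Y $ 2 - sqrt 3 / 8 * X $ 4 * Y $ 5 + sqrt 3 / 8 * X $ 5 * Y $ 4 - X $ 5 * Y $ 7 / 8 - sqrt 3 / 8 * X $ 7 * Y $ 2 + X $ 7 * Y $ 5 / 8)
    (- (3 / 8 * X $ 1 * Y $ 4) + sqrt 3 / 8 * X $ 1 * Y $ 7 - 3 / 8 * X $ 4 * Y $ 1 + sqrt 3 / 8 * X $ 4 * Y $ 6 - sqrt 3 / 8 * X $ 6 * Y $ 4 + X $ 6 * Y $ 7 / 8 + sqrt 3 / 8 * X $ 7 * Y $ 1 - X $ 7 * Y $ 6 / 8)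
    0
    (3 / 8 * X $ 1 * Y $ 2 - sqrt 3 / 8 * X $ 1 * Y $ 5 + 3 / 8 * X $ 2 * Y $ 1 + sqrt 3 / 8 * X $ 2 * Y $ 6 - sqrt 3 / 8 * X $ 5 * Y $ 1 + 3 / 8 * X $ 5 * Y $ 6 + sqrt 3 / 8 * X $ 6 * Y $ 2 + 3 / 8 * X $ 6 * Y $ 5)
    (sqrt 3 / 8 * X $ 1 * Y $ 4 - X $ 1 * Y $ 7 / 8 + sqrt 3 / 8 * X $ 4 * Y $ 1 + 3 / 8 * X $ 4 * Y $ 6 - 3 / 8 * X $ 6 * Y $ 4 + sqrt 3 / 8 * X $ 6 * Y $ 7 - X $ 7 * Y $ 1 / 8 - sqrt 3 / 8 * X $ 7 * Y $ 6)
    (- (sqrt 3 / 8 * X $ 2 * Y $ 4) + X $ 2 * Y $ 7 / 8 - sqrt 3 / 8 * X $ 4 * Y $ 2 - 3 / 8 * X $ 4 * Y $ 5 - 3 / 8 * X $ 5 * Y $ 4 + sqrt 3 / 8 * X $ 5 * Y $ 7 + X $ 7 * Y $ 2 / 8 + sqrt 3 / 8 * X $ 7 * Y $ 5)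
    (- (sqrt 3 / 8 * X $ 1 * Y $ 2) + X $ 1 * Y $ 5 / 8 - sqrt 3 / 8 * X $ 2 * Y $ 1 - X $ 2 * Y $ 6 / 8 + X $ 5 * Y $ 1 / 8 - sqrt 3 / 8 * X $ 5 * Y $ 6 - X $ 6 * Y $ 2 / 8 - sqrt 3 / 8 * X $ 6 * Y $ 5)
    0"
  by (simp add: vec_eq_8 koszul_def sal_L inner_8 ax_nth field_simps)

lemma sal_spin_conn:
  "sal.spin_conn spin_K (ax 1) p = (vec8
    (- p $ 3)
    (- (p $ 4 / 2) - sqrt 3 / 2 * p $ 7)
    (p $ 1)
    (p $ 2 / 2 + sqrt 3 / 2 * p $ 5)
    (- (sqrt 3 / 2 * p $ 4) + p $ 7 / 2)
    (p $ 8)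
    (sqrt 3 / 2 * p $ 2 - p $ 5 / 2)
    (- p $ 6), 0)"
  "sal.spin_conn spin_K (ax 2) p = (vec8
    (- (p $ 4 / 2) - sqrt 3 / 2 * p $ 7)
    (p $ 3)
    (- p $ 2)
    (p $ 1 / 2 - sqrt 3 / 2 * p $ 6)
    (p $ 8)
    (sqrt 3 / 2 * p $ 4 - p $ 7 / 2)
    (sqrt 3 / 2 * p $ 1 + p $ 6 / 2)
    (- p $ 5), 0)"
  "sal.spin_conn spin_K (ax 3) p = (vec8 0 0 0 0 0 0 0 0, 0)"
  "sal.spin_conn spin_K (ax 4) p = (vec8
    (3 / 2 * p $ 2 + sqrt 3 / 2 * p $ 5)
    (- (3 / 2 * p $ 1) - sqrt 3 / 2 * p $ 6)
    0 0
    (- (sqrt 3 / 2 * p $ 1) + 3 / 2 * p $ 6)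
    (sqrt 3 / 2 * p $ 2 - 3 / 2 * p $ 5)
    0 0, 0)"
  "sal.spin_conn spin_K (ax 5) p = (vec8
    (sqrt 3 / 2 * p $ 4 - p $ 7 / 2)
    (p $ 8)
    (p $ 5)
    (- (sqrt 3 / 2 * p $ 1) - p $ 6 / 2)
    (- p $ 3)
    (p $ 4 / 2 + sqrt 3 / 2 * p $ 7)
    (p $ 1 / 2 - sqrt 3 / 2 * p $ 6)
    (- p $ 2), 0)"
  "sal.spin_conn spin_K (ax 6) p = (vec8
    (p $ 8)
    (- (sqrt 3 / 2 * p $ 4) + p $ 7 / 2)
    (- p $ 6)
    (sqrt 3 / 2 * p $ 2 - p $ 5 / 2)
    (p $ 4 / 2 + sqrt 3 / 2 * p $ 7)
    (p $ 3)
    (- (p $ 2 / 2) - sqrt 3 / 2 * p $ 5)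
    (- p $ 1), 0)"
  "sal.spin_conn spin_K (ax 7) p = (vec8
    (- (sqrt 3 / 2 * p $ 2) - p $ 5 / 2)
    (sqrt 3 / 2 * p $ 1 + p $ 6 / 2)
    0 0
    (p $ 1 / 2 - sqrt 3 / 2 * p $ 6)
    (- (p $ 2 / 2) + sqrt 3 / 2 * p $ 5)
    0 0, 0)"
  "sal.spin_conn spin_K (ax 8) p = (vec8 0 0 0 0 0 0 0 0, 0)"
  unfolding sal.spin_conn_def
  by (simp_all add: sum_8 cliff_spin_K koszul_sal kprod_ax ktr_ax ax_nth vec_eq_8 inner_axis zero_prod_def)

text \<open>The expression is linear in the vector that \<open>\<gamma>\<close> is applied to, and
  by the table for \<open>spin_conn\<close> it cancels coordinate by coordinate for a symbolic
  vector \<open>p\<close>.\<close>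

lemma sal_dirac: "twisted_dirac spin_K sal.G sal.E (\<lambda>x. mat 1) x b = 0"
proof -
  have "(\<Sum>i\<in>UNIV. cliff spin_K (ax i) ((- koszul sal.L (ax i) p, 0) + (1/4) *\<^sub>R sal.spin_conn spin_K (ax i) p)) = 0" for p
    unfolding sum_8 sal_spin_conn koszul_sal
    by (simp add: cliff_spin_K kprod_ax ktr_ax ax_nth vec_eq_8 zero_prod_def algebra_simps)
  then show ?thesis
    unfolding sal.twisted_dirac_E by simp
qed

text \<open>For this index and direction the \<open>koszul\<close> part is zero, and the spin part
  leaves a quarter of the third basis spinor.\<close>

lemma sal_nabla_gamma: "nabla_gamma spin_K sal.G sal.E (\<lambda>x. mat 1) x (sal.E x *v ax 5) 5 \<noteq> 0"
  unfolding sal.nabla_gamma_E sal_spin_conn koszul_sal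
  by (simp add: zero_prod_def vec_eq_8 ax_nth)

section \<open>Integrable structures\<close>

lemma compact_psu3_not_einstein:
  "\<exists>(X :: point topology) A g \<rho> T. integrable_psu3 X A g \<rho> \<and> compact_space X \<and>
     psu3_torsion A g \<rho> T \<and> \<not> torsion_zero A T \<and> \<not> einstein A g"
proof -
  obtain T where T: "psu3_torsion nil.atlas (\<lambda>c. nil.G) (\<lambda>c. nil.pull rho0) T"
    using nil.psu3_torsion_exists[OF alt_form_rho0] ..
  have 0: "nil.nil_chart 0 \<in> nil.atlas" "0 \<in> cdom (nil.nil_chart 0)"
    by (simp_all add: nil.atlas_def nil.cdom_nil_chart nil.nbh_def)
  show ?thesis
  proof (intro exI conjI)
    show "integrable_psu3 nil.quotient nil.atlas (\<lambda>c. nil.G) (\<lambda>c. nil.pull rho0)"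
      unfolding integrable_psu3_def
      using nil.psu3_structure_pull[OF nil.oriented_quotient nil.invariant_quotient alt_form_rho0]
        nil.integrable3_pull[OF alt_form_rho0 nil_d_form nil_coclosed] ..
    show "compact_space nil.quotient" by (rule nil.compact_quotient)
    show "psu3_torsion nil.atlas (\<lambda>c. nil.G) (\<lambda>c. nil.pull rho0) T" by (rule T)
    show "\<not> torsion_zero nil.atlas T"
      by (rule nil.psu3_torsion_nonzero[OF alt_form_rho0 T nil.not_parallel3_pull[OF alt_form_rho0 nil_not_parallel 0]]) simp
    show "\<not> einstein nil.atlas (\<lambda>c. nil.G)"
    proof
      assume "einstein nil.atlas (\<lambda>c. nil.G)"
      then obtain \<kappa> where "\<And>v w. ricci nil.G 0 v w = \<kappa> * ip (nil.G 0) v w"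
        unfolding einstein_def using 0 by blast
      from this[of "ax 8" "ax 8"] this[of "ax 1" "ax 1"] show False
        by (simp add: nil_ricci nil.ip_G nil.P_mult nil_B_def)
    qed
  qed
qed

lemma parallel_psu3_not_ricci_flat:
  "\<exists>(X :: point topology) A g \<rho> T. integrable_psu3 X A g \<rho> \<and> psu3_torsion A g \<rho> T \<and> torsion_zero A T
     \<and> \<not> ricci_flat A g"
proof (intro exI conjI)
  show "integrable_psu3 (euclidean :: point topology) {std_chart} (\<lambda>c. sym.G) (\<lambda>c. sym.pull rho0)"
    unfolding integrable_psu3_def
    using sym.psu3_structure_pull[OF std_oriented_manifold8 sym.invariant_std alt_form_rho0]
      sym.integrable3_pull[OF alt_form_rho0 sym.parallel_form_closed[OF sym_parallel]
        sym.parallel_form_coclosed[OF sym_parallel]] ..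
  show "psu3_torsion {std_chart} (\<lambda>c. sym.G) (\<lambda>c. sym.pull rho0) (\<lambda>c x u. 0)"
    by (rule sym.psu3_torsion_0[OF alt_form_rho0 sym_parallel])
  show "torsion_zero {std_chart} (\<lambda>c x u. 0)"
    by (simp add: torsion_zero_def)
  show "\<not> ricci_flat {std_chart} (\<lambda>c. sym.G)"
  proof
    assume "ricci_flat {std_chart} (\<lambda>c. sym.G)"
    then have "ricci sym.G 0 (ax 3) (ax 3) = 0"
      by (simp add: ricci_flat_def std_chart)
    then show False by (simp add: sym_ricci)
  qed
qed

lemma np_ricci_flat: "ricci_flat A (\<lambda>c. np.G)"
  by (simp add: ricci_flat_def np_ricci)

lemma np_not_parallel3:
  assumes "alt_form 3 \<omega>" "\<not> np.parallel_form \<omega>"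
  shows "\<not> parallel3 {std_chart} (\<lambda>c. np.G) (\<lambda>c. np.pull \<omega>)"
proof (rule np.not_parallel3_pull[OF assms])
  show "std_chart \<in> {std_chart}" "0 \<in> cdom std_chart" "np_h 0 \<noteq> 0"
    using np_h_pos[of 0] by (simp_all add: std_chart)
qed

lemma ricci_flat_psu3_not_parallel:
  "\<exists>(X :: point topology) A g \<rho> T. integrable_psu3 X A g \<rho> \<and> \<not> compact_space X \<and>
     psu3_torsion A g \<rho> T \<and> \<not> torsion_zero A T \<and> ricci_flat A g"
proof -
  obtain T where T: "psu3_torsion {std_chart} (\<lambda>c. np.G) (\<lambda>c. np.pull rho0) T"
    using np.psu3_torsion_exists[OF alt_form_rho0] ..
  show ?thesis
  proof (intro exI conjI)
    show "integrable_psu3 (euclidean :: point topology) {std_chart} (\<lambda>c. np.G) (\<lambda>c. np.pull rho0)"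
      unfolding integrable_psu3_def
      using np.psu3_structure_pull[OF std_oriented_manifold8 np.invariant_std alt_form_rho0]
        np.integrable3_pull[OF alt_form_rho0 np_d_form(1) np_coclosed(1)] ..
    show "\<not> torsion_zero {std_chart} T"
      by (rule np.psu3_torsion_nonzero[OF alt_form_rho0 T np_not_parallel3[OF alt_form_rho0 np_not_parallel(1)]])
  qed (rule not_compact_euclidean T np_ricci_flat)+
qed

lemma compact_type3_plus_not_parallel:
  "\<exists>K (X :: point topology) A g E \<sigma> \<gamma>. integrable_type3_plus K X A g E \<sigma> \<gamma> \<and> compact_space X \<and>
     \<not> parallel_gamma K A g E \<gamma>"
proof (intro exI conjI)
  show "integrable_type3_plus spin_K sal.quotient sal.atlas (\<lambda>c. sal.G) (\<lambda>c. sal.E) (\<lambda>c d x. id) (\<lambda>c x. mat 1)"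
    unfolding integrable_type3_plus_def
    using sal.type3_plus_structure_E[OF sal.oriented_quotient sal.invariant_quotient half_spin_rep_spin_K
        type3_plus_at_spin_K] sal_dirac by blast
  show "compact_space sal.quotient" by (rule sal.compact_quotient)
  have "sal.nil_chart 0 \<in> sal.atlas" "0 \<in> cdom (sal.nil_chart 0)"
    by (simp_all add: sal.atlas_def sal.cdom_nil_chart sal.nbh_def)
  then show "\<not> parallel_gamma spin_K sal.atlas (\<lambda>c. sal.G) (\<lambda>c. sal.E) (\<lambda>c x. mat 1)"
    unfolding parallel_gamma_def using sal_nabla_gamma by blast
qed

text \<open>Types 2_0 and 3_0 differ only in the 3-form and its bracket, on the same Gibbons-Hawking
  product.\<close>

lemma ricci_flat_bracket_structure:
  assumes "alt_form 3 \<omega>" "norm_sq3 (mat 1) \<omega> = 1" "\<And>a b c d. np.d_form \<omega> [a, b, c, d] = 0"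
    "np.coclosed \<omega>" "\<not> np.parallel_form \<omega>" "\<And>u v w. br u v \<bullet> w = \<omega> [u, v, w]"
    and Q: "\<And>x. Q (\<lambda>u v. np.E x *v br (np.P x *v u) (np.P x *v v))"
  shows "\<exists>(X :: point topology) A g \<rho>. (bracket_structure Q X A g \<rho> \<and> integrable3 A g \<rho>) \<and> \<not> compact_space X \<and>
     \<not> parallel3 A g \<rho> \<and> ricci_flat A g"
proof (intro exI conjI)
  show "bracket_structure Q (euclidean :: point topology) {std_chart} (\<lambda>c. np.G) (\<lambda>c. np.pull \<omega>)"
    by (rule np.bracket_structure_pull[where br = br]) (fact std_oriented_manifold8 np.invariant_std assms)+
  show "integrable3 {std_chart} (\<lambda>c. np.G) (\<lambda>c. np.pull \<omega>)"
    by (rule np.integrable3_pull[OF assms(1,3,4)])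
  show "\<not> parallel3 {std_chart} (\<lambda>c. np.G) (\<lambda>c. np.pull \<omega>)"
    by (rule np_not_parallel3[OF assms(1,5)])
qed (rule not_compact_euclidean np_ricci_flat)+

lemma ricci_flat_type2_0_not_parallel:
  "\<exists>(X :: point topology) A g \<rho>. integrable_type2_0 X A g \<rho> \<and> \<not> compact_space X \<and>
     \<not> parallel3 A g \<rho> \<and> ricci_flat A g"
  unfolding integrable_type2_0_def
proof (rule ricci_flat_bracket_structure)
  \<comment> \<open>Two flat directions, 1 and 2, are paired with the closed forms
    \<open>e^45\<close> and \<open>e^67\<close>. The two summands are orthonormal, hence the factor;
    the indices 3 and 8 span the abelian part.\<close>
  let ?w = "\<lambda>vs. 1 / sqrt 2 * (e3 1 4 5 vs + e3 2 6 7 vs)"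
  let ?br = "\<lambda>u v. (1 / sqrt 2) *\<^sub>R (cross8 1 4 5 u v + cross8 2 6 7 u v)"
  show w: "alt_form 3 ?w"
    by (intro alt_form_scale alt_form_add alt_form_e3)
  show "norm_sq3 (mat 1) ?w = 1"
    by (rule norm_sq3_e3_add) simp
  have "np.d_form ?w [a, b, c, d] = 1 / sqrt 2 * (np.d_form (e3 1 4 5) [a, b, c, d] + np.d_form (e3 2 6 7) [a, b, c, d])"
    for a b c d
    unfolding np.d_form_4[OF w] np.d_form_4[OF alt_form_e3] by (simp only: algebra_simps)
  then show "np.d_form ?w [a, b, c, d] = 0" for a b c d
    by (simp add: np_d_form)
  show "np.coclosed ?w"
    by (rule np.coclosed_lincomb np_coclosed)+
  show "\<not> np.parallel_form ?w"
    by (rule np_not_parallel)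
  show "?br u v \<bullet> w = ?w [u, v, w]" for u v w
    by (simp only: inner_scaleR_left inner_add_left cross8_e3)
  show "is_su2_su2_R2 (\<lambda>u v. np.E x *v ?br (np.P x *v u) (np.P x *v v))" for x
    unfolding is_su2_su2_R2_def
    by (rule lie_iso_conj[OF _ np.P_E], fold is_su2_su2_R2_def, rule is_su2_su2_R2_cross8) simp_all
qed

lemma ricci_flat_type3_0_not_parallel:
  "\<exists>(X :: point topology) A g \<rho>. integrable_type3_0 X A g \<rho> \<and> \<not> compact_space X \<and>
     \<not> parallel3 A g \<rho> \<and> ricci_flat A g"
  unfolding integrable_type3_0_def
proof (rule ricci_flat_bracket_structure)
  show "norm_sq3 (mat 1) (e3 1 4 5) = 1"
    by (rule norm_sq3_e3) simp
  show "is_su2_R5 (\<lambda>u v. np.E x *v cross8 1 4 5 (np.P x *v u) (np.P x *v v))" for x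
    unfolding is_su2_R5_def
    by (rule lie_iso_conj[OF _ np.P_E], fold is_su2_R5_def, rule is_su2_R5_cross8) simp
qed (rule alt_form_e3 np_d_form np_coclosed np_not_parallel cross8_e3)+

theorem proposition3p13:
  shows
    "((\<exists>(X :: point topology) A g \<rho> T.
         integrable_psu3 X A g \<rho> \<and> compact_space X \<and>
         psu3_torsion A g \<rho> T \<and> \<not> torsion_zero A T \<and> \<not> einstein A g) \<and>
      \<not> (\<forall>(X :: point topology) A g \<rho> T.
         integrable_psu3 X A g \<rho> \<and> psu3_torsion A g \<rho> T \<and> torsion_zero A T \<longrightarrow> ricci_flat A g) \<and>
      (\<exists>(X :: point topology) A g \<rho> T.
         integrable_psu3 X A g \<rho> \<and> \<not> compact_space X \<and>
         psu3_torsion A g \<rho> T \<and> \<not> torsion_zero A T \<and> ricci_flat A g)) \<and>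
     ((\<exists>K (X :: point topology) A g E \<sigma> \<gamma>.
         integrable_type3_plus K X A g E \<sigma> \<gamma> \<and> compact_space X \<and>
         \<not> parallel_gamma K A g E \<gamma>) \<and>
      (\<exists>(X :: point topology) A g \<rho>.
         integrable_type2_0 X A g \<rho> \<and> \<not> compact_space X \<and>
         \<not> parallel3 A g \<rho> \<and> ricci_flat A g) \<and>
      (\<exists>(X :: point topology) A g \<rho>.
         integrable_type3_0 X A g \<rho> \<and> \<not> compact_space X \<and>
         \<not> parallel3 A g \<rho> \<and> ricci_flat A g))"
proof (intro conjI compact_psu3_not_einstein ricci_flat_psu3_not_parallel compact_type3_plus_not_parallel
    ricci_flat_type2_0_not_parallel ricci_flat_type3_0_not_parallel notI)
  assume *: "\<forall>(X :: point topology) A g \<rho> T.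
         integrable_psu3 X A g \<rho> \<and> psu3_torsion A g \<rho> T \<and> torsion_zero A T \<longrightarrow> ricci_flat A g"
  obtain X :: "point topology" and A g \<rho> T where "integrable_psu3 X A g \<rho>" "psu3_torsion A g \<rho> T" "torsion_zero A T"
    "\<not> ricci_flat A g"
    using parallel_psu3_not_ricci_flat by (elim exE conjE)
  then show False using * by (elim allE notE impE) (intro conjI)
qed

end
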